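(* Let $S(\lambda,t_2)$ be a $\mathbb C^{p\times p}$-valued function, analytic at $\lambda=\infty$ with value $I$ there, and symmetric with respect to the imaginary axis, i.e. $$S(\lambda,t_2)=\sigma_1^{-1}(t_2)\big(S(-\bar\lambda,t_2)^{-1}\big)^*\sigma_1(t_2).$$ Then there exists a (Krein space) realization $$S(\lambda,t_2)=I-B(t_2)^*\mathbb X^{-1}(t_2)(\lambda I-A_1)^{-1}B(t_2)\sigma_1(t_2)$$ such that the Lyapunov equation holds: $$A_1\mathbb X(t_2)+\mathbb X(t_2)A_1^*+B(t_2)\sigma_1(t_2)B(t_2)^*=0 .$$
   Context: Here $t_2$ varies in an interval $\mathrm I$, and $\sigma_1:\mathrm I\to\mathbb C^{p\times p}$ is a given differentiable function with self-adjoint invertible values. A (Krein space) realization means: there is a Krein space $\widetilde{\mathcal K}$, regarded as a Hilbert space with inner product $\langle\cdot,\cdot\rangle$ (adjoints $^*$ of operators are taken with respect to $\langle\cdot,\cdot\rangle$), a bounded operator $A_1$ on $\widetilde{\mathcal K}$ independent of $t_2$, bounded operators $B(t_2):\mathbb C^p\to\widetilde{\mathcal K}$, and bounded, self-adjoint, invertible, but not necessarily positive, operators $\mathbb X(t_2)$ on $\widetilde{\mathcal K}$ (the inverse $\mathbb X^{-1}(t_2)$ representing an indefinite Krein inner product $[u,v]=\langle\mathbb X^{-1}(t_2)u,v\rangle$).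
   Formalization: S(λ,t₂) is assumed analytic in one neighbourhood |λ|>r of infinity common to all t₂; without this the claim fails, e.g. S=(λ+a(t₂))/(λ−a(t₂)), σ₁=1, a real and unbounded, since A₁ is bounded and independent of t₂. *)

theory Defs
  imports "HOL-Analysis.Analysis" "HOL-Library.Function_Algebras"
begin

section \<open>Complex Hilbert spaces\<close>

text \<open>
  The library has no complex inner product spaces, so a Hilbert space is given here by a carrier
  inside an ambient complex vector space together with an inner product on the carrier.
  Existence of a Hilbert space is stated over the ambient type \<open>real \<Rightarrow> complex\<close>; up to isometry
  every Hilbert space with an orthonormal basis of at most continuum cardinality has its carrier
  there. Inner products are linear in the first and antilinear in the second argument.
\<close>

record 'v hilbert =
  hcarrier :: "'v set"
  hscale :: "complex \<Rightarrow> 'v \<Rightarrow> 'v"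
  hinner :: "'v \<Rightarrow> 'v \<Rightarrow> complex"

definition hnorm :: "'v hilbert \<Rightarrow> 'v \<Rightarrow> real" where
  "hnorm K x = sqrt (Re (hinner K x x))"

definition hilbert_space :: "'v::ab_group_add hilbert \<Rightarrow> bool" where
  "hilbert_space K \<longleftrightarrow>
     vector_space (hscale K) \<and> module.subspace (hscale K) (hcarrier K) \<and>
     (\<forall>x\<in>hcarrier K. \<forall>y\<in>hcarrier K. \<forall>z\<in>hcarrier K.
        hinner K (x + y) z = hinner K x z + hinner K y z) \<and>
     (\<forall>c. \<forall>x\<in>hcarrier K. \<forall>y\<in>hcarrier K. hinner K (hscale K c x) y = c * hinner K x y) \<and>
     (\<forall>x\<in>hcarrier K. \<forall>y\<in>hcarrier K. hinner K y x = cnj (hinner K x y)) \<and>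
     (\<forall>x\<in>hcarrier K. x \<noteq> 0 \<longrightarrow> Re (hinner K x x) > 0) \<and>
     (\<forall>s. (\<forall>n. s n \<in> hcarrier K) \<and>
          (\<forall>e>0. \<exists>N. \<forall>m\<ge>N. \<forall>n\<ge>N. hnorm K (s m - s n) < e) \<longrightarrow>
          (\<exists>l\<in>hcarrier K. (\<lambda>n. hnorm K (s n - l)) \<longlonglongrightarrow> 0))"

definition cspace :: "(complex ^ 'p) hilbert" where
  "cspace = \<lparr>hcarrier = UNIV, hscale = (*s), hinner = (\<lambda>u v. \<Sum>i\<in>UNIV. u $ i * cnj (v $ i))\<rparr>"

definition bounded_op ::
    "'v::ab_group_add hilbert \<Rightarrow> 'w::ab_group_add hilbert \<Rightarrow> ('v \<Rightarrow> 'w) \<Rightarrow> bool" where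
  "bounded_op K L T \<longleftrightarrow>
     (\<forall>x\<in>hcarrier K. T x \<in> hcarrier L) \<and>
     (\<forall>x\<in>hcarrier K. \<forall>y\<in>hcarrier K. T (x + y) = T x + T y) \<and>
     (\<forall>c. \<forall>x\<in>hcarrier K. T (hscale K c x) = hscale L c (T x)) \<and>
     (\<exists>M. \<forall>x\<in>hcarrier K. hnorm L (T x) \<le> M * hnorm K x)"

text \<open>
  For a bounded operator between Hilbert spaces the vector described below exists by the Riesz
  representation theorem and is unique, so this is the usual adjoint on the carrier of \<open>L\<close>.
\<close>

definition hadjoint ::
    "'v::ab_group_add hilbert \<Rightarrow> 'w::ab_group_add hilbert \<Rightarrow> ('v \<Rightarrow> 'w) \<Rightarrow> ('w \<Rightarrow> 'v)" where
  "hadjoint K L T y =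
     (THE x. x \<in> hcarrier K \<and> (\<forall>u\<in>hcarrier K. hinner L (T u) y = hinner K u x))"

definition selfadjoint_op :: "'v::ab_group_add hilbert \<Rightarrow> ('v \<Rightarrow> 'v) \<Rightarrow> bool" where
  "selfadjoint_op K T \<longleftrightarrow> bounded_op K K T \<and> (\<forall>x\<in>hcarrier K. hadjoint K K T x = T x)"

definition hinverse :: "'v hilbert \<Rightarrow> ('v \<Rightarrow> 'v) \<Rightarrow> ('v \<Rightarrow> 'v)" where
  "hinverse K T = inv_into (hcarrier K) T"

definition invertible_op :: "'v::ab_group_add hilbert \<Rightarrow> ('v \<Rightarrow> 'v) \<Rightarrow> bool" where
  "invertible_op K T \<longleftrightarrow>
     bounded_op K K T \<and> bij_betw T (hcarrier K) (hcarrier K) \<and> bounded_op K K (hinverse K T)"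

lemma
  assumes "hilbert_space K"
  shows hilbert_space_vs: "vector_space (hscale K)"
    and hilbert_space_sub: "module.subspace (hscale K) (hcarrier K)"
    and hilbert_space_add: "\<forall>x\<in>hcarrier K. \<forall>y\<in>hcarrier K. \<forall>z\<in>hcarrier K.
          hinner K (x + y) z = hinner K x z + hinner K y z"
    and hilbert_space_sym: "\<forall>x\<in>hcarrier K. \<forall>y\<in>hcarrier K. hinner K y x = cnj (hinner K x y)"
    and hilbert_space_pos: "\<forall>x\<in>hcarrier K. x \<noteq> 0 \<longrightarrow> Re (hinner K x x) > 0"
  using assms unfolding hilbert_space_def by - (elim conjE, assumption)+

lemma hadjoint_eqI:
  assumes K: "hilbert_space K" and x: "x \<in> hcarrier K"
    and adj: "\<And>u. u \<in> hcarrier K \<Longrightarrow> hinner L (T u) y = hinner K u x"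
  shows "hadjoint K L T y = x"
  unfolding hadjoint_def
proof (rule the_equality)
  show "x \<in> hcarrier K \<and> (\<forall>u\<in>hcarrier K. hinner L (T u) y = hinner K u x)"
    using x adj by blast
next
  fix z assume z: "z \<in> hcarrier K \<and> (\<forall>u\<in>hcarrier K. hinner L (T u) y = hinner K u z)"
  interpret vector_space "hscale K" by (rule hilbert_space_vs[OF K])
  have S: "subspace (hcarrier K)" by (rule hilbert_space_sub[OF K])
  define w where "w = z - x"
  have w: "w \<in> hcarrier K" using subspace_diff[OF S] z x by (simp add: w_def)
  have zw: "z = w + x" by (simp add: w_def)
  have zK: "z \<in> hcarrier K" and zu: "hinner L (T w) y = hinner K w z" using z w by blast+
  have add: "hinner K (w + x) w = hinner K w w + hinner K x w"
    by (rule hilbert_space_add[OF K, rule_format, OF w x w])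
  have sym: "hinner K z w = cnj (hinner K w z)" "hinner K x w = cnj (hinner K w x)"
    by (rule hilbert_space_sym[OF K, rule_format, OF w zK],
        rule hilbert_space_sym[OF K, rule_format, OF w x])
  have "hinner K w z = hinner K w x" using zu adj[OF w] by metis
  hence "hinner K (w + x) w = hinner K x w" using sym zw by metis
  hence "hinner K w w = 0" using add by simp
  hence "w = 0" using hilbert_space_pos[OF K] w by (metis less_irrefl zero_complex.sel(1))
  thus "z = x" using zw by simp
qed

lemma hnorm_cspace: "hnorm cspace x = norm x"
proof -
  have "Re (x $ i * cnj (x $ i)) = (norm (x $ i))\<^sup>2" for i
    by (simp only: complex_mult_cnj cmod_power2 Re_complex_of_real)
  thus ?thesis
    by (simp only: hnorm_def cspace_def norm_vec_def L2_set_def Re_sum hilbert.simps)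
qed

lemma hilbert_space_cspace: "hilbert_space (cspace :: (complex ^ 'p) hilbert)"
proof -
  have V: "vector_space ((*s) :: complex \<Rightarrow> complex ^ 'p \<Rightarrow> complex ^ 'p)"
    by (rule vec.vector_space_axioms)
  have pos: "Re (hinner cspace x x) > 0" if "x \<noteq> 0" for x :: "complex ^ 'p"
  proof -
    have "hnorm cspace x > 0" using that by (simp add: hnorm_cspace)
    thus ?thesis by (simp add: hnorm_def)
  qed
  have comp: "\<exists>l. (\<lambda>n. norm (s n - l)) \<longlonglongrightarrow> 0"
    if "\<forall>e>0. \<exists>N. \<forall>m\<ge>N. \<forall>n\<ge>N. norm (s m - s n) < e" for s :: "nat \<Rightarrow> complex ^ 'p"
  proof -
    have "Cauchy s" using that by (simp add: Cauchy_def dist_norm)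
    then obtain l where "s \<longlonglongrightarrow> l" using Cauchy_convergent convergent_def by blast
    thus ?thesis using LIM_zero tendsto_norm_zero by blast
  qed
  have S: "module.subspace (*s) (UNIV :: (complex ^ 'p) set)" by (rule vec.subspace_UNIV)
  have sel: "hcarrier cspace = (UNIV :: (complex ^ 'p) set)"
      "hscale cspace = ((*s) :: complex \<Rightarrow> complex ^ 'p \<Rightarrow> complex ^ 'p)"
      "\<And>u v :: complex ^ 'p. hinner cspace u v = (\<Sum>i\<in>UNIV. u $ i * cnj (v $ i))"
    by (simp_all add: cspace_def)
  have ip: "hinner cspace (x + y) z = hinner cspace x z + hinner cspace y z"
      "hinner cspace (c *s x) y = c * hinner cspace x y"
      "hinner cspace y x = cnj (hinner cspace x y)" for x y z :: "complex ^ 'p" and c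
    unfolding sel
    by (simp_all add: ring_distribs sum.distrib sum_distrib_left mult.assoc)
       (simp add: mult.commute)
  show ?thesis
    unfolding hilbert_space_def hnorm_cspace sel(1,2)
  proof (intro conjI ballI allI impI)
    show "\<exists>l\<in>UNIV. (\<lambda>n. norm (s n - l)) \<longlonglongrightarrow> 0"
      if "(\<forall>n. s n \<in> UNIV) \<and> (\<forall>e>0. \<exists>N. \<forall>m\<ge>N. \<forall>n\<ge>N. norm (s m - s n) < e)"
      for s :: "nat \<Rightarrow> complex ^ 'p"
      using comp[OF conjunct2[OF that]] by simp
  qed (rule V S ip pos; assumption?)+
qed

section \<open>Matrix-valued functions\<close>

definition cadjoint :: "complex ^ 'n ^ 'm \<Rightarrow> complex ^ 'm ^ 'n" where
  "cadjoint A = (\<chi> i j. cnj (A $ j $ i))"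

text \<open>
  \<open>F\<close> is analytic at infinity with value \<open>L\<close>: the function \<open>w \<mapsto> F (1/w)\<close>, given the value \<open>L\<close> at
  \<open>w = 0\<close>, is analytic near 0. The radius is explicit, so that the neighbourhood
  \<open>cmod z > r\<close> of infinity can be shared by a family of functions.
\<close>

definition analytic_at_infinity ::
    "real \<Rightarrow> (complex \<Rightarrow> complex ^ 'n ^ 'm) \<Rightarrow> complex ^ 'n ^ 'm \<Rightarrow> bool" where
  "analytic_at_infinity r F L \<longleftrightarrow>
     0 < r \<and> (\<forall>i j. (\<lambda>w. (if w = 0 then L else F (inverse w)) $ i $ j)
                       holomorphic_on ball 0 (inverse r))"

section \<open>Krein space realizations\<close>

text \<open>
  The Krein space is carried by the Hilbert space \<open>K\<close>: for each \<open>t\<close> the Gram operator of its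
  indefinite inner product is the inverse of \<open>X t\<close>, that is
  \<open>[u, v] = hinner K (hinverse K (X t) u) v\<close>.
\<close>

definition krein_data ::
    "real set \<Rightarrow> 'v::ab_group_add hilbert \<Rightarrow> ('v \<Rightarrow> 'v) \<Rightarrow> (real \<Rightarrow> complex ^ 'p \<Rightarrow> 'v)
       \<Rightarrow> (real \<Rightarrow> 'v \<Rightarrow> 'v) \<Rightarrow> bool" where
  "krein_data I K A B X \<longleftrightarrow>
     hilbert_space K \<and> bounded_op K K A \<and>
     (\<forall>t\<in>I. bounded_op cspace K (B t) \<and> selfadjoint_op K (X t) \<and> invertible_op K (X t))"

definition resolvent :: "'v::ab_group_add hilbert \<Rightarrow> ('v \<Rightarrow> 'v) \<Rightarrow> complex \<Rightarrow> 'v \<Rightarrow> 'v" where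
  "resolvent K A z = hinverse K (\<lambda>x. hscale K z x - A x)"

text \<open>
  Both sides of the realization formula are germs at infinity; they are compared on
  \<open>cmod z > \<rho>\<close>, where the resolvent of \<open>A\<close> is required to exist.
\<close>

definition realizes_on ::
    "real \<Rightarrow> real set \<Rightarrow> (real \<Rightarrow> complex ^ 'p ^ 'p) \<Rightarrow> (complex \<Rightarrow> real \<Rightarrow> complex ^ 'p ^ 'p)
       \<Rightarrow> 'v::ab_group_add hilbert \<Rightarrow> ('v \<Rightarrow> 'v) \<Rightarrow> (real \<Rightarrow> complex ^ 'p \<Rightarrow> 'v)
       \<Rightarrow> (real \<Rightarrow> 'v \<Rightarrow> 'v) \<Rightarrow> bool" where
  "realizes_on \<rho> I \<sigma>\<^sub>1 S K A B X \<longleftrightarrow>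
     (\<forall>t\<in>I. \<forall>z. \<rho> < cmod z \<longrightarrow>
        invertible_op K (\<lambda>x. hscale K z x - A x) \<and>
        (\<forall>v. S z t *v v =
           v - hadjoint cspace K (B t)
                 (hinverse K (X t) (resolvent K A z (B t (\<sigma>\<^sub>1 t *v v))))))"

definition lyapunov ::
    "real set \<Rightarrow> (real \<Rightarrow> complex ^ 'p ^ 'p) \<Rightarrow> 'v::ab_group_add hilbert \<Rightarrow> ('v \<Rightarrow> 'v)
       \<Rightarrow> (real \<Rightarrow> complex ^ 'p \<Rightarrow> 'v) \<Rightarrow> (real \<Rightarrow> 'v \<Rightarrow> 'v) \<Rightarrow> bool" where
  "lyapunov I \<sigma>\<^sub>1 K A B X \<longleftrightarrow>
     (\<forall>t\<in>I. \<forall>x\<in>hcarrier K.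
        A (X t x) + X t (hadjoint K K A x) + B t (\<sigma>\<^sub>1 t *v hadjoint cspace K (B t) x) = 0)"

end

theory Submission
  imports Defs "HOL-Complex_Analysis.Complex_Analysis"
begin

text \<open>
  Fix \<open>\<rho> > r\<close>. The state space is the space of square-summable \<open>\<complex>\<^sup>p\<close>-valued Laurent series on the
  unit circle, and \<open>A\<^sub>1\<close> is multiplication by \<open>\<rho> * z\<close>, independently of \<open>t\<close>. For fixed \<open>t\<close> put
  \<open>T z = S (\<rho> * z)\<close>, \<open>\<tau> = - \<rho> \<sigma>\<^sub>1\<^sup>-\<^sup>1\<close> and \<open>F\<^sup># z = (F (- cnj z))\<^sup>*\<close>, so that \<open>T \<tau> T\<^sup># = \<tau>\<close>. The
  symbol \<open>T\<close> is analytic outside the disc; complement it by the symbol \<open>h z = \<omega> exp (k z)\<close> with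
  \<open>\<bar>\<omega>\<bar> = 1\<close> and \<open>k\<close> real, which is analytic inside, satisfies \<open>h \<tau> h\<^sup># = \<tau>\<close> as well, and for
  suitable \<open>\<omega>\<close> and \<open>k\<close> makes the jump \<open>T - h\<close> invertible on the circle. With the projections
  \<open>P\<^sub>\<plusminus>\<close> onto the nonnegative and the negative powers and the flip
  \<open>(N f)\<^sub>n = (-1)\<^sup>n f\<^bsub>-1-n\<^esub>\<close>, which intertwines \<open>A\<^sub>1\<^sup>*\<close> and \<open>- A\<^sub>1\<close>, set
  \<open>X f = (T - h) \<tau> (P\<^sub>- h\<^sup># + P\<^sub>+ T\<^sup>#) N f\<close> and \<open>B v = (T - h) \<tau> v\<close>. The two symmetries make \<open>X\<close>
  self-adjoint, the triangular shape of the middle factor makes it invertible, the Lyapunov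
  equation reduces to the rank \<open>p\<close> commutator of the shift with \<open>P\<^sub>\<plusminus>\<close>, and \<open>B\<^sup>* X\<^sup>-\<^sup>1\<close> is the
  coefficient of \<open>1/z\<close>, from which \<open>S\<close> is recovered.
\<close>

no_notation fps_nth (infixl "$" 75)

no_notation Infinite_Set_Sum.abs_summable_on (infix "abs'_summable'_on" 50)
notation Infinite_Sum.abs_summable_on (infixr "abs'_summable'_on" 46)

lemma has_sum_finite_sum:
  fixes f :: "'i \<Rightarrow> 'a \<Rightarrow> 'b :: {topological_comm_monoid_add}"
  assumes "finite I" "\<And>i. i \<in> I \<Longrightarrow> (f i has_sum s i) A"
  shows "((\<lambda>x. \<Sum>i\<in>I. f i x) has_sum (\<Sum>i\<in>I. s i)) A"
  using assms by (induction I rule: finite_induct) (auto intro!: has_sum_add)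

lemma abs_summable_on_rectangles:
  fixes t :: "'a \<Rightarrow> 'b \<Rightarrow> 'c :: real_normed_vector"
  assumes "\<And>F G. finite F \<Longrightarrow> finite G \<Longrightarrow> (\<Sum>x\<in>F. \<Sum>y\<in>G. norm (t x y)) \<le> C"
  shows "(\<lambda>(x, y). t x y) abs_summable_on UNIV \<times> UNIV"
  unfolding Infinite_Sum.abs_summable_iff_bdd_above
proof (rule bdd_aboveI2)
  fix H :: "('a \<times> 'b) set" assume "H \<in> {F. F \<subseteq> UNIV \<times> UNIV \<and> finite F}"
  then have H: "finite H" by simp
  have "(\<Sum>p\<in>H. norm (case p of (x, y) \<Rightarrow> t x y)) \<le> (\<Sum>p\<in>fst ` H \<times> snd ` H. norm (case p of (x, y) \<Rightarrow> t x y))"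
    by (rule sum_mono2) (use H in \<open>auto intro: rev_image_eqI\<close>)
  also have "\<dots> = (\<Sum>x\<in>fst ` H. \<Sum>y\<in>snd ` H. norm (t x y))"
    by (simp add: sum.cartesian_product case_prod_beta)
  also have "\<dots> \<le> C" by (rule assms) (use H in auto)
  finally show "(\<Sum>p\<in>H. norm (case p of (x, y) \<Rightarrow> t x y)) \<le> C" .
qed

lemma half_squares_bound: "a * b \<le> (a\<^sup>2 + b\<^sup>2) / (2::real)"
  using sum_squares_bound[of a b] by simp

section \<open>Square-summable families\<close>

typedef 'i ell2 = "{f :: 'i \<Rightarrow> complex. (\<lambda>x. (cmod (f x))\<^sup>2) summable_on UNIV}"
  morphisms coord Abs_ell2
  by (rule exI[of _ "\<lambda>_. 0"]) auto

setup_lifting type_definition_ell2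

lemma coord_summable: "(\<lambda>x. (cmod (coord f x))\<^sup>2) summable_on UNIV"
  using coord[of f] by simp

lemma ell2_eqI: "(\<And>x. coord f x = coord g x) \<Longrightarrow> f = g"
  by (metis coord_inject ext)

lemma square_summable_add:
  assumes "(\<lambda>x. (cmod (f x))\<^sup>2) summable_on A" "(\<lambda>x. (cmod (g x))\<^sup>2) summable_on A"
  shows "(\<lambda>x. (cmod (f x + g x))\<^sup>2) summable_on A"
proof (rule summable_on_comparison_test)
  show "(\<lambda>x. 2 * (cmod (f x))\<^sup>2 + 2 * (cmod (g x))\<^sup>2) summable_on A"
    by (intro summable_on_add summable_on_cmult_right assms)
  show "(cmod (f x + g x))\<^sup>2 \<le> 2 * (cmod (f x))\<^sup>2 + 2 * (cmod (g x))\<^sup>2" for x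
  proof -
    have "(cmod (f x + g x))\<^sup>2 \<le> (cmod (f x) + cmod (g x))\<^sup>2"
      by (intro power_mono norm_triangle_ineq) auto
    also have "\<dots> \<le> 2 * (cmod (f x))\<^sup>2 + 2 * (cmod (g x))\<^sup>2"
      using sum_squares_bound[of "cmod (f x)" "cmod (g x)"] by (simp add: power2_sum)
    finally show ?thesis .
  qed
qed auto

lemma square_summable_mult:
  "(\<lambda>x. (cmod (f x))\<^sup>2) summable_on A \<Longrightarrow> (\<lambda>x. (cmod (c * f x))\<^sup>2) summable_on A"
  by (simp add: norm_mult power_mult_distrib summable_on_cmult_right)

instantiation ell2 :: (type) ab_group_add
begin
lift_definition zero_ell2 :: "'a ell2" is "\<lambda>_. 0" by simp
lift_definition plus_ell2 :: "'a ell2 \<Rightarrow> 'a ell2 \<Rightarrow> 'a ell2" is "\<lambda>f g x. f x + g x"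
  by (rule square_summable_add)
lift_definition uminus_ell2 :: "'a ell2 \<Rightarrow> 'a ell2" is "\<lambda>f x. - f x" by simp
lift_definition minus_ell2 :: "'a ell2 \<Rightarrow> 'a ell2 \<Rightarrow> 'a ell2" is "\<lambda>f g x. f x - g x"
  using square_summable_add[of _ _ "\<lambda>x. - _ x"] by simp
instance by standard (transfer; simp add: algebra_simps)+
end

lift_definition cscale :: "complex \<Rightarrow> 'i ell2 \<Rightarrow> 'i ell2" is "\<lambda>c f x. c * f x"
  by (rule square_summable_mult)

lemma coord_simps [simp]:
  "coord 0 x = 0" "coord (f + g) x = coord f x + coord g x" "coord (- f) x = - coord f x"
  "coord (f - g) x = coord f x - coord g x" "coord (cscale c f) x = c * coord f x"
  by (transfer; simp)+

definition ip :: "'i ell2 \<Rightarrow> 'i ell2 \<Rightarrow> complex" where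
  "ip f g = (\<Sum>\<^sub>\<infinity>x. coord f x * cnj (coord g x))"

definition nrm :: "'i ell2 \<Rightarrow> real" where
  "nrm f = sqrt (\<Sum>\<^sub>\<infinity>x. (cmod (coord f x))\<^sup>2)"

lemma has_sum_ip: "((\<lambda>x. coord f x * cnj (coord g x)) has_sum ip f g) UNIV"
proof -
  have "(\<lambda>x. norm (coord f x * cnj (coord g x))) summable_on UNIV"
  proof (rule summable_on_comparison_test)
    show "(\<lambda>x. ((cmod (coord f x))\<^sup>2 + (cmod (coord g x))\<^sup>2) * (1/2)) summable_on UNIV"
      by (intro summable_on_cmult_left summable_on_add coord_summable)
  qed (use half_squares_bound in \<open>auto simp: norm_mult\<close>)
  then show ?thesis
    unfolding ip_def by (rule has_sum_infsum[OF abs_summable_summable])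
qed

lemma ip_add_left: "ip (f + g) h = ip f h + ip g h"
  by (rule has_sum_unique[OF has_sum_ip])
     (use has_sum_add[OF has_sum_ip has_sum_ip] in \<open>simp add: algebra_simps\<close>)

lemma ip_scale_left: "ip (cscale c f) h = c * ip f h"
  by (rule has_sum_unique[OF has_sum_ip])
     (use has_sum_cmult_right[OF has_sum_ip] in \<open>simp add: algebra_simps\<close>)

lemma ip_sym: "ip g f = cnj (ip f g)"
proof (rule has_sum_unique[OF has_sum_ip])
  have "((\<lambda>x. cnj (coord f x * cnj (coord g x))) has_sum cnj (ip f g)) UNIV"
    by (simp only: has_sum_cnj_iff has_sum_ip)
  then show "((\<lambda>x. coord g x * cnj (coord f x)) has_sum cnj (ip f g)) UNIV"
    by (simp add: mult.commute)
qed

lemma ip_minus_left: "ip (- f) h = - ip f h"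
proof -
  have "- f = cscale (-1) f" by (rule ell2_eqI) simp
  then show ?thesis by (simp add: ip_scale_left)
qed

lemma ip_add_right: "ip h (f + g) = ip h f + ip h g"
  by (metis complex_cnj_add ip_add_left ip_sym)

lemma ip_minus_right: "ip h (- f) = - ip h f"
  by (metis complex_cnj_minus ip_minus_left ip_sym)

lemma ip_diff_right: "ip h (f - g) = ip h f - ip h g"
  using ip_add_right[of h f "- g"] by (simp add: ip_minus_right)

lemma ip_diff_left: "ip (f - g) h = ip f h - ip g h"
  using ip_add_left[of f "- g" h] by (simp add: ip_minus_left)

lemma has_sum_nrm: "((\<lambda>x. (cmod (coord f x))\<^sup>2) has_sum (nrm f)\<^sup>2) UNIV"
  using has_sum_infsum[OF coord_summable, of f] by (simp add: nrm_def infsum_nonneg)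

lemma nrm_nonneg: "0 \<le> nrm f"
  by (simp add: nrm_def infsum_nonneg)

lemma nrm_sum_le: "finite F \<Longrightarrow> (\<Sum>x\<in>F. (cmod (coord f x))\<^sup>2) \<le> (nrm f)\<^sup>2"
  by (rule finite_sum_le_has_sum[OF has_sum_nrm]) auto

lemma nrm_leI:
  assumes "0 \<le> C" "\<And>F. finite F \<Longrightarrow> (\<Sum>x\<in>F. (cmod (coord f x))\<^sup>2) \<le> C\<^sup>2"
  shows "nrm f \<le> C"
proof -
  have "(nrm f)\<^sup>2 \<le> C\<^sup>2" by (rule has_sum_le_finite_sums[OF has_sum_nrm]) (use assms in auto)
  then show ?thesis using assms(1) by (rule power2_le_imp_le)
qed

lemma cmod_coord_le_nrm: "cmod (coord f x) \<le> nrm f"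
  by (rule power2_le_imp_le[OF _ nrm_nonneg]) (use nrm_sum_le[of "{x}" f] in simp)

lemma ip_self: "ip f f = of_real ((nrm f)\<^sup>2)"
proof (rule has_sum_unique[OF has_sum_ip])
  have "((\<lambda>x. complex_of_real ((cmod (coord f x))\<^sup>2)) has_sum complex_of_real ((nrm f)\<^sup>2)) UNIV"
    by (rule has_sum_of_real[OF has_sum_nrm])
  then show "((\<lambda>x. coord f x * cnj (coord f x)) has_sum complex_of_real ((nrm f)\<^sup>2)) UNIV"
    by (simp add: complex_mult_cnj cmod_power2)
qed

lemma nrm_pos: "f \<noteq> 0 \<Longrightarrow> 0 < nrm f"
proof (rule ccontr)
  assume "f \<noteq> 0" "\<not> 0 < nrm f"
  then have "nrm f = 0" using nrm_nonneg[of f] by simp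
  then have "coord f x = 0" for x using cmod_coord_le_nrm[of f x] by simp
  then have "f = 0" by (intro ell2_eqI) simp
  with \<open>f \<noteq> 0\<close> show False by simp
qed

lemma square_summableI:
  "(\<lambda>x. (cmod (f x))\<^sup>2) summable_on UNIV" if "\<And>F. finite F \<Longrightarrow> (\<Sum>x\<in>F. (cmod (f x))\<^sup>2) \<le> C"
  by (rule nonneg_bdd_above_summable_on) (use that in \<open>auto intro!: bdd_aboveI2\<close>)

lemma ell2_complete:
  assumes "\<And>e. e > 0 \<Longrightarrow> \<exists>N. \<forall>m\<ge>N. \<forall>n\<ge>N. nrm (s m - s n) < e"
  shows "\<exists>l. (\<lambda>n. nrm (s n - l)) \<longlonglongrightarrow> 0"
proof -
  have "Cauchy (\<lambda>n. coord (s n) x)" for x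
    unfolding Cauchy_def dist_norm
  proof (intro allI impI)
    fix e :: real assume "e > 0"
    from assms[OF this] obtain N where N: "\<And>m n. m \<ge> N \<Longrightarrow> n \<ge> N \<Longrightarrow> nrm (s m - s n) < e" by blast
    have "norm (coord (s m) x - coord (s n) x) < e" if "m \<ge> N" "n \<ge> N" for m n
      using cmod_coord_le_nrm[of "s m - s n" x] N[OF that] by simp
    then show "\<exists>M. \<forall>m\<ge>M. \<forall>n\<ge>M. norm (coord (s m) x - coord (s n) x) < e" by blast
  qed
  then have "\<exists>l. (\<lambda>n. coord (s n) x) \<longlonglongrightarrow> l" for x
    using Cauchy_convergent convergent_def by blast
  then obtain l where l: "\<And>x. (\<lambda>n. coord (s n) x) \<longlonglongrightarrow> l x" by metis
  have bound: "\<exists>N. \<forall>n\<ge>N. \<forall>F. finite F \<longrightarrow> (\<Sum>x\<in>F. (cmod (coord (s n) x - l x))\<^sup>2) \<le> e\<^sup>2"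
    if e: "e > 0" for e
  proof -
    from assms[OF e] obtain N where N: "\<And>m n. m \<ge> N \<Longrightarrow> n \<ge> N \<Longrightarrow> nrm (s m - s n) < e" by blast
    have "(\<Sum>x\<in>F. (cmod (coord (s n) x - l x))\<^sup>2) \<le> e\<^sup>2" if "n \<ge> N" "finite F" for n F
    proof (rule tendsto_upperbound)
      show "(\<lambda>m. \<Sum>x\<in>F. (cmod (coord (s n) x - coord (s m) x))\<^sup>2) \<longlonglongrightarrow>
              (\<Sum>x\<in>F. (cmod (coord (s n) x - l x))\<^sup>2)"
        by (intro tendsto_intros l)
      have "(\<Sum>x\<in>F. (cmod (coord (s n) x - coord (s m) x))\<^sup>2) \<le> e\<^sup>2" if "m \<ge> N" for m
      proof -
        have "(\<Sum>x\<in>F. (cmod (coord (s n) x - coord (s m) x))\<^sup>2) \<le> (nrm (s n - s m))\<^sup>2"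
          using nrm_sum_le[OF \<open>finite F\<close>, of "s n - s m"] by simp
        also have "\<dots> \<le> e\<^sup>2"
          using N[OF \<open>n \<ge> N\<close> that] by (intro power_mono nrm_nonneg) auto
        finally show ?thesis .
      qed
      then show "\<forall>\<^sub>F m in sequentially. (\<Sum>x\<in>F. (cmod (coord (s n) x - coord (s m) x))\<^sup>2) \<le> e\<^sup>2"
        by (auto simp: eventually_sequentially)
    qed auto
    then show ?thesis by blast
  qed
  obtain N where N: "\<And>F. finite F \<Longrightarrow> (\<Sum>x\<in>F. (cmod (coord (s N) x - l x))\<^sup>2) \<le> 1\<^sup>2"
    using bound[of 1] by auto
  have "(\<lambda>x. (cmod (coord (s N) x + - (coord (s N) x - l x)))\<^sup>2) summable_on UNIV"
    using square_summableI[OF N]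
    by (intro square_summable_add coord_summable) (simp only: norm_minus_cancel)
  then have L: "coord (Abs_ell2 l) = l"
    by (simp add: Abs_ell2_inverse)
  have "(\<lambda>n. nrm (s n - Abs_ell2 l)) \<longlonglongrightarrow> 0"
  proof (rule LIMSEQ_I)
    fix e :: real assume "e > 0"
    then obtain N where N: "\<And>n F. n \<ge> N \<Longrightarrow> finite F \<Longrightarrow> (\<Sum>x\<in>F. (cmod (coord (s n) x - l x))\<^sup>2) \<le> (e/2)\<^sup>2"
      using bound[of "e/2"] by auto
    have "nrm (s n - Abs_ell2 l) \<le> e/2" if "n \<ge> N" for n
      using N[OF that] \<open>e > 0\<close> by (intro nrm_leI) (auto simp: L)
    then have "norm (nrm (s n - Abs_ell2 l) - 0) < e" if "n \<ge> N" for n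
      using \<open>e > 0\<close> nrm_nonneg[of "s n - Abs_ell2 l"] that by fastforce
    then show "\<exists>N. \<forall>n\<ge>N. norm (nrm (s n - Abs_ell2 l) - 0) < e" by blast
  qed
  then show ?thesis by blast
qed

section \<open>Schur kernels\<close>

definition schur :: "('i \<Rightarrow> 'i \<Rightarrow> complex) \<Rightarrow> real \<Rightarrow> bool" where
  "schur k M \<longleftrightarrow> (\<forall>x F. finite F \<longrightarrow> (\<Sum>y\<in>F. cmod (k x y)) \<le> M) \<and>
                 (\<forall>y F. finite F \<longrightarrow> (\<Sum>x\<in>F. cmod (k x y)) \<le> M)"

lemma
  assumes "schur k M"
  shows schur_row: "finite F \<Longrightarrow> (\<Sum>y\<in>F. cmod (k x y)) \<le> M"
    and schur_col: "finite F \<Longrightarrow> (\<Sum>x\<in>F. cmod (k x y)) \<le> M"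
    and schur_nonneg: "0 \<le> M"
    and schur_entry: "cmod (k x y) \<le> M"
proof -
  show row: "finite F \<Longrightarrow> (\<Sum>y\<in>F. cmod (k x y)) \<le> M" for F x
    using assms by (simp add: schur_def)
  show "finite F \<Longrightarrow> (\<Sum>x\<in>F. cmod (k x y)) \<le> M" using assms by (simp add: schur_def)
  show "0 \<le> M" using row[of "{}"] by simp
  show "cmod (k x y) \<le> M" using row[of "{y}"] by simp
qed

definition kop :: "('i \<Rightarrow> 'i \<Rightarrow> complex) \<Rightarrow> 'i ell2 \<Rightarrow> 'i ell2" where
  "kop k f = Abs_ell2 (\<lambda>x. \<Sum>\<^sub>\<infinity>y. k x y * coord f y)"

lemma
  assumes k: "schur k M"
  shows has_sum_kop: "((\<lambda>y. k x y * coord f y) has_sum coord (kop k f) x) UNIV"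
    and nrm_kop_le: "nrm (kop k f) \<le> M * nrm f"
proof -
  let ?T = "\<lambda>x. \<Sum>\<^sub>\<infinity>y. cmod (k x y) * (cmod (coord f y))\<^sup>2"
  have T: "((\<lambda>y. cmod (k x y) * (cmod (coord f y))\<^sup>2) has_sum ?T x) UNIV" for x
  proof (rule has_sum_infsum, rule summable_on_comparison_test)
    show "(\<lambda>y. M * (cmod (coord f y))\<^sup>2) summable_on UNIV"
      by (intro summable_on_cmult_right coord_summable)
  qed (auto intro!: mult_right_mono schur_entry[OF k])
  have fin: "(\<Sum>y\<in>G. cmod (k x y * coord f y)) \<le> sqrt (M * ?T x)" if "finite G" for x G
  proof (rule real_le_rsqrt)
    have "(\<Sum>y\<in>G. cmod (k x y * coord f y)) =
            (\<Sum>y\<in>G. sqrt (cmod (k x y)) * (sqrt (cmod (k x y)) * cmod (coord f y)))"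
      by (simp add: norm_mult flip: mult.assoc)
    then have "(\<Sum>y\<in>G. cmod (k x y * coord f y))\<^sup>2 \<le>
        (\<Sum>y\<in>G. (sqrt (cmod (k x y)))\<^sup>2) * (\<Sum>y\<in>G. (sqrt (cmod (k x y)) * cmod (coord f y))\<^sup>2)"
      using Cauchy_Schwarz_ineq_sum[of "\<lambda>y. sqrt (cmod (k x y))" "\<lambda>y. sqrt (cmod (k x y)) * cmod (coord f y)" G]
      by (simp only:)
    also have "\<dots> = (\<Sum>y\<in>G. cmod (k x y)) * (\<Sum>y\<in>G. cmod (k x y) * (cmod (coord f y))\<^sup>2)"
      by (simp add: power_mult_distrib)
    also have "\<dots> \<le> M * ?T x"
      by (intro mult_mono schur_row[OF k] finite_sum_le_has_sum[OF T] that sum_nonneg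
          schur_nonneg[OF k]) auto
    finally show "(\<Sum>y\<in>G. cmod (k x y * coord f y))\<^sup>2 \<le> M * ?T x" .
  qed
  have abs: "(\<lambda>y. k x y * coord f y) abs_summable_on UNIV" for x
    unfolding Infinite_Sum.abs_summable_iff_bdd_above by (rule bdd_aboveI2) (use fin in auto)
  have sq: "(cmod (\<Sum>\<^sub>\<infinity>y. k x y * coord f y))\<^sup>2 \<le> M * ?T x" for x
  proof -
    have "cmod (\<Sum>\<^sub>\<infinity>y. k x y * coord f y) \<le> (\<Sum>\<^sub>\<infinity>y. cmod (k x y * coord f y))"
      by (rule norm_infsum_bound[OF abs])
    also have "\<dots> \<le> sqrt (M * ?T x)"
      by (rule infsum_le_finite_sums[OF abs]) (use fin in auto)
    finally have "(cmod (\<Sum>\<^sub>\<infinity>y. k x y * coord f y))\<^sup>2 \<le> (sqrt (M * ?T x))\<^sup>2"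
      by (intro power_mono) auto
    also have "\<dots> = M * ?T x"
      by (intro real_sqrt_pow2 mult_nonneg_nonneg schur_nonneg[OF k] infsum_nonneg) auto
    finally show ?thesis .
  qed
  have le: "(\<Sum>x\<in>F. (cmod (\<Sum>\<^sub>\<infinity>y. k x y * coord f y))\<^sup>2) \<le> (M * nrm f)\<^sup>2" if "finite F" for F
  proof -
    have "(\<Sum>x\<in>F. (cmod (\<Sum>\<^sub>\<infinity>y. k x y * coord f y))\<^sup>2) \<le> M * (\<Sum>x\<in>F. ?T x)"
      unfolding sum_distrib_left by (rule sum_mono) (rule sq)
    also have "M * (\<Sum>x\<in>F. ?T x) \<le> M * (M * (nrm f)\<^sup>2)"
    proof (intro mult_left_mono schur_nonneg[OF k],
        rule has_sum_mono[OF has_sum_finite_sum[OF that T] has_sum_cmult_right[OF has_sum_nrm]])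
      show "(\<Sum>x\<in>F. cmod (k x y) * (cmod (coord f y))\<^sup>2) \<le> M * (cmod (coord f y))\<^sup>2" for y
        unfolding sum_distrib_right[symmetric]
        by (intro mult_right_mono schur_col[OF k that]) auto
    qed
    finally show ?thesis
      by (simp add: power_mult_distrib power2_eq_square mult_ac)
  qed
  have C: "coord (kop k f) = (\<lambda>x. \<Sum>\<^sub>\<infinity>y. k x y * coord f y)"
    unfolding kop_def by (rule Abs_ell2_inverse) (use square_summableI[OF le] in simp)
  show "((\<lambda>y. k x y * coord f y) has_sum coord (kop k f) x) UNIV"
    unfolding C by (rule has_sum_infsum[OF abs_summable_summable[OF abs]])
  show "nrm (kop k f) \<le> M * nrm f"
  proof (rule nrm_leI)
    show "0 \<le> M * nrm f" by (intro mult_nonneg_nonneg schur_nonneg[OF k] nrm_nonneg)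
  qed (use le C in simp)
qed

lemma coord_kop: "schur k M \<Longrightarrow> coord (kop k f) x = (\<Sum>\<^sub>\<infinity>y. k x y * coord f y)"
  using infsumI[OF has_sum_kop] by metis

lemma kop_add: "schur k M \<Longrightarrow> kop k (f + g) = kop k f + kop k g"
proof (rule ell2_eqI, rule has_sum_unique[OF has_sum_kop])
  fix x assume k: "schur k M"
  show "((\<lambda>y. k x y * coord (f + g) y) has_sum coord (kop k f + kop k g) x) UNIV"
    using has_sum_add[OF has_sum_kop[OF k, of x f] has_sum_kop[OF k, of x g]] by (simp add: algebra_simps)
qed assumption

lemma kop_scale: "schur k M \<Longrightarrow> kop k (cscale c f) = cscale c (kop k f)"
proof (rule ell2_eqI, rule has_sum_unique[OF has_sum_kop])
  fix x assume k: "schur k M"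
  show "((\<lambda>y. k x y * coord (cscale c f) y) has_sum coord (cscale c (kop k f)) x) UNIV"
    using has_sum_cmult_right[OF has_sum_kop[OF k, of x f], of c] by (simp add: algebra_simps)
qed assumption

lemma kop_comp:
  assumes k: "schur k M" and l: "schur l L" and m: "schur m C"
    and prod: "\<And>x z. ((\<lambda>y. k x y * l y z) has_sum m x z) UNIV"
  shows "kop k (kop l f) = kop m f"
proof (rule ell2_eqI)
  fix x
  have "(\<lambda>(y, z). k x y * (l y z * coord f z)) abs_summable_on UNIV \<times> UNIV"
  proof (rule abs_summable_on_rectangles)
    fix F G :: "'a set" assume F: "finite F" and G: "finite G"
    have "(\<Sum>y\<in>F. \<Sum>z\<in>G. norm (k x y * (l y z * coord f z))) \<le>
            (\<Sum>y\<in>F. \<Sum>z\<in>G. cmod (k x y) * cmod (l y z)/2 + cmod (l y z) * (M * (cmod (coord f z))\<^sup>2)/2)"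
    proof (intro sum_mono)
      fix y z
      have "norm (k x y * (l y z * coord f z)) = cmod (k x y) * cmod (l y z) * (1 * cmod (coord f z))"
        by (simp add: norm_mult)
      also have "\<dots> \<le> cmod (k x y) * cmod (l y z) * ((1\<^sup>2 + (cmod (coord f z))\<^sup>2)/2)"
        by (intro mult_left_mono half_squares_bound) auto
      also have "\<dots> = cmod (k x y) * cmod (l y z)/2 + cmod (l y z) * (cmod (k x y) * (cmod (coord f z))\<^sup>2)/2"
        by (simp add: field_simps)
      also have "\<dots> \<le> cmod (k x y) * cmod (l y z)/2 + cmod (l y z) * (M * (cmod (coord f z))\<^sup>2)/2"
        by (intro add_left_mono divide_right_mono mult_left_mono mult_right_mono schur_entry[OF k]) auto
      finally show "norm (k x y * (l y z * coord f z)) \<le> \<dots>" .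
    qed
    also have "\<dots> = (\<Sum>y\<in>F. cmod (k x y) * (\<Sum>z\<in>G. cmod (l y z)))/2 +
                   (\<Sum>z\<in>G. (\<Sum>y\<in>F. cmod (l y z)) * (M * (cmod (coord f z))\<^sup>2))/2"
      by (simp add: sum.distrib sum_distrib_left sum_distrib_right sum_divide_distrib sum.swap[of _ G F])
    also have "\<dots> \<le> (\<Sum>y\<in>F. cmod (k x y) * L)/2 + (\<Sum>z\<in>G. L * (M * (cmod (coord f z))\<^sup>2))/2"
      by (intro add_mono divide_right_mono sum_mono mult_left_mono mult_right_mono
          schur_row[OF l] schur_col[OF l] F G mult_nonneg_nonneg schur_nonneg[OF k]) auto
    also have "\<dots> = (\<Sum>y\<in>F. cmod (k x y)) * L/2 + L * (M * (\<Sum>z\<in>G. (cmod (coord f z))\<^sup>2))/2"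
      by (simp add: sum_distrib_left sum_distrib_right)
    also have "\<dots> \<le> M * L/2 + L * (M * (nrm f)\<^sup>2)/2"
      by (intro add_mono divide_right_mono mult_left_mono mult_right_mono schur_row[OF k] nrm_sum_le
          F G schur_nonneg[OF k] schur_nonneg[OF l]) auto
    finally show "(\<Sum>y\<in>F. \<Sum>z\<in>G. norm (k x y * (l y z * coord f z))) \<le> M * L/2 + L * (M * (nrm f)\<^sup>2)/2" .
  qed
  then have "(\<lambda>(y, z). k x y * (l y z * coord f z)) summable_on UNIV \<times> UNIV"
    by (rule abs_summable_summable)
  from infsum_swap_banach[OF this]
  have "(\<Sum>\<^sub>\<infinity>y. \<Sum>\<^sub>\<infinity>z. k x y * (l y z * coord f z)) = (\<Sum>\<^sub>\<infinity>z. \<Sum>\<^sub>\<infinity>y. k x y * (l y z * coord f z))" .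
  moreover have "(\<Sum>\<^sub>\<infinity>z. k x y * (l y z * coord f z)) = k x y * coord (kop l f) y" for y
    by (rule infsumI[OF has_sum_cmult_right[OF has_sum_kop[OF l]]])
  moreover have "(\<Sum>\<^sub>\<infinity>y. k x y * (l y z * coord f z)) = m x z * coord f z" for z
    using infsumI[OF has_sum_cmult_left[OF prod]] by (simp add: mult.assoc)
  ultimately show "coord (kop k (kop l f)) x = coord (kop m f) x"
    by (simp add: coord_kop[OF k] coord_kop[OF m])
qed

lemma schur_adjoint: "schur k M \<Longrightarrow> schur (\<lambda>x y. cnj (k y x)) M"
  by (simp add: schur_def)

lemma kop_adjoint:
  assumes k: "schur k M"
  shows "ip (kop k f) g = ip f (kop (\<lambda>x y. cnj (k y x)) g)"
proof -
  note k' = schur_adjoint[OF k]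
  have "(\<lambda>(x, y). k x y * coord f y * cnj (coord g x)) abs_summable_on UNIV \<times> UNIV"
  proof (rule abs_summable_on_rectangles)
    fix F G :: "'a set" assume F: "finite F" and G: "finite G"
    have "(\<Sum>x\<in>F. \<Sum>y\<in>G. norm (k x y * coord f y * cnj (coord g x))) \<le>
            (\<Sum>x\<in>F. \<Sum>y\<in>G. cmod (k x y) * ((cmod (coord f y))\<^sup>2/2) + cmod (k x y) * ((cmod (coord g x))\<^sup>2/2))"
    proof (intro sum_mono)
      fix x y
      have "norm (k x y * coord f y * cnj (coord g x)) = cmod (k x y) * (cmod (coord f y) * cmod (coord g x))"
        by (simp add: norm_mult)
      also have "\<dots> \<le> cmod (k x y) * (((cmod (coord f y))\<^sup>2 + (cmod (coord g x))\<^sup>2)/2)"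
        by (intro mult_left_mono half_squares_bound) auto
      finally show "norm (k x y * coord f y * cnj (coord g x)) \<le>
          cmod (k x y) * ((cmod (coord f y))\<^sup>2/2) + cmod (k x y) * ((cmod (coord g x))\<^sup>2/2)"
        by (simp add: field_simps)
    qed
    also have "\<dots> = (\<Sum>y\<in>G. (\<Sum>x\<in>F. cmod (k x y)) * ((cmod (coord f y))\<^sup>2/2)) +
                   (\<Sum>x\<in>F. (\<Sum>y\<in>G. cmod (k x y)) * ((cmod (coord g x))\<^sup>2/2))"
      unfolding sum.distrib sum_distrib_right by (subst sum.swap) simp
    also have "\<dots> \<le> (\<Sum>y\<in>G. M * ((cmod (coord f y))\<^sup>2/2)) + (\<Sum>x\<in>F. M * ((cmod (coord g x))\<^sup>2/2))"
      by (intro add_mono sum_mono mult_right_mono schur_row[OF k] schur_col[OF k] F G) auto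
    also have "\<dots> = M * ((\<Sum>y\<in>G. (cmod (coord f y))\<^sup>2)/2) + M * ((\<Sum>x\<in>F. (cmod (coord g x))\<^sup>2)/2)"
      by (simp add: sum_distrib_left sum_divide_distrib)
    also have "\<dots> \<le> M * ((nrm f)\<^sup>2/2) + M * ((nrm g)\<^sup>2/2)"
      by (intro add_mono mult_left_mono divide_right_mono nrm_sum_le F G schur_nonneg[OF k]) auto
    finally show "(\<Sum>x\<in>F. \<Sum>y\<in>G. norm (k x y * coord f y * cnj (coord g x))) \<le>
        M * ((nrm f)\<^sup>2/2) + M * ((nrm g)\<^sup>2/2)" .
  qed
  then have "(\<lambda>(x, y). k x y * coord f y * cnj (coord g x)) summable_on UNIV \<times> UNIV"
    by (rule abs_summable_summable)
  from infsum_swap_banach[OF this]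
  have "(\<Sum>\<^sub>\<infinity>x. \<Sum>\<^sub>\<infinity>y. k x y * coord f y * cnj (coord g x)) =
        (\<Sum>\<^sub>\<infinity>y. \<Sum>\<^sub>\<infinity>x. k x y * coord f y * cnj (coord g x))" .
  moreover have "(\<Sum>\<^sub>\<infinity>y. k x y * coord f y * cnj (coord g x)) = coord (kop k f) x * cnj (coord g x)" for x
    by (rule infsumI[OF has_sum_cmult_left[OF has_sum_kop[OF k]]])
  moreover have "(\<Sum>\<^sub>\<infinity>x. k x y * coord f y * cnj (coord g x)) =
      coord f y * cnj (coord (kop (\<lambda>x y. cnj (k y x)) g) y)" for y
  proof (rule infsumI)
    have "((\<lambda>x. cnj (cnj (k x y) * coord g x)) has_sum
        cnj (coord (kop (\<lambda>x y. cnj (k y x)) g) y)) UNIV"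
      by (simp only: has_sum_cnj_iff has_sum_kop[OF k'])
    from has_sum_cmult_right[OF this, of "coord f y"]
    show "((\<lambda>x. k x y * coord f y * cnj (coord g x)) has_sum
        coord f y * cnj (coord (kop (\<lambda>x y. cnj (k y x)) g) y)) UNIV"
      by (simp add: mult_ac)
  qed
  ultimately show ?thesis by (simp add: ip_def)
qed

section \<open>Laurent coefficients on the unit circle\<close>

definition near_circle :: "(complex \<Rightarrow> complex) \<Rightarrow> bool" where
  "near_circle f \<longleftrightarrow> (\<exists>U. open U \<and> sphere 0 1 \<subseteq> U \<and> f holomorphic_on U)"

lemma near_circleI: "open U \<Longrightarrow> sphere 0 1 \<subseteq> U \<Longrightarrow> f holomorphic_on U \<Longrightarrow> near_circle f"
  unfolding near_circle_def by blast

lemma near_circle_common: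
  assumes "near_circle f" "near_circle g"
  obtains U where "open U" "sphere 0 1 \<subseteq> U" "0 \<notin> U" "f holomorphic_on U" "g holomorphic_on U"
proof -
  obtain U V where "open U" "sphere 0 1 \<subseteq> U" "f holomorphic_on U"
    and "open V" "sphere 0 1 \<subseteq> V" "g holomorphic_on V"
    using assms unfolding near_circle_def by blast
  then show thesis
    by (intro that[of "U \<inter> V - {0}"]) (auto intro: holomorphic_on_subset)
qed

lemma near_circle_const: "near_circle (\<lambda>_. c)"
  by (rule near_circleI[of UNIV]) auto

lemma near_circle_ident: "near_circle (\<lambda>z. z)"
  by (rule near_circleI[of UNIV]) auto

lemma near_circle_powi: "near_circle (\<lambda>z. z powi n)"
  by (rule near_circleI[of "- {0}"]) (auto intro!: holomorphic_intros)

lemma near_circle_add: "near_circle f \<Longrightarrow> near_circle g \<Longrightarrow> near_circle (\<lambda>z. f z + g z)"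
  by (erule (1) near_circle_common) (auto intro!: near_circleI holomorphic_intros)

lemma near_circle_diff: "near_circle f \<Longrightarrow> near_circle g \<Longrightarrow> near_circle (\<lambda>z. f z - g z)"
  by (erule (1) near_circle_common) (auto intro!: near_circleI holomorphic_intros)

lemma near_circle_mult: "near_circle f \<Longrightarrow> near_circle g \<Longrightarrow> near_circle (\<lambda>z. f z * g z)"
  by (erule (1) near_circle_common) (auto intro!: near_circleI holomorphic_intros)

lemma near_circle_sum:
  "finite A \<Longrightarrow> (\<And>i. i \<in> A \<Longrightarrow> near_circle (f i)) \<Longrightarrow> near_circle (\<lambda>z. \<Sum>i\<in>A. f i z)"
  by (induction A rule: finite_induct) (auto intro: near_circle_add near_circle_const)

lemma near_circle_prod:
  "finite A \<Longrightarrow> (\<And>i. i \<in> A \<Longrightarrow> near_circle (f i)) \<Longrightarrow> near_circle (\<lambda>z. \<Prod>i\<in>A. f i z)"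
  by (induction A rule: finite_induct) (auto intro: near_circle_mult near_circle_const)

lemma near_circle_divide:
  assumes "near_circle f" "near_circle g" "\<And>z. cmod z = 1 \<Longrightarrow> g z \<noteq> 0"
  shows "near_circle (\<lambda>z. f z / g z)"
proof -
  obtain U where U: "open U" "sphere 0 1 \<subseteq> U" "f holomorphic_on U" "g holomorphic_on U"
    by (rule near_circle_common[OF assms(1,2)])
  have "open (U \<inter> g -` (- {0}))"
    by (rule continuous_open_preimage) (use U holomorphic_on_imp_continuous_on in auto)
  then show ?thesis
  proof (rule near_circleI)
    show "sphere 0 1 \<subseteq> U \<inter> g -` (- {0})" using U(2) assms(3) by auto
    have "f holomorphic_on U \<inter> g -` (- {0})" "g holomorphic_on U \<inter> g -` (- {0})"
      by (rule holomorphic_on_subset[OF U(3)], blast, rule holomorphic_on_subset[OF U(4)], blast)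
    then show "(\<lambda>z. f z / g z) holomorphic_on U \<inter> g -` (- {0})"
      by (rule holomorphic_on_divide) auto
  qed
qed

lemma near_circle_deriv: "near_circle f \<Longrightarrow> near_circle (deriv f)"
  unfolding near_circle_def using holomorphic_deriv by blast

lemma near_circle_integrable: "near_circle f \<Longrightarrow> f contour_integrable_on circlepath 0 1"
  unfolding near_circle_def
  by (elim exE conjE, rule contour_integrable_holomorphic_simple) auto

lemma near_circle_bounded:
  assumes "near_circle f"
  shows "\<exists>B\<ge>0. \<forall>z. cmod z = 1 \<longrightarrow> cmod (f z) \<le> B"
proof -
  obtain U where "sphere 0 1 \<subseteq> U" "f holomorphic_on U"
    using assms unfolding near_circle_def by blast
  then have "continuous_on (sphere 0 1) f"
    by (meson continuous_on_subset holomorphic_on_imp_continuous_on)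
  then have "bounded (f ` sphere 0 1)"
    by (intro compact_imp_bounded compact_continuous_image) auto
  then obtain B where "\<And>z. z \<in> sphere 0 1 \<Longrightarrow> cmod (f z) \<le> B"
    unfolding bounded_iff by (metis imageI)
  then show ?thesis
    by (intro exI[of _ "max B 0"]) (auto simp: le_max_iff_disj)
qed

definition lcoef :: "(complex \<Rightarrow> complex) \<Rightarrow> int \<Rightarrow> complex" where
  "lcoef f n = contour_integral (circlepath 0 1) (\<lambda>z. f z * z powi (- n - 1)) / (2 * of_real pi * \<i>)"

lemma lcoef_cong: "(\<And>z. cmod z = 1 \<Longrightarrow> f z = g z) \<Longrightarrow> lcoef f n = lcoef g n"
  unfolding lcoef_def by (rule arg_cong[where f = "\<lambda>x. x / _"], rule contour_integral_eq) auto

lemma lcoef_integrable: "near_circle f \<Longrightarrow> (\<lambda>z. f z * z powi m) contour_integrable_on circlepath 0 1"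
  by (intro near_circle_integrable near_circle_mult near_circle_powi)

lemma lcoef_add: "near_circle f \<Longrightarrow> near_circle g \<Longrightarrow> lcoef (\<lambda>z. f z + g z) n = lcoef f n + lcoef g n"
  unfolding lcoef_def by (simp add: distrib_right contour_integral_add lcoef_integrable add_divide_distrib)

lemma lcoef_cmult: "near_circle f \<Longrightarrow> lcoef (\<lambda>z. c * f z) n = c * lcoef f n"
  unfolding lcoef_def by (simp add: mult.assoc contour_integral_lmul lcoef_integrable)

lemma lcoef_diff: "near_circle f \<Longrightarrow> near_circle g \<Longrightarrow> lcoef (\<lambda>z. f z - g z) n = lcoef f n - lcoef g n"
  unfolding lcoef_def by (simp add: left_diff_distrib contour_integral_diff lcoef_integrable diff_divide_distrib)

lemma lcoef_shift: "lcoef (\<lambda>z. z powi m * f z) n = lcoef f (n - m)"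
proof -
  have "z powi m * f z * z powi (- n - 1) = f z * z powi (- (n - m) - 1)" if "cmod z = 1" for z
  proof -
    have "z \<noteq> 0" using that by auto
    then have "z powi (m + (- n - 1)) = z powi m * z powi (- n - 1)" by (intro power_int_add disjI1)
    moreover have "m + (- n - 1) = - (n - m) - 1" by simp
    ultimately have "z powi (- (n - m) - 1) = z powi m * z powi (- n - 1)" by (simp only:)
    then show ?thesis by (simp only: mult_ac)
  qed
  then show ?thesis
    unfolding lcoef_def by (intro arg_cong[where f = "\<lambda>x. x / _"] contour_integral_eq) auto
qed

lemma lcoef_deriv:
  assumes f: "near_circle f"
  shows "lcoef (deriv f) (n - 1) = of_int n * lcoef f n"
proof -
  obtain U where U: "open U" "sphere 0 1 \<subseteq> U" "0 \<notin> U" "f holomorphic_on U"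
    by (rule near_circle_common[OF f f])
  let ?g = "circlepath 0 1"
  have "((\<lambda>z. deriv f z * z powi (- n) + f z * (of_int (- n) * z powi (- n - 1)))
          has_contour_integral
          (\<lambda>z. f z * z powi (- n)) (pathfinish ?g) - (\<lambda>z. f z * z powi (- n)) (pathstart ?g)) ?g"
  proof (rule contour_integral_primitive)
    fix z assume z: "z \<in> U"
    have nz: "z \<noteq> 0" using z U(3) by auto
    have "(f has_field_derivative deriv f z) (at z within U)"
      using holomorphic_derivI[OF U(4,1) z] by (rule has_field_derivative_at_within)
    moreover have "((\<lambda>z. z powi (- n)) has_field_derivative (of_int (- n) * z powi (- n - 1))) (at z within U)"
      using nz by (auto intro!: derivative_eq_intros)
    ultimately show "((\<lambda>z. f z * z powi (- n)) has_field_derivative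
        deriv f z * z powi (- n) + f z * (of_int (- n) * z powi (- n - 1))) (at z within U)"
      by (subst add.commute) (rule DERIV_mult')
  qed (use U in auto)
  then have "contour_integral ?g (\<lambda>z. deriv f z * z powi (- n) + f z * (of_int (- n) * z powi (- n - 1))) = 0"
    by (simp add: contour_integral_unique)
  moreover have "contour_integral ?g (\<lambda>z. deriv f z * z powi (- n) + f z * (of_int (- n) * z powi (- n - 1))) =
      contour_integral ?g (\<lambda>z. deriv f z * z powi (- n)) - of_int n * contour_integral ?g (\<lambda>z. f z * z powi (- n - 1))"
  proof -
    have "contour_integral ?g (\<lambda>z. of_int n * (f z * z powi (- n - 1))) =
        of_int n * contour_integral ?g (\<lambda>z. f z * z powi (- n - 1))"
      by (rule contour_integral_lmul[OF lcoef_integrable[OF f]])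
    moreover have "contour_integral ?g (\<lambda>z. deriv f z * z powi (- n) - of_int n * (f z * z powi (- n - 1))) =
        contour_integral ?g (\<lambda>z. deriv f z * z powi (- n)) -
        contour_integral ?g (\<lambda>z. of_int n * (f z * z powi (- n - 1)))"
      by (intro contour_integral_diff contour_integrable_lmul lcoef_integrable near_circle_deriv f)
    ultimately show ?thesis by (simp add: algebra_simps)
  qed
  ultimately show ?thesis by (simp add: lcoef_def)
qed

lemma lcoef_bounded:
  assumes "near_circle f"
  obtains C where "\<And>n. cmod (lcoef f n) \<le> C"
proof -
  obtain B where B: "0 \<le> B" "\<And>z. cmod z = 1 \<Longrightarrow> cmod (f z) \<le> B"
    using near_circle_bounded[OF assms] by blast
  have "cmod (lcoef f n) \<le> B" for n
  proof -
    have "cmod (contour_integral (circlepath 0 1) (\<lambda>z. f z * z powi (- n - 1))) \<le> B * (2 * pi * 1)"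
      by (rule has_contour_integral_bound_circlepath[OF has_contour_integral_integral])
         (use B lcoef_integrable[OF assms] in \<open>auto simp: norm_mult norm_power_int\<close>)
    then show ?thesis by (simp add: lcoef_def norm_divide norm_mult field_simps)
  qed
  then show thesis by (rule that)
qed

lemma summable_on_int_inverse_squares: "(\<lambda>n::int. 1 / (1 + (real_of_int n)\<^sup>2)) summable_on UNIV"
proof -
  have s: "summable (\<lambda>n::nat. 1 / (1 + (real n + c)\<^sup>2))" if "0 \<le> c" for c :: real
  proof (rule summable_comparison_test')
    show "summable (\<lambda>n. inverse (real n ^ 2))" by (rule inverse_power_summable) simp
    show "norm (1 / (1 + (real n + c)\<^sup>2)) \<le> inverse (real n ^ 2)" if "n \<ge> 1" for n
    proof -
      have "(real n)\<^sup>2 \<le> (real n + c)\<^sup>2" using \<open>0 \<le> c\<close> by (intro power_mono) auto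
      then have "inverse (1 + (real n + c)\<^sup>2) \<le> inverse ((real n)\<^sup>2)"
        using that by (intro le_imp_inverse_le) auto
      moreover have "0 \<le> inverse (1 + (real n + c)\<^sup>2)" by simp
      ultimately show ?thesis by (simp only: divide_inverse mult_1 real_norm_def abs_of_nonneg)
    qed
  qed
  have "(\<lambda>n::int. 1 / (1 + (real_of_int n)\<^sup>2)) summable_on range int"
    by (subst summable_on_reindex) (use s[of 0] in \<open>auto simp: o_def intro!: summable_nonneg_imp_summable_on\<close>)
  moreover have "(\<lambda>n::int. 1 / (1 + (real_of_int n)\<^sup>2)) summable_on range (\<lambda>n. - int n - 1)"
  proof (subst summable_on_reindex)
    have "(real n + 1)\<^sup>2 = (- real n - 1)\<^sup>2" for n :: nat by (simp add: power2_eq_square algebra_simps)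
    then show "((\<lambda>n. 1 / (1 + (real_of_int n)\<^sup>2)) \<circ> (\<lambda>n. - int n - 1)) summable_on UNIV"
      using s[of 1] by (auto simp: o_def intro!: summable_nonneg_imp_summable_on)
  qed (auto simp: inj_on_def)
  ultimately have "(\<lambda>n::int. 1 / (1 + (real_of_int n)\<^sup>2)) summable_on range int \<union> range (\<lambda>n. - int n - 1)"
    by (rule summable_on_Un_disjoint) auto
  moreover have "range int \<union> range (\<lambda>n. - int n - 1) = UNIV"
  proof (intro set_eqI iffI UNIV_I)
    fix n :: int
    have "n = int (nat n) \<or> n = - int (nat (- n - 1)) - 1" by linarith
    then show "n \<in> range int \<union> range (\<lambda>n. - int n - 1)" by blast
  qed
  ultimately show ?thesis by simp
qed

lemma lcoef_abs_summable:
  assumes f: "near_circle f"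
  shows "(\<lambda>n. cmod (lcoef f n)) summable_on UNIV"
proof -
  have f': "near_circle (deriv f)" and f'': "near_circle (deriv (deriv f))"
    using f near_circle_deriv by auto
  obtain C0 C1 C2 where C: "\<And>n. cmod (lcoef f n) \<le> C0" "\<And>n. cmod (lcoef (deriv f) n) \<le> C1"
      "\<And>n. cmod (lcoef (deriv (deriv f)) n) \<le> C2"
    using lcoef_bounded[OF f] lcoef_bounded[OF f'] lcoef_bounded[OF f''] by metis
  have "cmod (lcoef f n) \<le> (C0 + C1 + C2) * (1 / (1 + (real_of_int n)\<^sup>2))" for n
  proof -
    have e1: "lcoef (deriv f) (n - 1) = of_int n * lcoef f n"
      by (rule lcoef_deriv[OF f])
    have e2: "lcoef (deriv (deriv f)) (n - 1 - 1) = of_int (n - 1) * lcoef (deriv f) (n - 1)"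
      by (rule lcoef_deriv[OF f'])
    have "(1 + (of_int n)\<^sup>2) * lcoef f n =
        lcoef f n + lcoef (deriv f) (n - 1) + lcoef (deriv (deriv f)) (n - 1 - 1)"
      unfolding e2 unfolding e1 by (simp add: algebra_simps power2_eq_square)
    then have "cmod ((1 + (of_int n)\<^sup>2) * lcoef f n) \<le> C0 + C1 + C2"
      using C(1)[of n] C(2)[of "n - 1"] C(3)[of "n - 1 - 1"]
      by (simp only:) (intro norm_triangle_le add_mono; simp)
    moreover have "cmod (1 + (of_int n)\<^sup>2) = 1 + (real_of_int n)\<^sup>2"
    proof -
      have "(1 + (of_int n)\<^sup>2 :: complex) = of_real (1 + (real_of_int n)\<^sup>2)" by simp
      then show ?thesis by (simp only: norm_of_real) simp
    qed
    ultimately have "(1 + (real_of_int n)\<^sup>2) * cmod (lcoef f n) \<le> C0 + C1 + C2"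
      by (simp add: norm_mult)
    then show ?thesis
      by (simp add: field_simps add_pos_nonneg)
  qed
  then show ?thesis
    by (intro summable_on_comparison_test[OF summable_on_cmult_right[OF summable_on_int_inverse_squares]]) auto
qed

lemma has_sum_lcoef_mult:
  assumes \<alpha>: "(\<lambda>k. cmod (\<alpha> k)) summable_on UNIV"
    and F: "\<And>z. cmod z = 1 \<Longrightarrow> ((\<lambda>k. \<alpha> k * z powi k) has_sum F z) UNIV"
    and G: "near_circle G"
  shows "((\<lambda>k. \<alpha> k * lcoef G (n - k)) has_sum lcoef (\<lambda>z. F z * G z) n) UNIV"
proof -
  let ?g = "circlepath 0 1" and ?h = "\<lambda>z. G z * z powi (- n - 1)"
  have h: "near_circle ?h" by (intro near_circle_mult G near_circle_powi)
  obtain B where B: "0 \<le> B" "\<And>z. cmod z = 1 \<Longrightarrow> cmod (?h z) \<le> B"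
    using near_circle_bounded[OF h] by blast
  have "uniform_limit (sphere 0 1) (\<lambda>X z. \<Sum>k\<in>X. \<alpha> k * z powi k * ?h z) (\<lambda>z. F z * ?h z)
          (finite_subsets_at_top UNIV)"
  proof (rule Weierstrass_m_test_general')
    show "norm (\<alpha> k * z powi k * ?h z) \<le> cmod (\<alpha> k) * B" if "z \<in> sphere 0 1" for k z
      using that B(2)[of z] by (simp add: norm_mult norm_power_int mult_left_mono)
    show "((\<lambda>k. \<alpha> k * z powi k * ?h z) has_sum F z * ?h z) UNIV" if "z \<in> sphere 0 1" for z
      using that by (intro has_sum_cmult_left F) simp
    show "(\<lambda>k. cmod (\<alpha> k) * B) summable_on UNIV" by (intro summable_on_cmult_left \<alpha>)
  qed
  then have "((\<lambda>X. contour_integral ?g (\<lambda>z. \<Sum>k\<in>X. \<alpha> k * z powi k * ?h z)) \<longlongrightarrow>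
      contour_integral ?g (\<lambda>z. F z * ?h z)) (finite_subsets_at_top UNIV)"
  proof (rule contour_integral_uniform_limit_circlepath(2)[rotated])
    have "(\<lambda>z. \<Sum>k\<in>X. \<alpha> k * z powi k * ?h z) contour_integrable_on ?g" if "finite X" for X
      by (intro near_circle_integrable near_circle_sum near_circle_mult near_circle_const
          near_circle_powi G that)
    then show "\<forall>\<^sub>F X in finite_subsets_at_top UNIV.
        (\<lambda>z. \<Sum>k\<in>X. \<alpha> k * z powi k * ?h z) contour_integrable_on ?g"
      by (rule eventually_finite_subsets_at_top_weakI)
  qed auto
  moreover have "contour_integral ?g (\<lambda>z. \<Sum>k\<in>X. \<alpha> k * z powi k * ?h z) =
      (\<Sum>k\<in>X. \<alpha> k * lcoef G (n - k) * (2 * of_real pi * \<i>))" if "finite X" for X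
  proof -
    have "contour_integral ?g (\<lambda>z. \<Sum>k\<in>X. \<alpha> k * z powi k * ?h z) =
        (\<Sum>k\<in>X. contour_integral ?g (\<lambda>z. \<alpha> k * z powi k * ?h z))"
      by (intro contour_integral_sum that near_circle_integrable near_circle_mult near_circle_const
          near_circle_powi G)
    also have "\<dots> = (\<Sum>k\<in>X. \<alpha> k * lcoef G (n - k) * (2 * of_real pi * \<i>))"
    proof (rule sum.cong[OF refl])
      fix k
      have "contour_integral ?g (\<lambda>z. \<alpha> k * z powi k * ?h z) =
          contour_integral ?g (\<lambda>z. \<alpha> k * (z powi k * G z * z powi (- n - 1)))"
        by (simp add: mult_ac)
      also have "\<dots> = \<alpha> k * contour_integral ?g (\<lambda>z. z powi k * G z * z powi (- n - 1))"
        by (intro contour_integral_lmul lcoef_integrable near_circle_mult near_circle_powi G)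
      also have "\<dots> = \<alpha> k * (lcoef (\<lambda>z. z powi k * G z) n * (2 * of_real pi * \<i>))"
        by (simp add: lcoef_def)
      finally show "contour_integral ?g (\<lambda>z. \<alpha> k * z powi k * ?h z) = \<alpha> k * lcoef G (n - k) * (2 * of_real pi * \<i>)"
        by (simp add: lcoef_shift)
    qed
    finally show ?thesis .
  qed
  ultimately have "((\<lambda>X. \<Sum>k\<in>X. \<alpha> k * lcoef G (n - k) * (2 * of_real pi * \<i>)) \<longlongrightarrow>
      contour_integral ?g (\<lambda>z. F z * ?h z)) (finite_subsets_at_top UNIV)"
    by (elim Lim_transform_eventually) (auto intro!: eventually_finite_subsets_at_top_weakI)
  then have "((\<lambda>k. \<alpha> k * lcoef G (n - k) * (2 * of_real pi * \<i>)) has_sum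
      contour_integral ?g (\<lambda>z. F z * ?h z)) UNIV"
    by (simp add: has_sum_def)
  from this[THEN has_sum_cmult_left, of "1 / (2 * of_real pi * \<i>)"]
  have "((\<lambda>k. \<alpha> k * lcoef G (n - k)) has_sum
      contour_integral ?g (\<lambda>z. F z * ?h z) * (1 / (2 * of_real pi * \<i>))) UNIV" by simp
  moreover have "lcoef (\<lambda>z. F z * G z) n = contour_integral ?g (\<lambda>z. F z * ?h z) * (1 / (2 * of_real pi * \<i>))"
    by (simp add: lcoef_def mult.assoc)
  ultimately show ?thesis by (simp only:)
qed

lemma lcoef_const: "lcoef (\<lambda>_. c) n = (if n = 0 then c else 0)"
proof (cases "n = 0")
  case True
  have "contour_integral (circlepath 0 1) (\<lambda>z. c * (1 / (z - 0))) =
      c * contour_integral (circlepath 0 1) (\<lambda>z. 1 / (z - 0))"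
    by (intro contour_integral_lmul near_circle_integrable near_circle_divide near_circle_diff
        near_circle_const near_circle_ident) auto
  also have "contour_integral (circlepath 0 1) (\<lambda>z. 1 / (z - 0)) = 2 * of_real pi * \<i>"
    by (rule contour_integral_circlepath) simp
  finally have "contour_integral (circlepath 0 1) (\<lambda>z. c * (1 / (z - 0))) = c * (2 * of_real pi * \<i>)" .
  moreover have "lcoef (\<lambda>_. c) n = contour_integral (circlepath 0 1) (\<lambda>z. c * (1 / (z - 0))) / (2 * of_real pi * \<i>)"
    unfolding lcoef_def using True
    by (intro arg_cong[where f = "\<lambda>x. x / _"] contour_integral_eq) (auto simp: power_int_minus divide_inverse)
  ultimately show ?thesis using True by simp
next
  case False
  have "lcoef (deriv (\<lambda>_. c)) (n - 1) = of_int n * lcoef (\<lambda>_. c) n"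
    by (rule lcoef_deriv[OF near_circle_const])
  moreover have "lcoef (deriv (\<lambda>_. c)) (n - 1) = 0"
    by (simp add: lcoef_def)
  ultimately show ?thesis using False by simp
qed

lemma has_sum_single: "((\<lambda>k. if k = n then c else 0) has_sum c) UNIV"
  by (rule has_sum_finite_neutralI[of "{n}"]) auto

lemma lcoef_unique:
  assumes "(\<lambda>k. cmod (\<alpha> k)) summable_on UNIV"
    and "\<And>z. cmod z = 1 \<Longrightarrow> ((\<lambda>k. \<alpha> k * z powi k) has_sum F z) UNIV"
  shows "lcoef F n = \<alpha> n"
proof -
  have "((\<lambda>k. \<alpha> k * lcoef (\<lambda>_. 1) (n - k)) has_sum lcoef (\<lambda>z. F z * 1) n) UNIV"
    by (rule has_sum_lcoef_mult[OF assms near_circle_const])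
  moreover have "(\<lambda>k. \<alpha> k * lcoef (\<lambda>_. 1) (n - k)) = (\<lambda>k. if k = n then \<alpha> n else 0)"
    by (auto simp: lcoef_const)
  ultimately show ?thesis
    using has_sum_single[of n "\<alpha> n"] has_sum_unique by (metis (no_types, lifting) lcoef_cong mult.right_neutral)
qed

text \<open>
  Writing \<open>f z = f z\<^sub>0 + (z - z\<^sub>0) * g z\<close> with \<open>g\<close> again holomorphic near the circle, the Laurent
  series of the second summand telescopes at \<open>z\<^sub>0\<close>.
\<close>

lemma has_sum_lcoef:
  assumes f: "near_circle f" and z0: "cmod z0 = 1"
  shows "((\<lambda>n. lcoef f n * z0 powi n) has_sum f z0) UNIV"
proof -
  obtain U where U: "open U" "sphere 0 1 \<subseteq> U" "f holomorphic_on U"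
    using f unfolding near_circle_def by blast
  define g where "g = (\<lambda>z. if z = z0 then deriv f z0 else (f z - f z0) / (z - z0))"
  have "g holomorphic_on U"
    unfolding g_def by (rule pole_lemma) (use U z0 in \<open>auto simp: interior_open\<close>)
  with U have g: "near_circle g" by (intro near_circleI)
  have fg: "f z = f z0 + (z powi 1 * g z - z0 * g z)" for z
    by (auto simp: g_def field_simps)
  have nz: "z0 \<noteq> 0" using z0 by auto
  have "lcoef f n = lcoef (\<lambda>z. f z0 + (z powi 1 * g z - z0 * g z)) n" for n
    by (rule lcoef_cong) (rule fg)
  also have "lcoef (\<lambda>z. f z0 + (z powi 1 * g z - z0 * g z)) n =
      (if n = 0 then f z0 else 0) + (lcoef g (n - 1) - z0 * lcoef g n)" for n
    by (simp only: lcoef_add lcoef_diff lcoef_const lcoef_shift lcoef_cmult near_circle_const g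
        near_circle_mult near_circle_powi near_circle_diff)
  finally have c': "lcoef f n = (if n = 0 then f z0 else 0) + (lcoef g (n - 1) - z0 * lcoef g n)" for n .
  have c: "lcoef f n * z0 powi n = (if n = 0 then f z0 else 0) +
      (lcoef g (n - 1) * z0 powi (n - 1 + 1) - lcoef g n * z0 powi (n + 1))" for n
  proof -
    have "z0 powi (n + 1) = z0 powi n * z0"
      using nz by (simp add: power_int_add)
    moreover have "(if n = 0 then f z0 else 0) * z0 powi n = (if n = 0 then f z0 else 0)" by simp
    ultimately show ?thesis
      unfolding c' distrib_right left_diff_distrib by (simp add: mult_ac)
  qed
  have "(\<lambda>n. norm (lcoef g n * z0 powi (n + 1))) summable_on UNIV"
    using lcoef_abs_summable[OF g] z0 by (simp add: norm_mult norm_power_int)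
  then have "(\<lambda>n. lcoef g n * z0 powi (n + 1)) summable_on UNIV"
    by (rule abs_summable_summable)
  then obtain s where s: "((\<lambda>n. lcoef g n * z0 powi (n + 1)) has_sum s) UNIV"
    by (auto simp: summable_on_def)
  have "bij (\<lambda>n::int. n - 1)" by (rule bij_betw_byWitness[of _ "\<lambda>n. n + 1"]) auto
  from has_sum_reindex_bij_betw[OF this, of "\<lambda>n. lcoef g n * z0 powi (n + 1)" s] s
  have s': "((\<lambda>n. lcoef g (n - 1) * z0 powi (n - 1 + 1)) has_sum s) UNIV" by simp
  have "((\<lambda>n. - (lcoef g n * z0 powi (n + 1))) has_sum - s) UNIV"
    using s by (simp add: has_sum_uminus)
  from has_sum_add[OF has_sum_single[of 0 "f z0"] has_sum_add[OF s' this]]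
  show ?thesis unfolding c by simp
qed

lemma has_sum_lcoef_prod:
  assumes "near_circle f" "near_circle g"
  shows "((\<lambda>k. lcoef f k * lcoef g (n - k)) has_sum lcoef (\<lambda>z. f z * g z) n) UNIV"
  by (rule has_sum_lcoef_mult[OF lcoef_abs_summable has_sum_lcoef]) (use assms in auto)

lemma
  assumes f: "near_circle f"
  shows near_circle_reflect: "near_circle (\<lambda>z. cnj (f (- cnj z)))"
    and lcoef_reflect: "lcoef (\<lambda>z. cnj (f (- cnj z))) n = (-1) powi n * cnj (lcoef f n)"
proof -
  obtain U where U: "open U" "sphere 0 1 \<subseteq> U" "f holomorphic_on U"
    using f unfolding near_circle_def by blast
  define V where "V = (\<lambda>z. - cnj z) -` U"
  have V: "open V" unfolding V_def using U(1) by (intro open_vimage continuous_intros)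
  have "(cnj \<circ> (f \<circ> uminus) \<circ> cnj) holomorphic_on V"
  proof (rule holomorphic_on_compose_cnj_cnj[OF _ V])
    show "f \<circ> uminus holomorphic_on cnj ` V"
      by (rule holomorphic_on_compose_gen[OF _ U(3)]) (auto simp: V_def intro!: holomorphic_intros)
  qed
  then show "near_circle (\<lambda>z. cnj (f (- cnj z)))"
    by (intro near_circleI[OF V]) (use U(2) in \<open>auto simp: o_def V_def subset_iff\<close>)
  show "lcoef (\<lambda>z. cnj (f (- cnj z))) n = (-1) powi n * cnj (lcoef f n)"
  proof (rule lcoef_unique)
    show "(\<lambda>k. cmod ((-1) powi k * cnj (lcoef f k))) summable_on UNIV"
      using lcoef_abs_summable[OF f] by (simp add: norm_mult norm_power_int)
    fix z :: complex assume z: "cmod z = 1"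
    have "((\<lambda>n. cnj (lcoef f n * (- cnj z) powi n)) has_sum cnj (f (- cnj z))) UNIV"
      unfolding has_sum_cnj_iff by (rule has_sum_lcoef[OF f]) (use z in simp)
    moreover have "cnj (lcoef f n * (- cnj z) powi n) = (-1) powi n * cnj (lcoef f n) * z powi n" for n
    proof -
      have "cnj ((- cnj z) powi n) = (- z) powi n" by (simp add: power_int_def)
      also have "\<dots> = (-1) powi n * z powi n" by (simp flip: power_int_mult_distrib)
      finally show ?thesis by simp
    qed
    ultimately show "((\<lambda>k. (-1) powi k * cnj (lcoef f k) * z powi k) has_sum cnj (f (- cnj z))) UNIV"
      by (simp only:)
  qed
qed

section \<open>Laurent operators on vector-valued square-summable sequences\<close>

type_synonym 'p seq = "(int \<times> 'p) ell2"

definition mnear :: "(complex \<Rightarrow> complex ^ 'm ^ 'n) \<Rightarrow> bool" where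
  "mnear F \<longleftrightarrow> (\<forall>i j. near_circle (\<lambda>z. F z $ i $ j))"

definition lop :: "(complex \<Rightarrow> complex ^ 'p ^ 'p) \<Rightarrow> 'p seq \<Rightarrow> 'p seq" where
  "lop F = kop (\<lambda>x y. lcoef (\<lambda>z. F z $ snd x $ snd y) (fst x - fst y))"

lemma mnearD: "mnear F \<Longrightarrow> near_circle (\<lambda>z. F z $ i $ j)"
  by (simp add: mnear_def)

lemma mnear_const: "mnear (\<lambda>_. A)"
  by (simp add: mnear_def near_circle_const)

lemma mnear_diff: "mnear F \<Longrightarrow> mnear G \<Longrightarrow> mnear (\<lambda>z. F z - G z)"
  by (simp add: mnear_def near_circle_diff)

lemma mnear_mult: "mnear F \<Longrightarrow> mnear G \<Longrightarrow> mnear (\<lambda>z. F z ** G z)"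
  by (simp add: mnear_def matrix_matrix_mult_def near_circle_sum near_circle_mult)

lemma mnear_reflect: "mnear F \<Longrightarrow> mnear (\<lambda>z. cadjoint (F (- cnj z)))"
  unfolding mnear_def cadjoint_def using near_circle_reflect by fastforce

lemma sum_lcoef_le:
  assumes "near_circle f" "finite H" "inj_on g H"
  shows "(\<Sum>m\<in>H. cmod (lcoef f (g m))) \<le> (\<Sum>\<^sub>\<infinity>n. cmod (lcoef f n))"
proof -
  have "(\<Sum>m\<in>H. cmod (lcoef f (g m))) = (\<Sum>n\<in>g ` H. cmod (lcoef f n))"
    using assms(3) by (simp add: sum.reindex)
  also have "\<dots> \<le> (\<Sum>\<^sub>\<infinity>n. cmod (lcoef f n))"
    by (rule finite_sum_le_infsum[OF lcoef_abs_summable]) (use assms in auto)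
  finally show ?thesis .
qed

lemma schur_lop:
  assumes F: "mnear (F :: complex \<Rightarrow> complex ^ 'p ^ 'p)"
  obtains M where "schur (\<lambda>x y. lcoef (\<lambda>z. F z $ snd x $ snd y) (fst x - fst y)) M"
proof -
  let ?c = "\<lambda>i j. \<Sum>\<^sub>\<infinity>n. cmod (lcoef (\<lambda>z. F z $ i $ j) n)"
  let ?M = "\<Sum>i\<in>UNIV. \<Sum>j\<in>UNIV. ?c i j"
  have c: "0 \<le> ?c i j" for i j by (intro infsum_nonneg) auto
  have le: "(\<Sum>y\<in>G. h y) \<le> (\<Sum>j\<in>UNIV. \<Sum>m\<in>fst ` G. h (m, j))"
    if "finite G" "\<And>y. 0 \<le> h y" for G and h :: "int \<times> 'p \<Rightarrow> real"
  proof -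
    have "(\<Sum>y\<in>G. h y) \<le> (\<Sum>y\<in>fst ` G \<times> UNIV. h y)"
      by (rule sum_mono2) (use that in \<open>auto intro: rev_image_eqI\<close>)
    also have "\<dots> = (\<Sum>m\<in>fst ` G. \<Sum>j\<in>UNIV. h (m, j))"
      by (simp add: sum.cartesian_product)
    also have "\<dots> = (\<Sum>j\<in>UNIV. \<Sum>m\<in>fst ` G. h (m, j))" by (rule sum.swap)
    finally show ?thesis .
  qed
  have "schur (\<lambda>x y. lcoef (\<lambda>z. F z $ snd x $ snd y) (fst x - fst y)) ?M"
    unfolding schur_def
  proof (intro conjI allI impI)
    fix x :: "int \<times> 'p" and G :: "(int \<times> 'p) set" assume G: "finite G"
    have "(\<Sum>y\<in>G. cmod (lcoef (\<lambda>z. F z $ snd x $ snd y) (fst x - fst y))) \<le>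
        (\<Sum>j\<in>UNIV. \<Sum>m\<in>fst ` G. cmod (lcoef (\<lambda>z. F z $ snd x $ j) (fst x - m)))"
      using le[OF G, of "\<lambda>y. cmod (lcoef (\<lambda>z. F z $ snd x $ snd y) (fst x - fst y))"] by simp
    also have "\<dots> \<le> (\<Sum>j\<in>UNIV. ?c (snd x) j)"
      by (intro sum_mono sum_lcoef_le mnearD F) (use G in \<open>auto simp: inj_on_def\<close>)
    also have "\<dots> \<le> ?M"
      by (rule member_le_sum[of _ _ "\<lambda>i. \<Sum>j\<in>UNIV. ?c i j"]) (auto intro!: sum_nonneg c)
    finally show "(\<Sum>y\<in>G. cmod (lcoef (\<lambda>z. F z $ snd x $ snd y) (fst x - fst y))) \<le> ?M" .
  next
    fix y :: "int \<times> 'p" and G :: "(int \<times> 'p) set" assume G: "finite G"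
    have "(\<Sum>x\<in>G. cmod (lcoef (\<lambda>z. F z $ snd x $ snd y) (fst x - fst y))) \<le>
        (\<Sum>i\<in>UNIV. \<Sum>m\<in>fst ` G. cmod (lcoef (\<lambda>z. F z $ i $ snd y) (m - fst y)))"
      using le[OF G, of "\<lambda>x. cmod (lcoef (\<lambda>z. F z $ snd x $ snd y) (fst x - fst y))"] by simp
    also have "\<dots> \<le> (\<Sum>i\<in>UNIV. ?c i (snd y))"
      by (intro sum_mono sum_lcoef_le mnearD F) (use G in \<open>auto simp: inj_on_def\<close>)
    also have "\<dots> \<le> ?M"
      by (intro sum_mono member_le_sum c) auto
    finally show "(\<Sum>x\<in>G. cmod (lcoef (\<lambda>z. F z $ snd x $ snd y) (fst x - fst y))) \<le> ?M" .
  qed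
  then show thesis by (rule that)
qed

lemma has_sum_lop:
  assumes "mnear F"
  shows "((\<lambda>y. lcoef (\<lambda>z. F z $ i $ snd y) (n - fst y) * coord f y) has_sum coord (lop F f) (n, i)) UNIV"
proof -
  obtain M where "schur (\<lambda>x y. lcoef (\<lambda>z. F z $ snd x $ snd y) (fst x - fst y)) M"
    by (rule schur_lop[OF assms])
  from has_sum_kop[OF this, of "(n, i)" f] show ?thesis by (simp add: lop_def)
qed

lemma lop_eqI:
  assumes F: "mnear F"
    and sums: "\<And>n i. ((\<lambda>y. lcoef (\<lambda>z. F z $ i $ snd y) (n - fst y) * coord f y) has_sum coord g (n, i)) UNIV"
  shows "lop F f = g"
proof (rule ell2_eqI)
  fix x
  show "coord (lop F f) x = coord g x"
    using has_sum_unique[OF has_sum_lop[OF F, of "snd x" "fst x" f] sums[of "snd x" "fst x"]] by simp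
qed

lemma
  assumes F: "mnear F"
  shows lop_add: "lop F (f + g) = lop F f + lop F g"
    and lop_scale: "lop F (cscale c f) = cscale c (lop F f)"
    and lop_bounded: "\<exists>M. \<forall>f. nrm (lop F f) \<le> M * nrm f"
proof -
  obtain M where M: "schur (\<lambda>x y. lcoef (\<lambda>z. F z $ snd x $ snd y) (fst x - fst y)) M"
    by (rule schur_lop[OF F])
  show "lop F (f + g) = lop F f + lop F g" unfolding lop_def by (rule kop_add[OF M])
  show "lop F (cscale c f) = cscale c (lop F f)" unfolding lop_def by (rule kop_scale[OF M])
  show "\<exists>M. \<forall>f. nrm (lop F f) \<le> M * nrm f" unfolding lop_def using nrm_kop_le[OF M] by blast
qed

lemma lop_zero: "mnear F \<Longrightarrow> lop F 0 = 0"
  using lop_add[of F 0 0] by simp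

lemma lop_minus: "mnear F \<Longrightarrow> lop F (- f) = - lop F f"
  using lop_add[of F f "- f"] lop_zero[of F] by (simp add: eq_neg_iff_add_eq_0 add.commute)

lemma lop_vdiff: "mnear F \<Longrightarrow> lop F (f - g) = lop F f - lop F g"
  using lop_add[of F f "- g"] lop_minus[of F g] by simp

lemma lop_cong: "(\<And>z. cmod z = 1 \<Longrightarrow> F z = G z) \<Longrightarrow> lop F = lop G"
  unfolding lop_def by (intro arg_cong[where f = kop] ext lcoef_cong) simp

lemma lop_diff:
  assumes "mnear F" "mnear G"
  shows "lop (\<lambda>z. F z - G z) f = lop F f - lop G f"
proof (rule lop_eqI[OF mnear_diff[OF assms]])
  fix n i
  have "((\<lambda>y. - (lcoef (\<lambda>z. G z $ i $ snd y) (n - fst y) * coord f y)) has_sum - coord (lop G f) (n, i)) UNIV"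
    using has_sum_lop[OF assms(2)] by (simp add: has_sum_uminus)
  from has_sum_add[OF has_sum_lop[OF assms(1)] this]
  show "((\<lambda>y. lcoef (\<lambda>z. (F z - G z) $ i $ snd y) (n - fst y) * coord f y) has_sum
      coord (lop F f - lop G f) (n, i)) UNIV"
    using assms by (simp add: lcoef_diff mnearD left_diff_distrib)
qed

lemma sum_singleton_Times: "(\<Sum>x\<in>{k} \<times> A. g x) = (\<Sum>i\<in>A. g (k, i))"
proof -
  have "{k} \<times> A = Pair k ` A" by auto
  then show ?thesis by (simp add: sum.reindex inj_on_def)
qed

lemma minus_one_powi: "(-1 :: complex) powi n = (if even n then 1 else -1)"
  by (auto simp: power_int_def even_nat_iff)

lemma has_sum_blocks:
  fixes h :: "int \<times> 'p::finite \<Rightarrow> complex"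
  assumes "\<And>l. ((\<lambda>q. h (q, l)) has_sum s l) UNIV"
  shows "(h has_sum (\<Sum>l\<in>UNIV. s l)) UNIV"
proof -
  have "((\<lambda>p. if snd p = l then h p else 0) has_sum s l) UNIV" for l
  proof -
    have "(h has_sum s l) (range (\<lambda>q. (q, l)))"
      by (subst has_sum_reindex) (use assms in \<open>auto simp: o_def inj_on_def\<close>)
    then show ?thesis
      by (rule has_sum_cong_neutral[THEN iffD1, rotated -1]) auto
  qed
  then have "((\<lambda>p. \<Sum>l\<in>UNIV. if snd p = l then h p else 0) has_sum (\<Sum>l\<in>UNIV. s l)) UNIV"
    by (intro has_sum_finite_sum) auto
  then show ?thesis by simp
qed

lemma lcoef_sum:
  assumes "finite A" "\<And>i. i \<in> A \<Longrightarrow> near_circle (f i)"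
  shows "lcoef (\<lambda>z. \<Sum>i\<in>A. f i z) n = (\<Sum>i\<in>A. lcoef (f i) n)"
  using assms by (induction A rule: finite_induct) (auto simp: lcoef_add near_circle_sum lcoef_const)

lemma bij_int_reflect: "bij (\<lambda>q::int. n - q)"
  by (rule bij_betw_byWitness[of _ "\<lambda>q. n - q"]) auto

lemma lop_mult:
  assumes F: "mnear F" and G: "mnear G"
  shows "lop F (lop G f) = lop (\<lambda>z. F z ** G z) f"
proof -
  obtain M L C where
    "schur (\<lambda>x y. lcoef (\<lambda>z. F z $ snd x $ snd y) (fst x - fst y)) M"
    "schur (\<lambda>x y. lcoef (\<lambda>z. G z $ snd x $ snd y) (fst x - fst y)) L"
    "schur (\<lambda>x y. lcoef (\<lambda>z. (F z ** G z) $ snd x $ snd y) (fst x - fst y)) C"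
    by (rule schur_lop[OF F], rule schur_lop[OF G], rule schur_lop[OF mnear_mult[OF F G]])
  then show ?thesis
    unfolding lop_def
  proof (rule kop_comp)
    fix x z :: "int \<times> 'a"
    obtain n i m j where x: "x = (n, i)" and z: "z = (m, j)" by (metis surj_pair)
    have "((\<lambda>q. lcoef (\<lambda>z. F z $ i $ l) (n - q) * lcoef (\<lambda>z. G z $ l $ j) (q - m)) has_sum
        lcoef (\<lambda>z. F z $ i $ l * G z $ l $ j) (n - m)) UNIV" for l
      using has_sum_lcoef_prod[OF mnearD[OF F] mnearD[OF G], of i l l j "n - m"]
        has_sum_reindex_bij_betw[OF bij_int_reflect[of n],
          of "\<lambda>k. lcoef (\<lambda>z. F z $ i $ l) k * lcoef (\<lambda>z. G z $ l $ j) (n - m - k)"]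
      by (simp add: algebra_simps)
    then have "((\<lambda>y. lcoef (\<lambda>z. F z $ i $ snd y) (n - fst y) * lcoef (\<lambda>z. G z $ snd y $ j) (fst y - m)) has_sum
        (\<Sum>l\<in>UNIV. lcoef (\<lambda>z. F z $ i $ l * G z $ l $ j) (n - m))) UNIV"
      by (intro has_sum_blocks) simp
    then show "((\<lambda>y. lcoef (\<lambda>z. F z $ snd x $ snd y) (fst x - fst y) *
        lcoef (\<lambda>za. G za $ snd y $ snd z) (fst y - fst z)) has_sum
        lcoef (\<lambda>za. (F za ** G za) $ snd x $ snd z) (fst x - fst z)) UNIV"
      by (simp add: x z matrix_matrix_mult_def lcoef_sum near_circle_mult mnearD F G)
  qed
qed

lemma lop_one: "lop (\<lambda>_. mat 1) f = f"
proof (rule lop_eqI[OF mnear_const])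
  fix n :: int and i :: 'a
  have "lcoef (\<lambda>z. (mat 1 :: complex ^ 'a ^ 'a) $ i $ snd y) (n - fst y) * coord f y =
      (if y = (n, i) then coord f (n, i) else 0)" for y
    by (auto simp: lcoef_const mat_def prod_eq_iff)
  then show "((\<lambda>y. lcoef (\<lambda>z. (mat 1 :: complex ^ 'a ^ 'a) $ i $ snd y) (n - fst y) * coord f y) has_sum
      coord f (n, i)) UNIV"
    by (simp only:) (rule has_sum_finite_neutralI[of "{(n, i)}"]; auto)
qed

lemma lop_inverse:
  assumes "mnear F" "mnear G" "\<And>z. cmod z = 1 \<Longrightarrow> F z ** G z = mat 1"
  shows "lop F (lop G f) = f"
  using lop_mult[OF assms(1,2)] lop_cong[of "\<lambda>z. F z ** G z" "\<lambda>_. mat 1"] assms(3) lop_one by metis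

lemma summable_on_square_reindex:
  assumes f: "(\<lambda>x. (cmod (f x))\<^sup>2) summable_on UNIV" and g: "bij g"
    and le: "\<And>x. cmod (h x) \<le> cmod (f (g x))"
  shows "(\<lambda>x. (cmod (h x))\<^sup>2) summable_on UNIV"
proof (rule summable_on_comparison_test)
  show "(\<lambda>x. (cmod (f (g x)))\<^sup>2) summable_on UNIV"
    using f summable_on_reindex_bij_betw[OF g, of "\<lambda>x. (cmod (f x))\<^sup>2"] by simp
  show "(cmod (h x))\<^sup>2 \<le> (cmod (f (g x)))\<^sup>2" for x
    by (intro power_mono le) auto
qed auto

lemma nrm_reindex_le:
  assumes "bij g" "\<And>x. cmod (coord h x) \<le> cmod (coord f (g x))"
  shows "nrm h \<le> nrm f"
proof (rule nrm_leI[OF nrm_nonneg])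
  fix F :: "'a set" assume "finite F"
  have "(\<Sum>x\<in>F. (cmod (coord h x))\<^sup>2) \<le> (\<Sum>x\<in>F. (cmod (coord f (g x)))\<^sup>2)"
    by (intro sum_mono power_mono assms) auto
  also have "\<dots> = (\<Sum>y\<in>g ` F. (cmod (coord f y))\<^sup>2)"
    using assms(1) by (simp add: sum.reindex inj_on_subset[OF bij_is_inj])
  also have "\<dots> \<le> (nrm f)\<^sup>2" by (rule nrm_sum_le) (use \<open>finite F\<close> in simp)
  finally show "(\<Sum>x\<in>F. (cmod (coord h x))\<^sup>2) \<le> (nrm f)\<^sup>2" .
qed

lemma bij_shift_index: "bij (\<lambda>x::int \<times> 'p. (fst x + k, snd x))"
  by (rule bij_betw_byWitness[of _ "\<lambda>x. (fst x - k, snd x)"]) auto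

lemma bij_reflect_index: "bij (\<lambda>x::int \<times> 'p. (k - fst x, snd x))"
  by (rule bij_betw_byWitness[of _ "\<lambda>x. (k - fst x, snd x)"]) auto

lift_definition shift :: "int \<Rightarrow> 'p seq \<Rightarrow> 'p seq" is "\<lambda>k f x. f (fst x - k, snd x)"
proof -
  fix k and f :: "int \<times> 'p \<Rightarrow> complex" assume "(\<lambda>x. (cmod (f x))\<^sup>2) summable_on UNIV"
  then show "(\<lambda>x. (cmod (f (fst x - k, snd x)))\<^sup>2) summable_on UNIV"
    by (rule summable_on_square_reindex[OF _ bij_shift_index[of "- k"]]) simp
qed

lift_definition flip :: "'p seq \<Rightarrow> 'p seq" is "\<lambda>f x. (-1) powi fst x * f (-1 - fst x, snd x)"
  by (erule summable_on_square_reindex[OF _ bij_reflect_index[of "-1"]]) (simp add: norm_mult norm_power_int)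

lift_definition plus_part :: "'p seq \<Rightarrow> 'p seq" is "\<lambda>f x. if 0 \<le> fst x then f x else 0"
  by (erule summable_on_square_reindex[OF _ bij_id]) simp

lift_definition at_index :: "int \<Rightarrow> complex ^ 'p \<Rightarrow> 'p seq" is "\<lambda>k v x. if fst x = k then v $ snd x else 0"
proof -
  fix k :: int and v :: "complex ^ 'p"
  have "finite ({k} \<times> (UNIV :: 'p set))" by simp
  then have "(\<lambda>x. (cmod (if fst x = k then v $ snd x else 0))\<^sup>2) summable_on ({k} \<times> UNIV)"
    by (rule summable_on_finite)
  then show "(\<lambda>x. (cmod (if fst x = k then v $ snd x else 0))\<^sup>2) summable_on UNIV"
    by (rule summable_on_cong_neutral[THEN iffD1, rotated -1]) auto
qed

definition block :: "int \<Rightarrow> 'p seq \<Rightarrow> complex ^ 'p" where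
  "block k f = (\<chi> i. coord f (k, i))"

lemma coord_shift [simp]: "coord (shift k f) x = coord f (fst x - k, snd x)"
  by transfer simp

lemma coord_flip [simp]: "coord (flip f) x = (-1) powi fst x * coord f (-1 - fst x, snd x)"
  by transfer simp

lemma coord_plus_part [simp]: "coord (plus_part f) x = (if 0 \<le> fst x then coord f x else 0)"
  by transfer simp

lemma coord_at_index [simp]: "coord (at_index k v) x = (if fst x = k then v $ snd x else 0)"
  by transfer simp

lemma nrm_shift_le: "nrm (shift k f) \<le> nrm f"
  by (rule nrm_reindex_le[OF bij_shift_index[of "- k"]]) simp

lemma nrm_flip_le: "nrm (flip f) \<le> nrm f"
  by (rule nrm_reindex_le[OF bij_reflect_index[of "-1"]]) (simp add: norm_mult norm_power_int)

lemma nrm_plus_part_le: "nrm (plus_part f) \<le> nrm f"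
  by (rule nrm_reindex_le[OF bij_id]) simp

lemma nrm_at_index_le: "nrm (at_index k v) \<le> norm v"
proof (rule nrm_leI)
  fix F :: "(int \<times> 'a) set" assume F: "finite F"
  have "(\<Sum>x\<in>F. (cmod (coord (at_index k v) x))\<^sup>2) \<le> (\<Sum>x\<in>F \<union> {k} \<times> UNIV. (cmod (coord (at_index k v) x))\<^sup>2)"
    by (rule sum_mono2) (use F in auto)
  also have "\<dots> = (\<Sum>x\<in>{k} \<times> UNIV. (cmod (coord (at_index k v) x))\<^sup>2)"
    by (rule sum.mono_neutral_right) (use F in auto)
  also have "\<dots> = (\<Sum>i\<in>UNIV. (norm (v $ i))\<^sup>2)"
    by (simp add: sum_singleton_Times)
  also have "\<dots> = (norm v)\<^sup>2" by (simp add: norm_vec_def L2_set_def sum_nonneg)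
  finally show "(\<Sum>x\<in>F. (cmod (coord (at_index k v) x))\<^sup>2) \<le> (norm v)\<^sup>2" .
qed simp

lemma plus_part_simps:
  "plus_part (f + g) = plus_part f + plus_part g" "plus_part (f - g) = plus_part f - plus_part g"
  "plus_part (- f) = - plus_part f" "plus_part (cscale c f) = cscale c (plus_part f)"
  "plus_part (plus_part f) = plus_part f"
  by (rule ell2_eqI; simp)+

lemma flip_simps:
  "flip (f + g) = flip f + flip g" "flip (f - g) = flip f - flip g"
  "flip (- f) = - flip f" "flip (cscale c f) = cscale c (flip f)"
  by (rule ell2_eqI; simp add: algebra_simps)+

lemma shift_simps:
  "shift k (f + g) = shift k f + shift k g" "shift k (f - g) = shift k f - shift k g"
  "shift k (- f) = - shift k f" "shift k (cscale c f) = cscale c (shift k f)"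
  by (rule ell2_eqI; simp)+

lemma at_index_simps:
  "at_index k (v + w) = at_index k v + at_index k w" "at_index k (- v) = - at_index k v"
  "at_index k (v - w) = at_index k v - at_index k w"
  "at_index k (c *s v) = cscale c (at_index k v)"
  by (rule ell2_eqI; simp)+

lemma block_simps:
  "block k (f + g) = block k f + block k g" "block k (f - g) = block k f - block k g"
  "block k (- f) = - block k f" "block k (cscale c f) = c *s block k f"
  by (simp_all add: block_def vec_eq_iff)

lemma flip_flip: "flip (flip f) = - f"
  by (rule ell2_eqI) (auto simp: minus_one_powi)

lemma flip_plus_part: "flip (plus_part f) = flip f - plus_part (flip f)"
  by (rule ell2_eqI) auto

lemma flip_shift: "flip (shift k f) = cscale ((-1) powi k) (shift (- k) (flip f))"
  by (rule ell2_eqI) (auto simp: minus_one_powi algebra_simps)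

lemma flip_at_index: "flip (at_index (-1) v) = at_index 0 v"
  by (rule ell2_eqI) auto

lemma ip_reindex:
  assumes "bij g" "\<And>x. coord f' (g x) * cnj (coord h (g x)) = coord f x * cnj (coord h' x)"
  shows "ip f' h = ip f h'"
proof (rule has_sum_unique[OF _ has_sum_ip])
  show "((\<lambda>x. coord f x * cnj (coord h' x)) has_sum ip f' h) UNIV"
    using has_sum_reindex_bij_betw[OF assms(1), of "\<lambda>x. coord f' x * cnj (coord h x)" "ip f' h"]
      has_sum_ip[of f' h] unfolding assms(2) by blast
qed

lemma ip_shift: "ip (shift k f) g = ip f (shift (- k) g)"
  by (rule ip_reindex[OF bij_shift_index[of k]]) simp

lemma ip_flip: "ip (flip f) g = - ip f (flip g)"
proof -
  have "ip (flip f) g = ip f (- flip g)"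
    by (rule ip_reindex[OF bij_reflect_index[of "-1"]])
       (auto simp: minus_one_powi)
  then show ?thesis by (simp add: ip_minus_right)
qed

lemma ip_plus_part: "ip (plus_part f) g = ip f (plus_part g)"
  by (rule ip_reindex[OF bij_id]) simp

lemma ip_at_index: "ip (at_index k v) g = hinner cspace v (block k g)"
proof -
  have "((\<lambda>x. coord (at_index k v) x * cnj (coord g x)) has_sum
      (\<Sum>x\<in>{k} \<times> UNIV. coord (at_index k v) x * cnj (coord g x))) UNIV"
    by (rule has_sum_finite_neutralI) auto
  then have "ip (at_index k v) g = (\<Sum>x\<in>{k} \<times> UNIV. coord (at_index k v) x * cnj (coord g x))"
    by (rule has_sum_unique[OF has_sum_ip])
  also have "\<dots> = (\<Sum>i\<in>UNIV. v $ i * cnj (coord g (k, i)))"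
    by (simp add: sum_singleton_Times)
  finally show ?thesis by (simp add: cspace_def block_def)
qed

lemma lop_shift: "mnear F \<Longrightarrow> lop F (shift k f) = shift k (lop F f)"
proof (rule lop_eqI)
  fix n i assume F: "mnear F"
  show "((\<lambda>y. lcoef (\<lambda>z. F z $ i $ snd y) (n - fst y) * coord (shift k f) y) has_sum
      coord (shift k (lop F f)) (n, i)) UNIV"
    using has_sum_lop[OF F, of i "n - k" f]
      has_sum_reindex_bij_betw[OF bij_shift_index[of k],
        of "\<lambda>y. lcoef (\<lambda>z. F z $ i $ snd y) (n - fst y) * coord (shift k f) y"]
    by (simp add: algebra_simps)
qed

lemma lop_at_index:
  assumes F: "mnear F"
  shows "coord (lop F (at_index k v)) (n, i) = (\<Sum>j\<in>UNIV. lcoef (\<lambda>z. F z $ i $ j) (n - k) * v $ j)"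
proof -
  have "((\<lambda>y. lcoef (\<lambda>z. F z $ i $ snd y) (n - fst y) * coord (at_index k v) y) has_sum
     (\<Sum>y\<in>{k} \<times> UNIV. lcoef (\<lambda>z. F z $ i $ snd y) (n - fst y) * coord (at_index k v) y)) UNIV"
    by (rule has_sum_finite_neutralI) auto
  then have "coord (lop F (at_index k v)) (n, i) =
     (\<Sum>y\<in>{k} \<times> UNIV. lcoef (\<lambda>z. F z $ i $ snd y) (n - fst y) * coord (at_index k v) y)"
    by (rule has_sum_unique[OF has_sum_lop[OF F]])
  then show ?thesis by (simp add: sum_singleton_Times)
qed

definition minus_supported :: "(complex \<Rightarrow> complex ^ 'p ^ 'p) \<Rightarrow> bool" where
  "minus_supported F \<longleftrightarrow> (\<forall>i j n. 0 < n \<longrightarrow> lcoef (\<lambda>z. F z $ i $ j) n = 0)"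

definition plus_supported :: "(complex \<Rightarrow> complex ^ 'p ^ 'p) \<Rightarrow> bool" where
  "plus_supported F \<longleftrightarrow> (\<forall>i j n. n < 0 \<longrightarrow> lcoef (\<lambda>z. F z $ i $ j) n = 0)"

lemma minus_supported_const: "minus_supported (\<lambda>_. A)" and plus_supported_const: "plus_supported (\<lambda>_. A)"
  by (simp_all add: minus_supported_def plus_supported_def lcoef_const)

lemma plus_part_minus_supported:
  assumes F: "mnear F" "minus_supported F"
  shows "plus_part (lop F (plus_part f)) = plus_part (lop F f)"
proof (rule ell2_eqI)
  fix x :: "int \<times> 'a"
  obtain n i where x: "x = (n, i)" by (metis surj_pair)
  have "coord (lop F (plus_part f)) (n, i) = coord (lop F f) (n, i)" if "0 \<le> n"
  proof -
    have e: "lcoef (\<lambda>z. F z $ i $ snd y) (n - fst y) * coord (plus_part f) y =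
        lcoef (\<lambda>z. F z $ i $ snd y) (n - fst y) * coord f y" for y
      using F(2) that by (simp add: minus_supported_def)
    show ?thesis
      using has_sum_lop[OF F(1), of i n "plus_part f"] has_sum_lop[OF F(1), of i n f]
      unfolding e by (rule has_sum_unique)
  qed
  then show "coord (plus_part (lop F (plus_part f))) x = coord (plus_part (lop F f)) x"
    by (simp add: x)
qed

lemma plus_part_plus_supported:
  assumes F: "mnear F" "plus_supported F"
  shows "plus_part (lop F (plus_part f)) = lop F (plus_part f)"
proof (rule ell2_eqI)
  fix x :: "int \<times> 'a"
  obtain n i where x: "x = (n, i)" by (metis surj_pair)
  have "coord (lop F (plus_part f)) (n, i) = 0" if "n < 0"
  proof (rule has_sum_unique[OF has_sum_lop[OF F(1)]], rule has_sum_0)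
    show "lcoef (\<lambda>z. F z $ i $ snd y) (n - fst y) * coord (plus_part f) y = 0" for y
      using F(2) that by (simp add: plus_supported_def)
  qed
  then show "coord (plus_part (lop F (plus_part f))) x = coord (lop F (plus_part f)) x"
    by (simp add: x)
qed

lemma plus_part_const: "plus_part (lop (\<lambda>_. A) f) = lop (\<lambda>_. A) (plus_part f)"
  using plus_part_minus_supported[OF mnear_const minus_supported_const] plus_part_plus_supported[OF mnear_const plus_supported_const] by metis

lemma ip_lop:
  assumes F: "mnear F"
  shows "ip (lop F f) g = - ip f (flip (lop (\<lambda>z. cadjoint (F (- cnj z))) (flip g)))"
proof -
  let ?F = "\<lambda>z. cadjoint (F (- cnj z))" and ?k = "\<lambda>x y. lcoef (\<lambda>z. F z $ snd x $ snd y) (fst x - fst y)"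
  obtain M where M: "schur ?k M" by (rule schur_lop[OF F])
  have "kop (\<lambda>x y. cnj (?k y x)) g = - flip (lop ?F (flip g))"
  proof (rule ell2_eqI)
    fix x :: "int \<times> 'a"
    obtain n i where x: "x = (n, i)" by (metis surj_pair)
    let ?h = "\<lambda>y. lcoef (\<lambda>z. ?F z $ i $ snd y) (-1 - n - fst y) * coord (flip g) y"
    have "((\<lambda>y. ?h (-1 - fst y, snd y)) has_sum coord (lop ?F (flip g)) (-1 - n, i)) UNIV"
      using has_sum_lop[OF mnear_reflect[OF F], of i "-1 - n" "flip g"]
        has_sum_reindex_bij_betw[OF bij_reflect_index[of "-1"], of ?h] by simp
    from has_sum_cmult_right[OF this, of "- ((-1) powi n)"]
    have "((\<lambda>y. - ((-1) powi n) * ?h (-1 - fst y, snd y)) has_sum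
        coord (- flip (lop ?F (flip g))) x) UNIV"
      by (simp add: x)
    moreover have "- ((-1) powi n) * ?h (-1 - fst y, snd y) = cnj (?k y x) * coord g y" for y
    proof -
      have s: "- ((-1) powi n) * ((-1) powi (fst y - n) * (-1) powi (-1 - fst y)) = (1::complex)"
        by (simp add: minus_one_powi)
      have "lcoef (\<lambda>z. ?F z $ i $ snd y) (fst y - n) = (-1) powi (fst y - n) * cnj (?k y x)"
        using lcoef_reflect[OF mnearD[OF F], of "snd y" i "fst y - n"] by (simp add: cadjoint_def x)
      then have "- ((-1) powi n) * ?h (-1 - fst y, snd y) =
          (- ((-1) powi n) * ((-1) powi (fst y - n) * (-1) powi (-1 - fst y))) * (cnj (?k y x) * coord g y)"
        by (simp add: algebra_simps)
      then show ?thesis unfolding s by simp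
    qed
    ultimately have "((\<lambda>y. cnj (?k y x) * coord g y) has_sum coord (- flip (lop ?F (flip g))) x) UNIV"
      by simp
    then show "coord (kop (\<lambda>x y. cnj (?k y x)) g) x = coord (- flip (lop ?F (flip g))) x"
      by (rule has_sum_unique[OF has_sum_kop[OF schur_adjoint[OF M]]])
  qed
  then show ?thesis
    using kop_adjoint[OF M, of f g] by (simp add: lop_def ip_minus_right)
qed

lemma plus_part_shift:
  "plus_part (shift 1 f) - shift 1 (plus_part f) = at_index 0 (block (-1) f)"
  by (rule ell2_eqI) (auto simp: block_def)

section \<open>Inverting a Laurent operator\<close>

lemma near_circle_det:
  assumes "\<And>i j. near_circle (\<lambda>z. F z i j)"
  shows "near_circle (\<lambda>z. det (\<chi> i j. F z i j :: complex ^ 'p ^ 'p))"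
  unfolding det_def using assms
  by (auto intro!: near_circle_sum near_circle_mult near_circle_prod near_circle_const)

lemma
  fixes A :: "'a::semiring_1 ^ 'm ^ 'n"
  assumes "invertible A"
  shows matrix_inv_right: "A ** matrix_inv A = mat 1"
    and matrix_inv_left: "matrix_inv A ** A = mat 1"
  using someI_ex[OF assms[unfolded invertible_def]] by (simp_all add: matrix_inv_def)

lemma matrix_inv_entry:
  fixes A :: "complex ^ 'p ^ 'p"
  assumes "invertible A"
  shows "matrix_inv A $ i $ j = det (\<chi> k l. if l = i then (if k = j then 1 else 0) else A $ k $ l) / det A"
proof -
  have "det A \<noteq> 0" using assms by (simp add: invertible_det_nz)
  moreover have "A *v (matrix_inv A *v axis j 1) = axis j 1"
    using matrix_inv_right[OF assms] by (simp add: matrix_vector_mul_assoc)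
  ultimately have "matrix_inv A *v axis j 1 =
      (\<chi> i. det (\<chi> k l. if l = i then axis j 1 $ k else A $ k $ l) / det A)"
    by (simp add: cramer)
  then have entry: "(matrix_inv A *v axis j 1) $ i = det (\<chi> k l. if l = i then axis j 1 $ k else A $ k $ l) / det A"
    by simp
  have col: "(matrix_inv A *v axis j 1) $ i = matrix_inv A $ i $ j"
    by (simp add: matrix_vector_mult_def axis_def if_distrib cong: if_cong)
  have ax: "(axis j 1 :: complex ^ 'p) $ k = (if k = j then 1 else 0)" for k
    by (simp add: axis_def)
  show ?thesis using entry unfolding col ax .
qed

lemma mnear_inverse:
  fixes F :: "complex \<Rightarrow> complex ^ 'p ^ 'p"
  assumes F: "mnear F" and inv: "\<And>z. cmod z = 1 \<Longrightarrow> invertible (F z)"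
  obtains G where "mnear G" "\<And>z. cmod z = 1 \<Longrightarrow> G z = matrix_inv (F z)"
proof
  let ?G = "\<lambda>z. \<chi> i j. det (\<chi> k l. if l = i then (if k = j then 1 else 0) else F z $ k $ l :: complex ^ 'p ^ 'p) / det (F z)"
  have d: "near_circle (\<lambda>z. det (F z))"
    using near_circle_det[of "\<lambda>z i j. F z $ i $ j"] mnearD[OF F] by simp
  have "near_circle (\<lambda>z. det (\<chi> k l. if l = i then (if k = j then 1 else 0) else F z $ k $ l :: complex ^ 'p ^ 'p) / det (F z))" for i j
  proof (rule near_circle_divide[OF near_circle_det d])
    show "near_circle (\<lambda>z. if l = i then if k = j then 1 else 0 else F z $ k $ l)" for k l
      by (cases "l = i") (auto intro: near_circle_const mnearD[OF F])
    show "det (F z) \<noteq> 0" if "cmod z = 1" for z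
      using inv[OF that] by (simp add: invertible_det_nz)
  qed
  then show "mnear ?G" by (simp add: mnear_def)
  show "?G z = matrix_inv (F z)" if "cmod z = 1" for z
    by (simp add: vec_eq_iff matrix_inv_entry[OF inv[OF that]])
qed

section \<open>Separating the symbol from an exponential\<close>

lemma tendsto_det:
  fixes A :: "'a \<Rightarrow> complex ^ 'p ^ 'p"
  assumes "\<And>i j. ((\<lambda>n. A n $ i $ j) \<longlongrightarrow> L $ i $ j) F"
  shows "((\<lambda>n. det (A n)) \<longlongrightarrow> det L) F"
  unfolding det_def by (intro tendsto_intros assms)

lemma det_diff_mat_bound:
  fixes A :: "complex ^ 'p ^ 'p"
  assumes B: "\<And>i j. cmod (A $ i $ j) \<le> B" and u: "det (A - mat u) = 0"
  shows "cmod u \<le> B * real CARD('p)"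
proof -
  have "\<not> invertible (A - mat u)" using u by (simp add: invertible_det_nz)
  then obtain v where "v \<noteq> 0" and v: "(A - mat u) *v v = 0"
    using invertible_left_inverse matrix_left_invertible_ker by metis
  let ?m = "Max (range (\<lambda>i. cmod (v $ i)))"
  have m: "cmod (v $ i) \<le> ?m" for i by simp
  have "?m \<in> range (\<lambda>i. cmod (v $ i))" by (rule Max_in) auto
  then obtain i where i: "?m = cmod (v $ i)" by blast
  have "v $ i \<noteq> 0"
  proof
    assume "v $ i = 0"
    then have "cmod (v $ j) \<le> 0" for j using m[of j] i by simp
    then show False using \<open>v \<noteq> 0\<close> by (simp add: vec_eq_iff)
  qed
  have "(mat u *v v) $ i = (\<Sum>j\<in>UNIV. if i = j then u * v $ j else 0)"
    unfolding matrix_vector_mult_def vec_lambda_beta by (rule sum.cong) (auto simp: mat_def)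
  then have "((A - mat u) *v v) $ i = (A *v v) $ i - u * v $ i"
    by (simp add: matrix_vector_mult_diff_rdistrib)
  then have "cmod u * cmod (v $ i) = cmod ((A *v v) $ i)"
    using v by (simp add: norm_mult)
  also have "\<dots> \<le> (\<Sum>j\<in>UNIV. cmod (A $ i $ j * v $ j))"
    by (simp add: matrix_vector_mult_def norm_sum)
  also have "\<dots> \<le> (\<Sum>j\<in>(UNIV :: 'p set). B * cmod (v $ i))"
  proof (rule sum_mono)
    fix j
    have "0 \<le> B" using B[of i j] norm_ge_zero order_trans by blast
    then show "norm (A $ i $ j * v $ j) \<le> B * cmod (v $ i)"
      using B m[of j] i by (simp add: norm_mult mult_mono)
  qed
  finally have "cmod u * cmod (v $ i) \<le> B * real CARD('p) * cmod (v $ i)"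
    by (simp add: mult_ac)
  then show ?thesis using \<open>v $ i \<noteq> 0\<close> by simp
qed

lemma countable_spectrum:
  fixes A :: "complex ^ 'p ^ 'p"
  assumes "invertible A"
  shows "countable {u. det (A - mat u) = 0}"
proof (cases "(\<lambda>u. det (A - mat u)) constant_on UNIV")
  case True
  then obtain c where "\<And>u. det (A - mat u) = c" by (auto simp: constant_on_def)
  then have "det (A - mat u) = det (A - mat 0)" for u by metis
  moreover have "det (A - mat 0) \<noteq> 0"
    using assms by (simp add: invertible_det_nz mat_0)
  ultimately have "{u. det (A - mat u) = 0} = {}" by simp
  then show ?thesis by simp
next
  case False
  have "(\<lambda>u. det (A - mat u)) holomorphic_on UNIV"
    unfolding det_def
  proof (intro holomorphic_intros)
    show "(\<lambda>u. (A - mat u) $ i $ p i) holomorphic_on UNIV" for p i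
      by (cases "i = p i") (auto simp: mat_def intro!: holomorphic_intros)
  qed
  from holomorphic_countable_zeros[OF this _ _ _ False]
  show ?thesis by (simp add: connected_UNIV)
qed

text \<open>
  On the unit circle \<open>exp (k * z)\<close> has modulus of order one only where \<open>Re z\<close> is of order \<open>1/k\<close>,
  that is near \<open>\<plusminus>\<i>\<close>, and there its phase is nearly constant. So for large \<open>k\<close> it suffices to
  avoid the rays through the eigenvalues of \<open>T (\<plusminus>\<i>)\<close>.
\<close>

lemma exists_separating_exponential:
  fixes T :: "complex \<Rightarrow> complex ^ 'p ^ 'p"
  assumes cont: "\<And>i j. continuous_on (sphere 0 1) (\<lambda>z. T z $ i $ j)"
    and inv: "\<And>z. cmod z = 1 \<Longrightarrow> invertible (T z)"
  obtains \<omega> :: complex and k :: real where "cmod \<omega> = 1"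
    "\<And>z. cmod z = 1 \<Longrightarrow> invertible (T z - mat (\<omega> * exp (of_real k * z)))"
proof -
  let ?E = "{u. det (T \<i> - mat u) = 0} \<union> {u. det (T (- \<i>) - mat u) = 0}"
  have "countable (sgn ` ?E)"
    using countable_spectrum[OF inv, of \<i>] countable_spectrum[OF inv, of "- \<i>"] by simp
  moreover have "uncountable (sphere (0::complex) 1)"
    by (rule connected_uncountable[of _ 1 "-1"]) (auto intro!: connected_sphere)
  ultimately obtain \<omega> where \<omega>: "\<omega> \<in> sphere (0::complex) 1" "\<omega> \<notin> sgn ` ?E"
    by (metis countable_subset subsetI)
  have ray: "det (T z - mat (of_real s * \<omega>)) \<noteq> 0" if "z = \<i> \<or> z = - \<i>" "0 < s" for z s
  proof
    assume "det (T z - mat (of_real s * \<omega>)) = 0"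
    then have "of_real s * \<omega> \<in> ?E" using that(1) by auto
    moreover have "sgn (of_real s * \<omega>) = \<omega>"
      using \<omega>(1) that(2) by (simp add: sgn_mult sgn_of_real) (simp add: sgn_eq)
    ultimately show False using \<omega>(2) by (metis imageI)
  qed
  have "bounded ((\<lambda>z. T z $ i $ j) ` sphere 0 1)" for i j
    by (intro compact_imp_bounded compact_continuous_image cont) auto
  then have "\<exists>B. \<forall>z. cmod z = 1 \<longrightarrow> cmod (T z $ i $ j) \<le> B" for i j
    unfolding bounded_iff by fastforce
  then obtain B where B: "\<And>i j z. cmod z = 1 \<Longrightarrow> cmod (T z $ i $ j) \<le> B i j" by metis
  let ?B = "\<Sum>i\<in>UNIV. \<Sum>j\<in>UNIV. \<bar>B i j\<bar>"
  have B': "cmod (T z $ i $ j) \<le> ?B" if "cmod z = 1" for z i j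
  proof -
    have "cmod (T z $ i $ j) \<le> \<bar>B i j\<bar>" using B[OF that, of i j] by simp
    also have "\<dots> \<le> (\<Sum>j\<in>UNIV. \<bar>B i j\<bar>)" by (rule member_le_sum) auto
    also have "\<dots> \<le> ?B" by (rule member_le_sum[of i _ "\<lambda>i. \<Sum>j\<in>UNIV. \<bar>B i j\<bar>"]) (auto intro!: sum_nonneg)
    finally show ?thesis .
  qed
  define K :: "nat \<Rightarrow> real" where "K n = 2 * pi * real (Suc n)" for n
  define h :: "nat \<Rightarrow> complex \<Rightarrow> complex" where "h n z = \<omega> * exp (of_real (K n) * z)" for n z
  have "\<exists>n. \<forall>z. cmod z = 1 \<longrightarrow> det (T z - mat (h n z)) \<noteq> 0"
  proof (rule ccontr)
    assume "\<not> ?thesis"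
    then obtain z where z: "\<And>n. cmod (z n) = 1" "\<And>n. det (T (z n) - mat (h n (z n))) = 0" by metis
    have "compact (sphere (0::complex) 1 \<times> cball (0::complex) (?B * real CARD('p)))"
      by (intro compact_Times) auto
    moreover have "(z n, h n (z n)) \<in> sphere 0 1 \<times> cball 0 (?B * real CARD('p))" for n
      using det_diff_mat_bound[OF B'[OF z(1)] z(2)] z(1) by simp
    ultimately obtain l r where r: "strict_mono r"
      and l: "((\<lambda>n. (z n, h n (z n))) \<circ> r) \<longlonglongrightarrow> l" "l \<in> sphere 0 1 \<times> cball 0 (?B * real CARD('p))"
      unfolding compact_def by meson
    obtain w u where wu: "l = (w, u)" by (cases l)
    have w: "(\<lambda>n. z (r n)) \<longlonglongrightarrow> w" and u: "(\<lambda>n. h (r n) (z (r n))) \<longlonglongrightarrow> u" and w1: "cmod w = 1"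
      using l tendsto_fst[OF l(1)] tendsto_snd[OF l(1)] by (auto simp: wu o_def)
    have "(\<lambda>n. det (T (z (r n)) - mat (h (r n) (z (r n))))) \<longlonglongrightarrow> det (T w - mat u)"
    proof (rule tendsto_det)
      fix i j
      have "(\<lambda>n. T (z (r n)) $ i $ j) \<longlonglongrightarrow> T w $ i $ j"
        by (rule continuous_on_tendsto_compose[OF cont w]) (use w1 z(1) in auto)
      then show "(\<lambda>n. (T (z (r n)) - mat (h (r n) (z (r n)))) $ i $ j) \<longlonglongrightarrow> (T w - mat u) $ i $ j"
        using u by (cases "i = j") (auto simp: mat_def intro!: tendsto_intros)
    qed
    then have "(\<lambda>n. 0) \<longlonglongrightarrow> det (T w - mat u)" by (simp only: z(2))
    then have det: "det (T w - mat u) = 0" using LIMSEQ_unique tendsto_const by blast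
    have "u \<noteq> 0"
      using det inv[OF w1] by (auto simp: invertible_det_nz mat_0)
    define x where "x n = Re (z (r n))" for n
    define y where "y n = Im (z (r n))" for n
    let ?K = "\<lambda>n. K (r n)"
    have x: "x \<longlonglongrightarrow> Re w" and y: "y \<longlonglongrightarrow> Im w"
      unfolding x_def y_def by (intro tendsto_intros w)+
    have circ: "(x n)\<^sup>2 + (y n)\<^sup>2 = 1" for n
      using z(1)[of "r n"] by (simp add: x_def y_def cmod_def)
    have hr: "h (r n) (z (r n)) = \<omega> * (of_real (exp (?K n * x n)) * exp (\<i> * of_real (?K n * y n)))" for n
    proof -
      have "of_real (?K n) * z (r n) = of_real (?K n * x n) + \<i> * of_real (?K n * y n)"
        by (simp add: complex_eq_iff x_def y_def)
      then show ?thesis by (simp only: h_def exp_add exp_of_real)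
    qed
    have "cmod (h (r n) (z (r n))) = exp (?K n * x n)" for n
      using \<omega>(1) by (simp add: hr norm_mult)
    then have mod: "(\<lambda>n. exp (?K n * x n)) \<longlonglongrightarrow> cmod u"
      using tendsto_norm[OF u] by simp
    from tendsto_ln[OF this] have Kx: "(\<lambda>n. ?K n * x n) \<longlonglongrightarrow> ln (cmod u)"
      using \<open>u \<noteq> 0\<close> by simp
    have "filterlim K at_top sequentially"
      unfolding K_def
      by (rule filterlim_tendsto_pos_mult_at_top[OF tendsto_const _
            filterlim_compose[OF filterlim_real_sequentially filterlim_Suc]]) simp
    then have Kinf: "filterlim ?K at_top sequentially"
      by (rule filterlim_compose) (rule filterlim_subseq[OF r])
    have "(\<lambda>n. (?K n * x n) / ?K n) \<longlonglongrightarrow> 0"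
      by (rule real_tendsto_divide_at_top[OF Kx Kinf])
    moreover have "(?K n * x n) / ?K n = x n" for n
    proof -
      have "?K n \<noteq> 0" by (simp add: K_def del: of_nat_Suc)
      then show ?thesis by simp
    qed
    ultimately have x0: "x \<longlonglongrightarrow> 0" by simp
    then have "Re w = 0" using x LIMSEQ_unique by blast
    then have "(Im w)\<^sup>2 = 1" using w1 cmod_power2[of w] by simp
    then have s: "Im w = 1 \<or> Im w = -1" by (simp add: power2_eq_1_iff)
    have w': "w = \<i> \<or> w = - \<i>" using s \<open>Re w = 0\<close> by (auto simp: complex_eq_iff)
    have "(\<lambda>n. - ((?K n * x n) * x n) / (y n + Im w)) \<longlonglongrightarrow> - (ln (cmod u) * 0) / (Im w + Im w)"
      by (intro tendsto_intros Kx x0 y) (use s in auto)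
    moreover have "\<forall>\<^sub>F n in sequentially. - ((?K n * x n) * x n) / (y n + Im w) = ?K n * (y n - Im w)"
    proof -
      have "(\<lambda>n. y n + Im w) \<longlonglongrightarrow> Im w + Im w" by (intro tendsto_intros y)
      then have "\<forall>\<^sub>F n in sequentially. y n + Im w \<noteq> 0"
        by (rule tendsto_imp_eventually_ne) (use s in auto)
      then show ?thesis
      proof eventually_elim
        case (elim n)
        have "(y n - Im w) * (y n + Im w) = - (x n * x n)"
          using circ[of n] \<open>(Im w)\<^sup>2 = 1\<close> by (simp add: power2_eq_square algebra_simps)
        then have "?K n * (y n - Im w) * (y n + Im w) = - ((?K n * x n) * x n)"
          by (simp add: mult.assoc)
        then show ?case using elim by (metis nonzero_mult_div_cancel_right)
      qed
    qed
    ultimately have Ky: "(\<lambda>n. ?K n * (y n - Im w)) \<longlonglongrightarrow> 0"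
      by (simp add: tendsto_cong)
    have phase: "exp (\<i> * of_real (?K n * y n)) = exp (\<i> * of_real (?K n * (y n - Im w)))" for n
    proof -
      have "exp (\<i> * of_real (?K n * Im w)) = 1"
      proof -
        define m :: int where "m = (if Im w = 1 then 1 else -1) * int (Suc (r n))"
        have "\<i> * of_real (?K n * Im w) = of_real (of_int (2 * m) * pi) * \<i>"
          using s by (auto simp: K_def m_def algebra_simps)
        then show ?thesis unfolding exp_eq_1 by (auto intro!: exI[of _ m])
      qed
      moreover have "\<i> * of_real (?K n * y n) = \<i> * of_real (?K n * (y n - Im w)) + \<i> * of_real (?K n * Im w)"
        by (simp add: algebra_simps)
      ultimately show ?thesis by (simp only: exp_add mult_1_right)
    qed
    have "(\<lambda>n. h (r n) (z (r n))) \<longlonglongrightarrow> \<omega> * (of_real (cmod u) * exp (\<i> * of_real 0))"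
      unfolding hr phase by (intro tendsto_intros mod Ky)
    then have "(\<lambda>n. h (r n) (z (r n))) \<longlonglongrightarrow> of_real (cmod u) * \<omega>"
      by (simp add: mult.commute)
    then have "u = of_real (cmod u) * \<omega>" using u LIMSEQ_unique by blast
    then show False using det ray[OF w', of "cmod u"] \<open>u \<noteq> 0\<close> by simp
  qed
  then obtain n where "\<And>z. cmod z = 1 \<Longrightarrow> det (T z - mat (h n z)) \<noteq> 0" by blast
  then show thesis
    using \<omega>(1) by (intro that[of \<omega> "K n"]) (auto simp: invertible_det_nz h_def)
qed

section \<open>One-sided symbols\<close>

lemma has_sum_int_nonneg:
  fixes b :: "nat \<Rightarrow> 'a :: banach"
  assumes "summable (\<lambda>k. norm (b k))" "b sums s"
  shows "((\<lambda>k::int. if 0 \<le> k then b (nat k) else 0) has_sum s) UNIV"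
proof -
  have "((\<lambda>k::int. if 0 \<le> k then b (nat k) else 0) has_sum s) (range int)"
    by (subst has_sum_reindex) (use norm_summable_imp_has_sum[OF assms] in \<open>auto simp: o_def\<close>)
  moreover have "range int = {n. 0 \<le> n}"
    by (auto simp: image_iff) presburger
  ultimately show ?thesis
    by (auto elim!: has_sum_cong_neutral[THEN iffD1, rotated -1])
qed

lemma lcoef_power_series:
  assumes a: "summable (\<lambda>k. cmod (a k))"
    and f: "\<And>z. cmod z = 1 \<Longrightarrow> (\<lambda>k. a k * z ^ k) sums f z"
  shows "lcoef f n = (if 0 \<le> n then a (nat n) else 0)"
proof (rule lcoef_unique)
  have "(\<lambda>k. if 0 \<le> k then cmod (a (nat k)) else 0) summable_on (UNIV :: int set)"
    using has_sum_int_nonneg[of "\<lambda>k. cmod (a k)"] a by (auto simp: summable_on_def summable_def)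
  then show "(\<lambda>k::int. cmod (if 0 \<le> k then a (nat k) else 0)) summable_on UNIV"
    by (simp add: if_distrib cong: if_cong)
  fix z :: complex assume z: "cmod z = 1"
  have "((\<lambda>k::int. if 0 \<le> k then a (nat k) * z ^ nat k else 0) has_sum f z) UNIV"
    by (rule has_sum_int_nonneg[OF _ f[OF z]]) (use a z in \<open>simp add: norm_mult norm_power\<close>)
  moreover have "(\<lambda>k::int. if 0 \<le> k then a (nat k) * z ^ nat k else 0) =
      (\<lambda>k. (if 0 \<le> k then a (nat k) else 0) * z powi k)"
    by (auto simp: power_int_def)
  ultimately show "((\<lambda>k. (if 0 \<le> k then a (nat k) else 0) * z powi k) has_sum f z) UNIV"
    by simp
qed

lemma lcoef_power_series_inverse:
  assumes a: "summable (\<lambda>k. cmod (a k))"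
    and f: "\<And>z. cmod z = 1 \<Longrightarrow> (\<lambda>k. a k * inverse z ^ k) sums f z"
  shows "lcoef f n = (if n \<le> 0 then a (nat (- n)) else 0)"
proof (rule lcoef_unique)
  have bij: "bij (uminus :: int \<Rightarrow> int)" by (simp add: bij_uminus)
  have "(\<lambda>k. if 0 \<le> k then cmod (a (nat k)) else 0) summable_on (UNIV :: int set)"
    using has_sum_int_nonneg[of "\<lambda>k. cmod (a k)"] a by (auto simp: summable_on_def summable_def)
  then have "(\<lambda>k. if 0 \<le> - k then cmod (a (nat (- k))) else 0) summable_on (UNIV :: int set)"
    using summable_on_reindex_bij_betw[OF bij, of "\<lambda>k. if 0 \<le> k then cmod (a (nat k)) else 0"] by simp
  then show "(\<lambda>k::int. cmod (if k \<le> 0 then a (nat (- k)) else 0)) summable_on UNIV"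
    by (simp add: if_distrib cong: if_cong)
  fix z :: complex assume z: "cmod z = 1"
  have "((\<lambda>k::int. if 0 \<le> k then a (nat k) * inverse z ^ nat k else 0) has_sum f z) UNIV"
    by (rule has_sum_int_nonneg[OF _ f[OF z]]) (use a z in \<open>simp add: norm_mult norm_power norm_inverse\<close>)
  then have "((\<lambda>k::int. if 0 \<le> - k then a (nat (- k)) * inverse z ^ nat (- k) else 0) has_sum f z) UNIV"
    using has_sum_reindex_bij_betw[OF bij, of "\<lambda>k. if 0 \<le> k then a (nat k) * inverse z ^ nat k else 0"] by simp
  moreover have "(\<lambda>k::int. if 0 \<le> - k then a (nat (- k)) * inverse z ^ nat (- k) else 0) =
      (\<lambda>k. (if k \<le> 0 then a (nat (- k)) else 0) * z powi k)"
    by (auto simp: power_int_def)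
  ultimately show "((\<lambda>k. (if k \<le> 0 then a (nat (- k)) else 0) * z powi k) has_sum f z) UNIV"
    by simp
qed

lemma lcoef_cadjoint_reflect:
  "mnear F \<Longrightarrow> lcoef (\<lambda>z. cadjoint (F (- cnj z)) $ i $ j) n = (-1) powi n * cnj (lcoef (\<lambda>z. F z $ j $ i) n)"
  using lcoef_reflect[OF mnearD, of F j i n] by (simp add: cadjoint_def)

lemma minus_supported_reflect:
  "mnear F \<Longrightarrow> minus_supported F \<Longrightarrow> minus_supported (\<lambda>z. cadjoint (F (- cnj z)))"
  by (simp add: minus_supported_def lcoef_cadjoint_reflect)

lemma plus_supported_reflect:
  "mnear F \<Longrightarrow> plus_supported F \<Longrightarrow> plus_supported (\<lambda>z. cadjoint (F (- cnj z)))"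
  by (simp add: plus_supported_def lcoef_cadjoint_reflect)

lemma lcoef_sandwich:
  assumes "mnear F"
  shows "lcoef (\<lambda>z. (A ** F z ** B) $ i $ j) n =
    (\<Sum>l\<in>UNIV. \<Sum>k\<in>UNIV. A $ i $ k * B $ l $ j * lcoef (\<lambda>z. F z $ k $ l) n)"
proof -
  have "(A ** F z ** B) $ i $ j = (\<Sum>l\<in>UNIV. \<Sum>k\<in>UNIV. A $ i $ k * B $ l $ j * F z $ k $ l)" for z
    by (simp add: matrix_matrix_mult_def sum_distrib_left sum_distrib_right mult_ac)
  then show ?thesis
    by (simp add: lcoef_sum near_circle_sum near_circle_mult near_circle_const mnearD[OF assms] lcoef_cmult)
qed

lemma minus_supported_sandwich:
  "mnear F \<Longrightarrow> minus_supported F \<Longrightarrow> minus_supported (\<lambda>z. A ** F z ** B)"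
  unfolding minus_supported_def[of "\<lambda>z. A ** F z ** B"] lcoef_sandwich
  by (simp add: minus_supported_def)

lemma plus_supported_sandwich:
  "mnear F \<Longrightarrow> plus_supported F \<Longrightarrow> plus_supported (\<lambda>z. A ** F z ** B)"
  unfolding plus_supported_def[of "\<lambda>z. A ** F z ** B"] lcoef_sandwich
  by (simp add: plus_supported_def)

section \<open>Scalar matrices and adjoints\<close>

lemma cadjoint_mult: "cadjoint (A ** B) = cadjoint B ** cadjoint A"
  by (simp add: cadjoint_def matrix_matrix_mult_def vec_eq_iff mult.commute)

lemma cadjoint_diff: "cadjoint (A - B) = cadjoint A - cadjoint B"
  by (simp add: cadjoint_def vec_eq_iff)

lemma cadjoint_mat: "cadjoint (mat c) = mat (cnj c)"
  by (auto simp: cadjoint_def vec_eq_iff mat_def)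

lemma mat_matrix_mult: "(mat c ** A) $ i $ j = c * (A :: 'a::comm_semiring_1 ^ 'm ^ 'n) $ i $ j"
proof -
  have "(mat c ** A) $ i $ j = (\<Sum>k\<in>UNIV. if i = k then c * A $ k $ j else 0)"
    unfolding matrix_matrix_mult_def vec_lambda_beta by (rule sum.cong) (auto simp: mat_def)
  then show ?thesis by simp
qed

lemma matrix_mult_mat: "(A ** mat c) $ i $ j = c * (A :: 'a::comm_semiring_1 ^ 'm ^ 'n) $ i $ j"
proof -
  have "(A ** mat c) $ i $ j = (\<Sum>k\<in>UNIV. if k = j then c * A $ i $ k else 0)"
    unfolding matrix_matrix_mult_def vec_lambda_beta by (rule sum.cong) (auto simp: mat_def mult.commute)
  then show ?thesis by simp
qed

lemma matrix_diff_rdistrib: "(A - B) ** C = A ** C - B ** (C :: 'a::ring_1 ^ 'm ^ 'n)"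
  by (simp add: matrix_matrix_mult_def vec_eq_iff left_diff_distrib sum_subtractf)

lemma matrix_vector_mult_minus: "A *v (- v) = - (A *v (v :: 'a::ring_1 ^ 'n))"
  by (simp add: matrix_vector_mult_def vec_eq_iff sum_negf)

lemma mat_commute: "mat c ** A = A ** mat (c :: 'a::comm_semiring_1)"
  by (simp add: vec_eq_iff mat_matrix_mult matrix_mult_mat)

lemma mat_mult_mat: "mat c ** mat d = (mat (c * d) :: 'a::comm_semiring_1 ^ 'n ^ 'n)"
  by (simp add: vec_eq_iff mat_matrix_mult) (simp add: mat_def)

lemma mat_mult_vec: "mat c *v v = c *s (v :: 'a::comm_semiring_1 ^ 'n)"
proof -
  have "(mat c *v v) $ i = (\<Sum>j\<in>UNIV. if i = j then c * v $ j else 0)" for i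
    unfolding matrix_vector_mult_def vec_lambda_beta by (rule sum.cong) (auto simp: mat_def)
  then show ?thesis by (simp add: vec_eq_iff)
qed

lemma mnear_mat: "near_circle f \<Longrightarrow> mnear (\<lambda>z. mat (f z))"
  unfolding mnear_def
proof (intro allI)
  fix i j :: 'a
  assume "near_circle f"
  then show "near_circle (\<lambda>z. (mat (f z) :: complex ^ 'a ^ 'a) $ i $ j)"
    by (cases "i = j") (simp_all add: mat_def near_circle_const)
qed

lemma lop_const_at_index: "lop (\<lambda>_. A) (at_index k v) = at_index k (A *v v)"
proof (rule ell2_eqI)
  fix x :: "int \<times> 'a"
  obtain n i where x: "x = (n, i)" by (metis surj_pair)
  show "coord (lop (\<lambda>_. A) (at_index k v)) x = coord (at_index k (A *v v)) x"
    by (simp add: x lop_at_index mnear_const lcoef_const matrix_vector_mult_def)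
qed

lemma block_lop_const: "block k (lop (\<lambda>_. A) f) = A *v block k f"
proof -
  have "coord (lop (\<lambda>_. A) f) (k, i) = (\<Sum>j\<in>UNIV. A $ i $ j * coord f (k, j))" for i
  proof (rule has_sum_unique[OF has_sum_lop[OF mnear_const]])
    have "((\<lambda>y. lcoef (\<lambda>z. A $ i $ snd y) (k - fst y) * coord f y) has_sum
        (\<Sum>y\<in>{k} \<times> UNIV. lcoef (\<lambda>z. A $ i $ snd y) (k - fst y) * coord f y)) UNIV"
      by (rule has_sum_finite_neutralI) (auto simp: lcoef_const)
    then show "((\<lambda>y. lcoef (\<lambda>z. A $ i $ snd y) (k - fst y) * coord f y) has_sum
        (\<Sum>j\<in>UNIV. A $ i $ j * coord f (k, j))) UNIV"
      by (simp add: sum_singleton_Times lcoef_const)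
  qed
  then show ?thesis by (simp add: block_def matrix_vector_mult_def vec_eq_iff)
qed

lemma block_flip: "block 0 (flip f) = block (-1) f"
  by (simp add: block_def vec_eq_iff)

lemma shift_eq_lop: "shift 1 f = lop (\<lambda>z. mat z) f"
proof (rule lop_eqI[symmetric])
  show "mnear (\<lambda>z. mat z :: complex ^ 'a ^ 'a)" by (intro mnear_mat near_circle_ident)
  fix n :: int and i :: 'a
  have id: "lcoef (\<lambda>z. z) m = (if m = 1 then 1 else 0)" for m
    using lcoef_shift[of 1 "\<lambda>_. 1" m] by (simp add: lcoef_const)
  have "lcoef (\<lambda>z. (mat z :: complex ^ 'a ^ 'a) $ i $ snd y) (n - fst y) * coord f y =
      (if y = (n - 1, i) then coord f (n - 1, i) else 0)" for y
    by (cases y; cases "i = snd y") (auto simp: mat_def id lcoef_const)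
  then show "((\<lambda>y. lcoef (\<lambda>z. (mat z :: complex ^ 'a ^ 'a) $ i $ snd y) (n - fst y) * coord f y) has_sum
      coord (shift 1 f) (n, i)) UNIV"
    by (simp only:) (rule has_sum_finite_neutralI[of "{(n - 1, i)}"]; auto)
qed

lemma cscale_eq_lop: "cscale c f = lop (\<lambda>_. mat c) f"
proof (rule lop_eqI[symmetric, OF mnear_const])
  fix n :: int and i :: 'a
  have "lcoef (\<lambda>z. (mat c :: complex ^ 'a ^ 'a) $ i $ snd y) (n - fst y) * coord f y =
      (if y = (n, i) then c * coord f (n, i) else 0)" for y
    by (auto simp: mat_def lcoef_const prod_eq_iff)
  then show "((\<lambda>y. lcoef (\<lambda>z. (mat c :: complex ^ 'a ^ 'a) $ i $ snd y) (n - fst y) * coord f y) has_sum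
      coord (cscale c f) (n, i)) UNIV"
    by (simp only:) (rule has_sum_finite_neutralI[of "{(n, i)}"]; auto)
qed

section \<open>The realization on sequences\<close>

locale jump =
  fixes T h W' :: "complex \<Rightarrow> complex ^ 'p ^ 'p" and \<tau> \<tau>' :: "complex ^ 'p ^ 'p"
  assumes T: "mnear T" "minus_supported T" "\<And>i j. lcoef (\<lambda>z. T z $ i $ j) 0 = mat 1 $ i $ j"
    and h: "mnear h" "plus_supported h"
    and \<tau>: "cadjoint \<tau> = \<tau>" "\<tau> ** \<tau>' = mat 1" "\<tau>' ** \<tau> = mat 1"
    and T_sym: "\<And>z. cmod z = 1 \<Longrightarrow> T z ** \<tau> ** cadjoint (T (- cnj z)) = \<tau>"
    and h_sym: "\<And>z. cmod z = 1 \<Longrightarrow> h z ** \<tau> ** cadjoint (h (- cnj z)) = \<tau>"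
    and W': "mnear W'" "\<And>z. cmod z = 1 \<Longrightarrow> (T z - h z) ** \<tau> ** W' z = mat 1"
begin

definition "Ts z = cadjoint (T (- cnj z))"
definition "hs z = cadjoint (h (- cnj z))"
definition "W z = (T z - h z) ** \<tau>"
definition "minus_part f = f - plus_part f"

definition X :: "'p seq \<Rightarrow> 'p seq" where
  "X f = lop W (minus_part (lop hs (flip f)) + plus_part (lop Ts (flip f)))"

definition Y :: "'p seq \<Rightarrow> 'p seq" where
  "Y f = - flip (minus_part (lop (\<lambda>z. \<tau>' ** h z ** \<tau>) (minus_part (lop W' f))) +
                plus_part (lop (\<lambda>z. \<tau>' ** T z ** \<tau>) (plus_part (lop W' f))))"

definition B :: "complex ^ 'p \<Rightarrow> 'p seq" where
  "B v = lop W (at_index 0 v)"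

definition B' :: "'p seq \<Rightarrow> complex ^ 'p" where
  "B' f = - (\<tau> *v block (-1) (lop Ts (flip f) - lop hs (flip f)))"

lemma near: "mnear Ts" "mnear hs" "mnear W" "mnear (\<lambda>z. \<tau>' ** h z ** \<tau>)" "mnear (\<lambda>z. \<tau>' ** T z ** \<tau>)"
    "mnear (\<lambda>z. T z ** \<tau>)" "mnear (\<lambda>z. h z ** \<tau>)"
  unfolding Ts_def hs_def W_def
  by (intro mnear_reflect mnear_mult mnear_diff mnear_const T h)+

lemma supp: "minus_supported Ts" "plus_supported hs" "plus_supported (\<lambda>z. \<tau>' ** h z ** \<tau>)"
    "minus_supported (\<lambda>z. \<tau>' ** T z ** \<tau>)"
  unfolding Ts_def hs_def
  by (intro minus_supported_reflect plus_supported_reflect minus_supported_sandwich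
      plus_supported_sandwich T h)+

lemma sym_inverse:
  assumes "A ** \<tau> ** As = \<tau>"
  shows "As ** (\<tau>' ** A ** \<tau>) = mat 1" "(\<tau>' ** A ** \<tau>) ** As = mat 1"
proof -
  show r: "(\<tau>' ** A ** \<tau>) ** As = mat 1"
    using assms \<tau>(3) by (metis matrix_mul_assoc)
  then show "As ** (\<tau>' ** A ** \<tau>) = mat 1" by (simp only: matrix_left_right_inverse)
qed

lemma Ts_inverse:
  "lop Ts (lop (\<lambda>z. \<tau>' ** T z ** \<tau>) f) = f" "lop (\<lambda>z. \<tau>' ** T z ** \<tau>) (lop Ts f) = f"
  by (intro lop_inverse near; simp add: Ts_def sym_inverse T_sym)+

lemma hs_inverse:
  "lop hs (lop (\<lambda>z. \<tau>' ** h z ** \<tau>) f) = f" "lop (\<lambda>z. \<tau>' ** h z ** \<tau>) (lop hs f) = f"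
  by (intro lop_inverse near; simp add: hs_def sym_inverse h_sym)+

lemma W_inverse: "lop W (lop W' f) = f" "lop W' (lop W f) = f"
proof -
  have r: "W z ** W' z = mat 1" if "cmod z = 1" for z
    using W'(2)[OF that] by (simp add: W_def)
  then have l: "W' z ** W z = mat 1" if "cmod z = 1" for z
    using that by (simp only: matrix_left_right_inverse)
  show "lop W (lop W' f) = f" by (rule lop_inverse[OF near(3) W'(1) r])
  show "lop W' (lop W f) = f" by (rule lop_inverse[OF W'(1) near(3) l])
qed

lemma minus_part_simps:
  "minus_part (f + g) = minus_part f + minus_part g" "minus_part (cscale c f) = cscale c (minus_part f)"
  "minus_part (minus_part f) = minus_part f" "minus_part (plus_part f) = 0" "plus_part (minus_part f) = 0"
  "minus_part f + plus_part f = f"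
  by (auto simp: minus_part_def plus_part_simps algebra_simps intro!: ell2_eqI)

lemma minus_part_plus_supported:
  assumes "mnear F" "plus_supported F"
  shows "minus_part (lop F (minus_part f)) = minus_part (lop F f)"
  using plus_part_plus_supported[OF assms, of f]
  by (simp add: minus_part_def lop_vdiff[OF assms(1)] plus_part_simps)

lemma X_Y: "X (Y f) = f"
proof -
  let ?g = "lop W' f"
  let ?a = "minus_part (lop (\<lambda>z. \<tau>' ** h z ** \<tau>) (minus_part ?g))"
  let ?b = "plus_part (lop (\<lambda>z. \<tau>' ** T z ** \<tau>) (plus_part ?g))"
  have flipY: "flip (Y f) = ?a + ?b"
    by (simp add: Y_def flip_simps flip_flip)
  have ma: "minus_part (?a + ?b) = ?a" and pb: "plus_part (?a + ?b) = ?b"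
    by (simp_all add: minus_part_simps plus_part_simps)
  have "minus_part (lop hs (?a + ?b)) = minus_part (lop hs ?a)"
    using minus_part_plus_supported[OF near(2) supp(2), of "?a + ?b"] by (simp only: ma)
  also have "\<dots> = minus_part (lop hs (lop (\<lambda>z. \<tau>' ** h z ** \<tau>) (minus_part ?g)))"
    by (rule minus_part_plus_supported[OF near(2) supp(2)])
  finally have 1: "minus_part (lop hs (?a + ?b)) = minus_part ?g"
    by (simp add: hs_inverse minus_part_simps)
  have "plus_part (lop Ts (?a + ?b)) = plus_part (lop Ts ?b)"
    using plus_part_minus_supported[OF near(1) supp(1), of "?a + ?b"] by (simp only: pb)
  also have "\<dots> = plus_part (lop Ts (lop (\<lambda>z. \<tau>' ** T z ** \<tau>) (plus_part ?g)))"
    by (rule plus_part_minus_supported[OF near(1) supp(1)])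
  finally have 2: "plus_part (lop Ts (?a + ?b)) = plus_part ?g"
    by (simp add: Ts_inverse plus_part_simps)
  show ?thesis
    unfolding X_def flipY 1 2 by (simp add: minus_part_simps W_inverse)
qed

lemma Y_X: "Y (X f) = f"
proof -
  let ?u = "flip f"
  let ?a = "minus_part (lop hs ?u)" and ?b = "plus_part (lop Ts ?u)"
  have g: "lop W' (X f) = ?a + ?b" by (simp add: X_def W_inverse)
  have ma: "minus_part (?a + ?b) = ?a" and pb: "plus_part (?a + ?b) = ?b"
    by (simp_all add: minus_part_simps plus_part_simps)
  have 1: "minus_part (lop (\<lambda>z. \<tau>' ** h z ** \<tau>) ?a) = minus_part ?u"
    by (simp add: minus_part_plus_supported[OF near(4) supp(3)] hs_inverse)
  have 2: "plus_part (lop (\<lambda>z. \<tau>' ** T z ** \<tau>) ?b) = plus_part ?u"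
    by (simp add: plus_part_minus_supported[OF near(5) supp(4)] Ts_inverse)
  show ?thesis
    unfolding Y_def g ma pb 1 2 by (simp add: minus_part_simps flip_flip)
qed

lemma W_reflect: "lop (\<lambda>z. cadjoint (W (- cnj z))) f = lop (\<lambda>_. \<tau>) (lop Ts f - lop hs f)"
proof -
  have "cadjoint (W (- cnj z)) = \<tau> ** (Ts z - hs z)" for z
    by (simp add: W_def Ts_def hs_def cadjoint_mult cadjoint_diff \<tau>)
  then show ?thesis
    by (simp add: lop_diff near flip: lop_mult[OF mnear_const mnear_diff[OF near(1,2)]])
qed

lemma ip_B: "ip (B v) f = hinner cspace v (B' f)"
proof -
  have "ip (B v) f = ip (at_index 0 v) (- flip (lop (\<lambda>z. cadjoint (W (- cnj z))) (flip f)))"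
    by (simp add: B_def ip_lop near ip_minus_right)
  then show ?thesis
    by (simp add: ip_at_index B'_def W_reflect block_simps block_flip block_lop_const)
qed

lemma X_selfadjoint: "ip (X f) g = ip f (X g)"
proof -
  let ?u = "flip g"
  let ?a = "lop Ts ?u" and ?b = "lop hs ?u"
  let ?w = "lop (\<lambda>_. \<tau>) (?a - ?b)"
  have Tsharp: "(\<lambda>z. cadjoint (Ts (- cnj z))) = T" and hsharp: "(\<lambda>z. cadjoint (hs (- cnj z))) = h"
    by (simp_all add: Ts_def hs_def cadjoint_def vec_eq_iff fun_eq_iff)
  have adj: "ip (lop hs x) y = - ip x (flip (lop h (flip y)))" "ip (lop Ts x) y = - ip x (flip (lop T (flip y)))" for x y
    using ip_lop[OF near(2), of x y] ip_lop[OF near(1), of x y] by (simp_all add: Tsharp hsharp)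
  have flip_minus: "flip (minus_part x) = plus_part (flip x)" "flip (plus_part x) = minus_part (flip x)" for x
    by (simp_all add: minus_part_def flip_simps flip_plus_part)
  have ip_minus_part: "ip (minus_part x) y = ip x (minus_part y)" for x y
    by (simp add: minus_part_def ip_diff_left ip_diff_right ip_plus_part)
  have "ip (X f) g = - ip (minus_part (lop hs (flip f)) + plus_part (lop Ts (flip f))) (flip ?w)"
    unfolding X_def by (simp add: ip_lop near W_reflect)
  also have "\<dots> = ip (flip f) (flip (lop h (flip (minus_part (flip ?w))))) +
      ip (flip f) (flip (lop T (flip (plus_part (flip ?w)))))"
    by (simp add: ip_add_left ip_minus_part ip_plus_part adj)
  also have "\<dots> = - ip f (lop h (plus_part ?w) + lop T (minus_part ?w))"
    by (simp add: ip_flip flip_minus flip_flip ip_minus_right ip_add_right plus_part_simps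
        minus_part_def flip_simps lop_vdiff lop_minus T h ip_diff_right algebra_simps)
  also have "lop h (plus_part ?w) + lop T (minus_part ?w) = - X g"
  proof -
    have comm: "minus_part (lop (\<lambda>_. \<tau>) x) = lop (\<lambda>_. \<tau>) (minus_part x)" for x
      by (simp add: minus_part_def plus_part_const lop_vdiff mnear_const)
    have m: "lop T (lop (\<lambda>_. \<tau>) x) = lop (\<lambda>z. T z ** \<tau>) x" "lop h (lop (\<lambda>_. \<tau>) x) = lop (\<lambda>z. h z ** \<tau>) x" for x
      by (simp_all add: lop_mult T h mnear_const)
    have eq: "lop (\<lambda>z. T z ** \<tau>) ?a = lop (\<lambda>z. h z ** \<tau>) ?b"
    proof -
      have "lop (\<lambda>z. T z ** \<tau>) ?a = lop (\<lambda>z. T z ** \<tau> ** Ts z) ?u"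
        by (rule lop_mult[OF near(6) near(1)])
      also have "\<dots> = lop (\<lambda>z. h z ** \<tau> ** hs z) ?u"
        by (rule fun_cong[OF lop_cong]) (simp add: Ts_def hs_def T_sym h_sym)
      also have "\<dots> = lop (\<lambda>z. h z ** \<tau>) ?b"
        by (rule lop_mult[OF near(7) near(2), symmetric])
      finally show ?thesis .
    qed
    have Weq: "lop W x = lop (\<lambda>z. T z ** \<tau>) x - lop (\<lambda>z. h z ** \<tau>) x" for x
    proof -
      have "W = (\<lambda>z. T z ** \<tau> - h z ** \<tau>)" by (simp add: W_def fun_eq_iff matrix_diff_rdistrib)
      then show ?thesis by (simp add: lop_diff near)
    qed
    have "lop h (plus_part ?w) = lop (\<lambda>z. h z ** \<tau>) (plus_part ?a - plus_part ?b)"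
      by (simp add: plus_part_const m plus_part_simps)
    moreover have "lop T (minus_part ?w) = lop (\<lambda>z. T z ** \<tau>) ((?a - ?b) - (plus_part ?a - plus_part ?b))"
      by (simp add: comm m) (simp add: minus_part_def plus_part_simps)
    moreover have "X g = lop W ((?b - plus_part ?b) + plus_part ?a)"
      by (simp add: X_def minus_part_def)
    ultimately show ?thesis
      using eq by (simp add: Weq lop_add lop_vdiff near)
  qed
  finally show ?thesis by (simp add: ip_minus_right)
qed

lemma X_at_index: "X (at_index (-1) v) = B v"
proof -
  let ?e = "at_index 0 v :: 'p seq"
  have e: "plus_part ?e = ?e" by (rule ell2_eqI) auto
  have "minus_part (lop hs ?e) = 0"
    using plus_part_plus_supported[OF near(2) supp(2), of ?e] by (simp add: e minus_part_def)
  moreover have "plus_part (lop Ts ?e) = ?e"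
  proof (rule ell2_eqI)
    fix x :: "int \<times> 'p"
    obtain n i where x: "x = (n, i)" by (metis surj_pair)
    have c: "lcoef (\<lambda>z. Ts z $ i $ j) n = (if n = 0 \<and> i = j then 1 else 0)" if "0 \<le> n" for j
    proof (cases "n = 0")
      case True
      have "lcoef (\<lambda>z. Ts z $ i $ j) 0 = cnj (lcoef (\<lambda>z. T z $ j $ i) 0)"
        by (simp add: Ts_def lcoef_cadjoint_reflect T(1))
      then show ?thesis using True by (auto simp: T(3) mat_def)
    qed (use supp(1) that in \<open>simp add: minus_supported_def\<close>)
    show "coord (plus_part (lop Ts ?e)) x = coord ?e x"
      by (auto simp: x lop_at_index near c if_distrib if_distribR cong: if_cong)
  qed
  ultimately show ?thesis
    by (simp add: X_def B_def flip_at_index)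
qed

lemma hinner_cspace_eqI:
  assumes "\<And>v. hinner cspace v a = hinner cspace v b"
  shows "a = (b :: complex ^ 'p)"
proof -
  have "hinner cspace (axis i 1) c = cnj (c $ i)" for i and c :: "complex ^ 'p"
  proof -
    have "(axis i 1 :: complex ^ 'p) $ j * cnj (c $ j) = (if j = i then cnj (c $ j) else 0)" for j
      by (simp add: axis_def)
    then show ?thesis by (simp add: cspace_def)
  qed
  then have "cnj (a $ i) = cnj (b $ i)" for i using assms by metis
  then show ?thesis by (simp add: vec_eq_iff)
qed

lemma B'_Y: "B' (Y f) = block (-1) f"
proof (rule hinner_cspace_eqI)
  fix v
  have "hinner cspace v (B' (Y f)) = ip (X (at_index (-1) v)) (Y f)"
    by (simp add: ip_B X_at_index)
  also have "\<dots> = hinner cspace v (block (-1) f)"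
    by (simp add: X_selfadjoint X_Y ip_at_index)
  finally show "hinner cspace v (B' (Y f)) = hinner cspace v (block (-1) f)" .
qed

lemma lyapunov_equation:
  assumes \<sigma>: "\<sigma> ** \<tau> = mat (- \<rho>)"
  shows "cscale \<rho> (shift 1 (X f)) + X (cscale \<rho> (shift (-1) f)) + B (\<sigma> *v B' f) = 0"
proof -
  let ?u = "flip f"
  let ?a = "lop Ts ?u" and ?b = "lop hs ?u"
  have "flip (cscale \<rho> (shift (-1) f)) = cscale (- \<rho>) (shift 1 ?u)"
    by (rule ell2_eqI) (simp add: flip_simps flip_shift)
  then have 1: "X (cscale \<rho> (shift (-1) f)) =
      cscale (- \<rho>) (lop W (minus_part (shift 1 ?b) + plus_part (shift 1 ?a)))"
    by (simp add: X_def lop_scale lop_shift near plus_part_simps minus_part_simps lop_add)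
       (rule ell2_eqI, simp add: algebra_simps)
  have 2: "shift 1 (X f) = lop W (shift 1 (minus_part ?b) + shift 1 (plus_part ?a))"
    by (simp add: X_def lop_shift near flip: shift_simps(1))
  have c: "at_index 0 (block (-1) (?a - ?b)) =
      (minus_part (shift 1 ?b) + plus_part (shift 1 ?a)) - (shift 1 (minus_part ?b) + shift 1 (plus_part ?a))"
    by (simp add: block_simps at_index_simps minus_part_def shift_simps flip: plus_part_shift)
  have "\<sigma> *v B' f = \<rho> *s block (-1) (?a - ?b)"
  proof -
    have "\<sigma> *v B' f = - (mat (- \<rho>) *v block (-1) (?a - ?b))"
      by (simp add: B'_def matrix_vector_mult_minus matrix_vector_mul_assoc \<sigma>)
    then show ?thesis by (simp add: mat_mult_vec vec_eq_iff)
  qed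
  then have 3: "B (\<sigma> *v B' f) = cscale \<rho> (lop W (at_index 0 (block (-1) (?a - ?b))))"
    by (simp add: B_def at_index_simps lop_scale near)
  show ?thesis
    unfolding 1 2 3 c by (rule ell2_eqI) (simp add: lop_add lop_vdiff near algebra_simps)
qed

end

section \<open>Bounded operators on sequences\<close>

definition ell2_op :: "('i ell2 \<Rightarrow> 'i ell2) \<Rightarrow> bool" where
  "ell2_op F \<longleftrightarrow> (\<forall>f g. F (f + g) = F f + F g) \<and> (\<forall>c f. F (cscale c f) = cscale c (F f)) \<and>
     (\<exists>M. \<forall>f. nrm (F f) \<le> M * nrm f)"

lemma nrm_add_le: "nrm (f + g) \<le> nrm f + nrm g"
proof -
  have "Re (ip f g) \<le> nrm f * nrm g"
  proof (cases "nrm f = 0 \<or> nrm g = 0")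
    case True
    then have "f = 0 \<or> g = 0" using nrm_pos less_irrefl by metis
    then show ?thesis using True by (auto simp: ip_def)
  next
    case False
    then have pos: "nrm f > 0" "nrm g > 0" using nrm_nonneg[of f] nrm_nonneg[of g] by auto
    have "0 \<le> (nrm (cscale (nrm g) f - cscale (nrm f) g))\<^sup>2" by simp
    also have "\<dots> = Re (ip (cscale (nrm g) f - cscale (nrm f) g) (cscale (nrm g) f - cscale (nrm f) g))"
      unfolding ip_self by simp
    also have "\<dots> = 2 * (nrm f * nrm g) * (nrm f * nrm g - Re (ip f g))"
    proof -
      have s: "ip x (cscale c y) = cnj c * ip x y" for x y :: "'a ell2" and c
        by (metis complex_cnj_cnj complex_cnj_mult ip_scale_left ip_sym)
      have g: "ip g f = cnj (ip f g)" by (rule ip_sym)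
      show ?thesis
        by (simp add: ip_diff_left ip_diff_right ip_scale_left s ip_self[of f] ip_self[of g] g
            power2_eq_square algebra_simps)
    qed
    finally show ?thesis using mult_pos_pos[OF pos] by (auto simp: zero_le_mult_iff)
  qed
  then have "(nrm (f + g))\<^sup>2 \<le> (nrm f + nrm g)\<^sup>2"
  proof -
    have "(nrm (f + g))\<^sup>2 = Re (ip (f + g) (f + g))" unfolding ip_self by simp
    also have "\<dots> = (nrm f)\<^sup>2 + (nrm g)\<^sup>2 + 2 * Re (ip f g)"
      using ip_sym[of g f] by (simp add: ip_add_left ip_add_right ip_self[of f] ip_self[of g])
    finally show ?thesis using \<open>Re (ip f g) \<le> nrm f * nrm g\<close> by (simp add: power2_sum)
  qed
  then show ?thesis by (rule power2_le_imp_le) (simp add: nrm_nonneg)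
qed

lemma nrm_minus: "nrm (- f) = nrm f"
  by (simp add: nrm_def)

lemma nrm_cscale: "nrm (cscale c f) = cmod c * nrm f"
  by (simp add: nrm_def norm_mult power_mult_distrib infsum_cmult_right' real_sqrt_mult)

lemma ell2_opI:
  assumes "\<And>f g. F (f + g) = F f + F g" "\<And>c f. F (cscale c f) = cscale c (F f)"
    "\<And>f. nrm (F f) \<le> M * nrm f"
  shows "ell2_op F"
  using assms unfolding ell2_op_def by blast

lemma ell2_op_comp: "ell2_op F \<Longrightarrow> ell2_op G \<Longrightarrow> ell2_op (\<lambda>f. F (G f))"
proof -
  assume F: "ell2_op F" and G: "ell2_op G"
  obtain M L where M: "\<And>f. nrm (F f) \<le> M * nrm f" and L: "\<And>f. nrm (G f) \<le> L * nrm f"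
    using F G unfolding ell2_op_def by blast
  have "nrm (F (G f)) \<le> (\<bar>M\<bar> * L) * nrm f" for f
  proof -
    have "nrm (F (G f)) \<le> \<bar>M\<bar> * nrm (G f)"
      using M[of "G f"] mult_right_mono[OF abs_ge_self nrm_nonneg, of M "G f"] by linarith
    also have "\<dots> \<le> \<bar>M\<bar> * (L * nrm f)" by (intro mult_left_mono L) auto
    finally show ?thesis by (simp add: mult.assoc)
  qed
  then show ?thesis
    by (rule ell2_opI[rotated -1]) (use F G in \<open>auto simp: ell2_op_def\<close>)
qed

lemma ell2_op_add: "ell2_op F \<Longrightarrow> ell2_op G \<Longrightarrow> ell2_op (\<lambda>f. F f + G f)"
proof -
  assume F: "ell2_op F" and G: "ell2_op G"
  obtain M L where M: "\<And>f. nrm (F f) \<le> M * nrm f" and L: "\<And>f. nrm (G f) \<le> L * nrm f"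
    using F G unfolding ell2_op_def by blast
  show ?thesis
  proof (rule ell2_opI)
    show "nrm (F f + G f) \<le> (M + L) * nrm f" for f
      using nrm_add_le[of "F f" "G f"] M[of f] L[of f] by (simp add: distrib_right)
    show "F (f + g) + G (f + g) = F f + G f + (F g + G g)" for f g
      using F G by (simp add: ell2_op_def)
    show "F (cscale c f) + G (cscale c f) = cscale c (F f + G f)" for c f
      using F G by (auto simp: ell2_op_def distrib_left intro!: ell2_eqI)
  qed
qed

lemma ell2_op_minus: "ell2_op F \<Longrightarrow> ell2_op (\<lambda>f. - F f)"
  unfolding ell2_op_def by (simp add: nrm_minus) (auto intro!: ell2_eqI)

lemma ell2_op_diff: "ell2_op F \<Longrightarrow> ell2_op G \<Longrightarrow> ell2_op (\<lambda>f. F f - G f)"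
  using ell2_op_add[OF _ ell2_op_minus, of F G] by simp

lemma ell2_op_cscale: "ell2_op (cscale c)"
  by (rule ell2_opI[where M = "cmod c"]) (auto simp: nrm_cscale intro!: ell2_eqI simp: algebra_simps)

lemma ell2_op_id: "ell2_op (\<lambda>f. f)"
  by (rule ell2_opI[where M = 1]) auto

lemma ell2_op_lop: "mnear F \<Longrightarrow> ell2_op (lop F)"
  unfolding ell2_op_def using lop_add lop_scale lop_bounded by blast

lemma ell2_op_shift: "ell2_op (shift k)" and ell2_op_flip: "ell2_op flip"
  and ell2_op_plus_part: "ell2_op plus_part"
  by (rule ell2_opI[where M = 1];
      simp add: shift_simps flip_simps plus_part_simps nrm_shift_le nrm_flip_le nrm_plus_part_le)+

section \<open>The state operator and its resolvent\<close>

definition res :: "real \<Rightarrow> complex \<Rightarrow> 'p::finite seq \<Rightarrow> 'p seq" where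
  "res \<rho> z = lop (\<lambda>w. mat (1 / (z - of_real \<rho> * w)))"

definition state :: "real \<Rightarrow> 'p seq \<Rightarrow> 'p seq" where
  "state \<rho> f = cscale \<rho> (shift 1 f)"

lemma ell2_op_state: "ell2_op (state \<rho>)"
  unfolding state_def[abs_def] by (intro ell2_op_comp[OF ell2_op_cscale] ell2_op_shift)

lemma ip_state: "ip (state \<rho> f) g = ip f (cscale \<rho> (shift (-1) g))"
proof -
  have "ip (state \<rho> f) g = \<rho> * ip f (shift (-1) g)"
    by (simp add: state_def ip_scale_left ip_shift)
  also have "\<dots> = ip f (cscale \<rho> (shift (-1) g))"
    by (metis complex_cnj_complex_of_real complex_cnj_cnj complex_cnj_mult ip_scale_left ip_sym)
  finally show ?thesis .
qed

lemma resolvent_denominator: "0 < \<rho> \<Longrightarrow> \<rho> < cmod z \<Longrightarrow> cmod w = 1 \<Longrightarrow> z - complex_of_real \<rho> * w \<noteq> 0"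
  by (auto simp: norm_mult)

lemma
  assumes "0 < \<rho>" "\<rho> < cmod z"
  shows mnear_res: "mnear (\<lambda>w. mat (1 / (z - of_real \<rho> * w)) :: complex ^ 'p ^ 'p)"
    and ell2_op_res: "ell2_op (res \<rho> z :: 'p seq \<Rightarrow> 'p seq)"
    and res_right: "cscale z (res \<rho> z f) - state \<rho> (res \<rho> z f) = (f :: 'p seq)"
    and res_left: "res \<rho> z (cscale z f - state \<rho> f) = (f :: 'p seq)"
proof -
  have nz: "z - complex_of_real \<rho> * w \<noteq> 0" if "cmod w = 1" for w
    using resolvent_denominator[OF assms that] .
  have near: "near_circle (\<lambda>w. z - complex_of_real \<rho> * w)"
    by (intro near_circle_diff near_circle_mult near_circle_const near_circle_ident)
  show R: "mnear (\<lambda>w. mat (1 / (z - of_real \<rho> * w)) :: complex ^ 'p ^ 'p)"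
    by (intro mnear_mat near_circle_divide near_circle_const near nz)
  show "ell2_op (res \<rho> z :: 'p seq \<Rightarrow> 'p seq)" unfolding res_def by (rule ell2_op_lop[OF R])
  have L: "mnear (\<lambda>w. mat (z - of_real \<rho> * w) :: complex ^ 'p ^ 'p)"
    by (rule mnear_mat[OF near])
  have eq: "cscale z g - state \<rho> g = lop (\<lambda>w. mat (z - of_real \<rho> * w)) g" for g :: "'p seq"
  proof -
    have "mat (z - of_real \<rho> * w) = (mat z - mat (of_real \<rho>) ** mat w :: complex ^ 'p ^ 'p)" for w
      by (simp add: mat_mult_mat) (simp add: mat_def vec_eq_iff)
    moreover have "mnear (\<lambda>w. mat w :: complex ^ 'p ^ 'p)" by (intro mnear_mat near_circle_ident)
    ultimately show ?thesis
      by (simp add: state_def shift_eq_lop lop_diff mnear_const mnear_mult lop_mult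
          cscale_eq_lop[of z] cscale_eq_lop[of "complex_of_real \<rho>"])
  qed
  show "cscale z (res \<rho> z f) - state \<rho> (res \<rho> z f) = f"
    unfolding eq res_def
  proof (rule lop_inverse[OF L R])
    fix w :: complex assume "cmod w = 1"
    then show "mat (z - of_real \<rho> * w) ** mat (1 / (z - of_real \<rho> * w)) = (mat 1 :: complex ^ 'p ^ 'p)"
      using nz[of w] by (simp add: mat_mult_mat)
  qed
  show "res \<rho> z (cscale z f - state \<rho> f) = f"
    unfolding eq res_def
  proof (rule lop_inverse[OF R L])
    fix w :: complex assume "cmod w = 1"
    then show "mat (1 / (z - of_real \<rho> * w)) ** mat (z - of_real \<rho> * w) = (mat 1 :: complex ^ 'p ^ 'p)"
      using nz[of w] by (simp add: mat_mult_mat)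
  qed
qed

lemma lcoef_resolvent:
  assumes "0 < \<rho>" "\<rho> < cmod z"
  shows "lcoef (\<lambda>w. 1 / (z - complex_of_real \<rho> * w)) n = (if 0 \<le> n then of_real \<rho> ^ nat n / z ^ Suc (nat n) else 0)"
proof (rule lcoef_power_series)
  have z: "z \<noteq> 0" using assms by auto
  have "(\<lambda>k. cmod (of_real \<rho> ^ k / z ^ Suc k)) = (\<lambda>k. (1 / cmod z) * (\<rho> / cmod z) ^ k)"
    using assms by (simp add: norm_divide norm_mult norm_power power_divide)
  moreover have "summable (\<lambda>k. (1 / cmod z) * (\<rho> / cmod z) ^ k)"
    using assms by (intro summable_mult summable_geometric) (simp add: divide_less_eq_1)
  ultimately show "summable (\<lambda>k. cmod (of_real \<rho> ^ k / z ^ Suc k))" by simp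
  fix w :: complex assume w: "cmod w = 1"
  have "norm (of_real \<rho> * w / z) < 1" using assms w by (simp add: norm_mult norm_divide divide_less_eq_1)
  from sums_mult[OF geometric_sums[OF this], of "1 / z"]
  have "(\<lambda>k. 1 / z * (of_real \<rho> * w / z) ^ k) sums (1 / z * (1 / (1 - of_real \<rho> * w / z)))" .
  moreover have "1 / z * (1 / (1 - of_real \<rho> * w / z)) = 1 / (z - of_real \<rho> * w)"
    using z resolvent_denominator[OF assms w] by (simp add: field_simps)
  moreover have "1 / z * (of_real \<rho> * w / z) ^ k = of_real \<rho> ^ k / z ^ Suc k * w ^ k" for k
    using z by (simp add: power_divide power_mult_distrib)
  ultimately show "(\<lambda>k. of_real \<rho> ^ k / z ^ Suc k * w ^ k) sums (1 / (z - of_real \<rho> * w))"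
    by simp
qed

lemma (in jump) realization_formula:
  assumes \<rho>: "0 < \<rho>" "\<rho> < cmod z" and \<sigma>: "\<tau> ** \<sigma> = mat (- of_real \<rho>)"
    and a: "\<And>i j. summable (\<lambda>m. cmod (a i j m))"
    and Ta: "\<And>i j w. cmod w = 1 \<Longrightarrow> (\<lambda>m. a i j m * inverse w ^ m) sums T w $ i $ j"
    and Sa: "\<And>i j. (\<lambda>m. a i j m * (of_real \<rho> / z) ^ m) sums S $ i $ j"
  shows "S *v v = v - B' (Y (res \<rho> z (B (\<sigma> *v v))))"
proof -
  let ?c = "\<lambda>w. 1 / (z - complex_of_real \<rho> * w)"
  let ?F = "\<lambda>w. mat (?c w) ** ((T w - h w) ** mat (- of_real \<rho>)) :: complex ^ 'p ^ 'p"
  have F: "mnear ?F" by (intro mnear_mult mnear_res[OF \<rho>] mnear_diff T h mnear_const)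
  have "res \<rho> z (B (\<sigma> *v v)) = lop (\<lambda>w. mat (?c w)) (lop W (lop (\<lambda>_. \<sigma>) (at_index 0 v)))"
    by (simp add: res_def B_def lop_const_at_index)
  also have "lop W (lop (\<lambda>_. \<sigma>) (at_index 0 v)) = lop (\<lambda>w. (T w - h w) ** mat (- of_real \<rho>)) (at_index 0 v)"
    by (simp add: lop_mult near mnear_const) (simp add: W_def \<sigma> flip: matrix_mul_assoc)
  also have "lop (\<lambda>w. mat (?c w)) \<dots> = lop ?F (at_index 0 v)"
    by (intro lop_mult mnear_res[OF \<rho>] mnear_mult mnear_diff T h mnear_const)
  finally have res: "res \<rho> z (B (\<sigma> *v v)) = lop ?F (at_index 0 v)" .
  have c: "near_circle ?c"
    by (intro near_circle_divide near_circle_diff near_circle_mult near_circle_const near_circle_ident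
        resolvent_denominator \<rho>)
  have coef: "lcoef (\<lambda>w. ?F w $ i $ j) (-1) = mat 1 $ i $ j - S $ i $ j" for i j
  proof -
    let ?g = "\<lambda>w. - of_real \<rho> * (T w $ i $ j - h w $ i $ j)"
    have g: "near_circle ?g" by (intro near_circle_mult near_circle_const near_circle_diff mnearD T h)
    have Tc: "lcoef (\<lambda>w. T w $ i $ j) n = (if n \<le> 0 then a i j (nat (- n)) else 0)" for n
      by (rule lcoef_power_series_inverse[OF a Ta])
    let ?b = "\<lambda>m. a i j m * (of_real \<rho> / z) ^ m"
    have q: "cmod (of_real \<rho> / z) \<le> 1" using \<rho> by (simp add: norm_divide divide_le_eq_1)
    have b: "summable (\<lambda>m. cmod (?b m))"
      by (rule summable_comparison_test'[OF a[of i j]])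
         (use power_le_one[OF norm_ge_zero q] in \<open>auto simp: norm_mult norm_power intro!: mult_left_le\<close>)
    have "(\<lambda>m. ?b (Suc m)) sums (S $ i $ j - ?b 0)"
      using Sa[of i j] sums_Suc_iff[of ?b "S $ i $ j - ?b 0"] by simp
    moreover have "?b 0 = mat 1 $ i $ j" using T(3)[of i j] Tc[of 0] by simp
    ultimately have s: "(\<lambda>m. - ?b (Suc m)) sums (mat 1 $ i $ j - S $ i $ j)"
      using sums_minus by fastforce
    have "((\<lambda>k::int. if 0 \<le> k then - ?b (Suc (nat k)) else 0) has_sum mat 1 $ i $ j - S $ i $ j) UNIV"
      by (rule has_sum_int_nonneg[OF _ s]) (use summable_Suc_iff[of "\<lambda>m. cmod (?b m)"] b in simp)
    moreover have "(if 0 \<le> k then - ?b (Suc (nat k)) else 0) = lcoef ?c k * lcoef ?g (-1 - k)" for k :: int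
    proof (cases "0 \<le> k")
      case True
      have "lcoef (\<lambda>w. h w $ i $ j) (-1 - k) = 0"
        using h(2) True by (simp add: plus_supported_def)
      moreover have "nat (k + 1) = Suc (nat k)" using True by simp
      moreover have "lcoef ?g n = - of_real \<rho> * (lcoef (\<lambda>w. T w $ i $ j) n - lcoef (\<lambda>w. h w $ i $ j) n)" for n
        using lcoef_cmult[OF near_circle_diff[OF mnearD[OF T(1)] mnearD[OF h(1)]]]
          lcoef_diff[OF mnearD[OF T(1)] mnearD[OF h(1)]] by metis
      ultimately have "lcoef ?g (-1 - k) = - of_real \<rho> * a i j (Suc (nat k))"
        using True by (simp add: Tc)
      then show ?thesis
        using True \<rho> by (simp add: lcoef_resolvent power_divide)
    qed (simp add: lcoef_resolvent[OF \<rho>])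
    ultimately have "((\<lambda>k. lcoef ?c k * lcoef ?g (-1 - k)) has_sum mat 1 $ i $ j - S $ i $ j) UNIV"
      by simp
    then have "lcoef (\<lambda>w. ?c w * ?g w) (-1) = mat 1 $ i $ j - S $ i $ j"
      using has_sum_unique[OF has_sum_lcoef_prod[OF c g]] by blast
    moreover have "?F w $ i $ j = ?c w * ?g w" for w
      by (simp only: mat_matrix_mult matrix_mult_mat vector_minus_component)
    ultimately show ?thesis by simp
  qed
  have "coord (lop ?F (at_index 0 v)) (-1, i) = v $ i - (S *v v) $ i" for i
  proof -
    have "coord (lop ?F (at_index 0 v)) (-1, i) = (\<Sum>j\<in>UNIV. (mat 1 $ i $ j - S $ i $ j) * v $ j)"
      unfolding lop_at_index[OF F] using coef by simp
    also have "\<dots> = ((mat 1 - S) *v v) $ i" by (simp add: matrix_vector_mult_def)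
    finally show ?thesis by (simp add: matrix_vector_mult_diff_rdistrib)
  qed
  then have "B' (Y (res \<rho> z (B (\<sigma> *v v)))) = v - S *v v"
    by (simp add: B'_Y res block_def vec_eq_iff)
  then show ?thesis by simp
qed

section \<open>Existence of the realization for a single parameter\<close>

definition realization_data ::
    "real \<Rightarrow> complex ^ 'p ^ 'p \<Rightarrow> (complex \<Rightarrow> complex ^ 'p ^ 'p) \<Rightarrow> ('p seq \<Rightarrow> 'p seq) \<Rightarrow> ('p seq \<Rightarrow> 'p seq) \<Rightarrow>
     (complex ^ 'p \<Rightarrow> 'p seq) \<Rightarrow> ('p seq \<Rightarrow> complex ^ 'p) \<Rightarrow> bool" where
  "realization_data \<rho> \<sigma> S X Y B B' \<longleftrightarrow>
     ell2_op X \<and> ell2_op Y \<and> (\<forall>f. X (Y f) = f) \<and> (\<forall>f. Y (X f) = f) \<and> (\<forall>f g. ip (X f) g = ip f (X g)) \<and>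
     (\<forall>v w. B (v + w) = B v + B w) \<and> (\<forall>c v. B (c *s v) = cscale c (B v)) \<and>
     (\<exists>M. \<forall>v. nrm (B v) \<le> M * norm v) \<and> (\<forall>v f. ip (B v) f = hinner cspace v (B' f)) \<and>
     (\<forall>f. state \<rho> (X f) + X (cscale \<rho> (shift (-1) f)) + B (\<sigma> *v B' f) = 0) \<and>
     (\<forall>z v. \<rho> < cmod z \<longrightarrow> S z *v v = v - B' (Y (res \<rho> z (B (\<sigma> *v v)))))"

lemma (in jump) ell2_ops: "ell2_op X" "ell2_op Y"
proof -
  have minus: "ell2_op minus_part"
    unfolding minus_part_def[abs_def] by (intro ell2_op_diff ell2_op_id ell2_op_plus_part)
  show "ell2_op X"
    unfolding X_def[abs_def]
    by (intro ell2_op_comp[OF ell2_op_lop] near ell2_op_add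
        ell2_op_comp[OF minus] ell2_op_comp[OF ell2_op_plus_part] ell2_op_flip)
  show "ell2_op Y"
    unfolding Y_def[abs_def]
    by (intro ell2_op_minus ell2_op_comp[OF ell2_op_flip] ell2_op_add ell2_op_comp[OF minus]
        ell2_op_comp[OF ell2_op_plus_part] ell2_op_comp[OF ell2_op_lop] near ell2_op_lop W')
qed

lemma (in jump) B_bounded: "\<exists>M. \<forall>v. nrm (B v) \<le> M * norm v"
proof -
  obtain M where M: "\<And>f. nrm (lop W f) \<le> M * nrm f" using lop_bounded[OF near(3)] by blast
  have "nrm (B v) \<le> \<bar>M\<bar> * norm v" for v
  proof -
    have "nrm (B v) \<le> M * nrm (at_index 0 v :: 'p seq)" unfolding B_def by (rule M)
    also have "\<dots> \<le> \<bar>M\<bar> * norm v" by (intro mult_mono nrm_at_index_le nrm_nonneg) auto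
    finally show ?thesis .
  qed
  then show ?thesis by blast
qed

lemma (in jump) realization_data:
  assumes \<rho>: "0 < \<rho>" and \<sigma>: "\<tau> ** \<sigma> = mat (- of_real \<rho>)" "\<sigma> ** \<tau> = mat (- of_real \<rho>)"
    and a: "\<And>i j. summable (\<lambda>m. cmod (a i j m))"
    and Ta: "\<And>i j w. cmod w = 1 \<Longrightarrow> (\<lambda>m. a i j m * inverse w ^ m) sums T w $ i $ j"
    and Sa: "\<And>i j z. \<rho> < cmod z \<Longrightarrow> (\<lambda>m. a i j m * (of_real \<rho> / z) ^ m) sums S z $ i $ j"
  shows "realization_data \<rho> \<sigma> S X Y B B'"
  unfolding realization_data_def
proof (intro conjI allI impI)
  show "state \<rho> (X f) + X (cscale \<rho> (shift (-1) f)) + B (\<sigma> *v B' f) = 0" for f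
    unfolding state_def by (rule lyapunov_equation[OF \<sigma>(2)])
  show "S z *v v = v - B' (Y (res \<rho> z (B (\<sigma> *v v))))" if "\<rho> < cmod z" for z v
    by (rule realization_formula[OF \<rho> that \<sigma>(1) a Ta Sa[OF that]])
  show "B (v + w) = B v + B w" "B (c *s v) = cscale c (B v)" for v w c
    by (simp_all add: B_def at_index_simps lop_add lop_scale near)
qed (simp_all add: ell2_ops X_Y Y_X X_selfadjoint ip_B B_bounded)

lemma near_circle_continuous: "near_circle f \<Longrightarrow> continuous_on (sphere 0 1) f"
  unfolding near_circle_def by (meson continuous_on_subset holomorphic_on_imp_continuous_on)

lemma plus_supported_exp: "mnear (\<lambda>z. mat (\<omega> * exp (k * z)) :: complex ^ 'p ^ 'p)"
    "plus_supported (\<lambda>z. mat (\<omega> * exp (k * z)) :: complex ^ 'p ^ 'p)"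
proof -
  show "mnear (\<lambda>z. mat (\<omega> * exp (k * z)) :: complex ^ 'p ^ 'p)"
    by (intro mnear_mat near_circleI[of UNIV]) (auto intro!: holomorphic_intros)
  have "lcoef (\<lambda>z. \<omega> * exp (k * z)) n = (if 0 \<le> n then \<omega> * (k ^ nat n /\<^sub>R fact (nat n)) else 0)" for n
  proof (rule lcoef_power_series)
    show "summable (\<lambda>m. cmod (\<omega> * (k ^ m /\<^sub>R fact m)))"
      using summable_mult[OF summable_norm_exp[of k], of "cmod \<omega>"] by (simp only: norm_mult)
    show "(\<lambda>m. \<omega> * (k ^ m /\<^sub>R fact m) * z ^ m) sums (\<omega> * exp (k * z))" for z
      using sums_mult[OF exp_converges[of "k * z"], of \<omega>] by (simp add: power_mult_distrib mult_ac)
  qed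
  then have "lcoef (\<lambda>z. (mat (\<omega> * exp (k * z)) :: complex ^ 'p ^ 'p) $ i $ j) n = 0" if "n < 0" for i j n
    using that by (cases "i = j") (simp_all add: mat_def lcoef_const)
  then show "plus_supported (\<lambda>z. mat (\<omega> * exp (k * z)) :: complex ^ 'p ^ 'p)"
    by (simp add: plus_supported_def)
qed

lemma exists_realization_data:
  fixes \<sigma> :: "complex ^ 'p ^ 'p" and S :: "complex \<Rightarrow> complex ^ 'p ^ 'p"
  assumes \<sigma>: "cadjoint \<sigma> = \<sigma>" "invertible \<sigma>"
    and S: "analytic_at_infinity r S (mat 1)"
    and sym: "\<And>z. r < cmod z \<Longrightarrow> invertible (S (- cnj z)) \<and>
      S z = matrix_inv \<sigma> ** cadjoint (matrix_inv (S (- cnj z))) ** \<sigma>"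
    and \<rho>: "r < \<rho>"
  shows "\<exists>X Y B B'. realization_data \<rho> \<sigma> S X Y B B'"
proof -
  have r: "0 < r" using S by (simp add: analytic_at_infinity_def)
  define G where "G i j w = (if w = 0 then mat 1 else S (inverse w)) $ i $ j" for i j w
  have G: "G i j holomorphic_on ball 0 (inverse r)" for i j
    using S by (simp add: analytic_at_infinity_def G_def[abs_def])
  define c where "c i j m = (deriv ^^ m) (G i j) 0 / fact m" for i j m
  define a where "a i j m = c i j m * (1 / of_real \<rho>) ^ m" for i j m
  have c: "(\<lambda>m. c i j m * w ^ m) sums G i j w" if "cmod w < inverse r" for i j w
    using holomorphic_power_series[OF G, of w i j] that by (simp add: c_def)
  define T where "T w = S (of_real \<rho> * w)" for w
  have lt: "1 / \<rho> < inverse r" using r \<rho> by (simp add: field_simps)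
  have TG: "T w $ i $ j = G i j (inverse (of_real \<rho> * w))" if "w \<noteq> 0" for w i j
    using that r \<rho> by (simp add: T_def G_def)
  have Ta: "(\<lambda>m. a i j m * inverse w ^ m) sums T w $ i $ j" if "cmod w = 1" for i j w
  proof -
    have "w \<noteq> 0" using that by auto
    have "cmod (inverse (of_real \<rho> * w)) < inverse r"
      using that lt r \<rho> by (simp add: norm_mult norm_inverse divide_inverse)
    from c[OF this, of i j] show ?thesis
      by (simp add: TG[OF \<open>w \<noteq> 0\<close>] a_def power_inverse power_mult_distrib divide_inverse mult.assoc)
  qed
  have Sa: "(\<lambda>m. a i j m * (of_real \<rho> / z) ^ m) sums S z $ i $ j" if "\<rho> < cmod z" for i j z
  proof -
    have z: "z \<noteq> 0" "\<rho> \<noteq> 0" using that r \<rho> by auto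
    have "cmod (inverse z) < inverse r"
      unfolding norm_inverse by (rule less_imp_inverse_less) (use that r \<rho> in auto)
    from c[OF this, of i j] show ?thesis
      using z by (simp add: a_def G_def power_divide power_inverse divide_inverse power_mult_distrib mult_ac)
  qed
  have a: "summable (\<lambda>m. cmod (a i j m))" for i j
  proof -
    obtain x where x: "1 / \<rho> < x" "x < inverse r" using dense[OF lt] by blast
    have "0 < x" using x(1) r \<rho> by (smt (verit) divide_pos_pos)
    have "summable (\<lambda>m. c i j m * of_real x ^ m)"
      using c[of "of_real x" i j] x \<open>0 < x\<close> by (auto simp: sums_iff)
    then show ?thesis
      unfolding a_def by (rule powser_insidea) (use x \<open>0 < x\<close> r \<rho> in \<open>simp add: norm_divide\<close>)
  qed
  have T: "mnear T"
    unfolding mnear_def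
  proof (intro allI)
    fix i j
    define U where "U = {w. r / \<rho> < cmod w}"
    have U0: "w \<noteq> 0" if "w \<in> U" for w using that r \<rho> by (auto simp: U_def field_simps)
    have "(\<lambda>w. G i j (inverse (of_real \<rho> * w))) holomorphic_on U"
    proof (rule holomorphic_on_compose_gen[OF _ G, unfolded o_def])
      show "(\<lambda>w. inverse (of_real \<rho> * w)) holomorphic_on U"
        using U0 r \<rho> by (auto intro!: holomorphic_intros)
      show "(\<lambda>w. inverse (of_real \<rho> * w)) ` U \<subseteq> ball 0 (inverse r)"
      proof (clarify)
        fix w assume "w \<in> U"
        then have "r < \<rho> * cmod w" using r \<rho> by (simp add: U_def pos_divide_less_eq mult.commute)
        then have "inverse (\<rho> * cmod w) < inverse r" using r by (rule less_imp_inverse_less)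
        then show "inverse (of_real \<rho> * w) \<in> ball 0 (inverse r)"
          using r \<rho> by (simp add: norm_inverse norm_mult)
      qed
    qed
    then have "(\<lambda>w. T w $ i $ j) holomorphic_on U"
      by (rule holomorphic_transform) (use TG U0 in simp)
    moreover have "open U" unfolding U_def by (intro open_Collect_less continuous_intros)
    moreover have "sphere 0 1 \<subseteq> U" using r \<rho> by (auto simp: U_def)
    ultimately show "near_circle (\<lambda>w. T w $ i $ j)" by (intro near_circleI)
  qed
  have Tc: "lcoef (\<lambda>w. T w $ i $ j) n = (if n \<le> 0 then a i j (nat (- n)) else 0)" for i j n
    by (rule lcoef_power_series_inverse[OF a Ta])
  have T0: "lcoef (\<lambda>w. T w $ i $ j) 0 = mat 1 $ i $ j" for i j
    by (simp add: Tc a_def c_def G_def)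
  have inv: "invertible (S z)" if "r < cmod z" for z
    using sym[of "- cnj z"] that by simp
  have T_inv: "invertible (T z)" if "cmod z = 1" for z
    unfolding T_def by (rule inv) (use that r \<rho> in \<open>simp add: norm_mult\<close>)
  obtain \<omega> k where \<omega>: "cmod \<omega> = 1"
    and k: "\<And>z. cmod z = 1 \<Longrightarrow> invertible (T z - mat (\<omega> * exp (of_real k * z)))"
    by (rule exists_separating_exponential[OF near_circle_continuous[OF mnearD[OF T]] T_inv]) blast+
  define h where "h z = (mat (\<omega> * exp (of_real k * z)) :: complex ^ 'p ^ 'p)" for z
  have h: "mnear h" "plus_supported h"
    using plus_supported_exp[where 'p = 'p, of \<omega> "of_real k"] by (simp_all add: h_def[abs_def])
  obtain W0 where W0: "mnear W0" "\<And>z. cmod z = 1 \<Longrightarrow> W0 z = matrix_inv (T z - h z)"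
    by (rule mnear_inverse[OF mnear_diff[OF T h(1)] k[folded h_def]]) blast+
  define \<tau> where "\<tau> = mat (- of_real \<rho>) ** matrix_inv \<sigma>"
  define \<tau>' where "\<tau>' = mat (- 1 / of_real \<rho>) ** \<sigma>"
  have \<rho>0: "\<rho> \<noteq> 0" "0 < \<rho>" using r \<rho> by auto
  note \<sigma>_inv = matrix_inv_left[OF \<sigma>(2)] matrix_inv_right[OF \<sigma>(2)]
  have pull: "A ** mat x ** B = mat x ** (A ** B)" for A B :: "complex ^ 'p ^ 'p" and x
    by (metis mat_commute matrix_mul_assoc)
  have \<tau>\<sigma>: "\<tau> ** \<sigma> = mat (- of_real \<rho>)" "\<sigma> ** \<tau> = mat (- of_real \<rho>)"
    by (simp_all add: \<tau>_def \<sigma>_inv flip: matrix_mul_assoc)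
       (simp add: matrix_mul_assoc pull \<sigma>_inv)
  have \<tau>\<tau>': "\<tau> ** \<tau>' = mat 1" "\<tau>' ** \<tau> = mat 1"
  proof -
    show "\<tau> ** \<tau>' = mat 1"
      using \<rho>0 by (simp add: \<tau>'_def matrix_mul_assoc pull \<tau>\<sigma> mat_mult_mat)
    then show "\<tau>' ** \<tau> = mat 1" by (simp only: matrix_left_right_inverse)
  qed
  have \<sigma>_inv_adj: "cadjoint (matrix_inv \<sigma>) = matrix_inv \<sigma>"
  proof -
    have "cadjoint (matrix_inv \<sigma>) ** \<sigma> = mat 1"
      using \<sigma>_inv(2) \<sigma>(1) cadjoint_mult[of \<sigma> "matrix_inv \<sigma>"] by (simp add: cadjoint_mat)
    then show ?thesis using \<sigma>_inv by (metis matrix_mul_assoc matrix_mul_lid matrix_mul_rid)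
  qed
  have \<tau>_adj: "cadjoint \<tau> = \<tau>"
    by (simp add: \<tau>_def cadjoint_mult cadjoint_mat \<sigma>_inv_adj mat_commute)
  interpret jump T h "\<lambda>z. \<tau>' ** W0 z" \<tau> \<tau>'
  proof
    show "minus_supported T" by (simp add: minus_supported_def Tc)
    show "mnear (\<lambda>z. \<tau>' ** W0 z)" by (intro mnear_mult mnear_const W0)
    fix z :: complex assume z: "cmod z = 1"
    show "(T z - h z) ** \<tau> ** (\<tau>' ** W0 z) = mat 1"
      using matrix_inv_right[OF k[OF z]] \<tau>\<tau>'(1) W0(2)[OF z]
      by (simp add: h_def) (metis matrix_mul_assoc matrix_mul_rid)
    show "h z ** \<tau> ** cadjoint (h (- cnj z)) = \<tau>"
    proof -
      have "cadjoint (h (- cnj z)) = mat (cnj \<omega> * exp (- (of_real k * z)))"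
        by (simp add: h_def cadjoint_mat exp_cnj)
      then have "h z ** \<tau> ** cadjoint (h (- cnj z)) =
          mat (\<omega> * exp (of_real k * z) * (cnj \<omega> * exp (- (of_real k * z)))) ** \<tau>"
        by (simp add: h_def mat_commute[of _ \<tau>] mat_mult_mat flip: matrix_mul_assoc)
      moreover have "\<omega> * exp (of_real k * z) * (cnj \<omega> * exp (- (of_real k * z))) = 1"
      proof -
        have "\<omega> * cnj \<omega> = 1" using complex_norm_square[of \<omega>] \<omega> by simp
        moreover have "exp (of_real k * z) * exp (- (of_real k * z)) = 1"
          by (simp flip: exp_add)
        ultimately show ?thesis by (metis mult.assoc mult.left_commute mult.right_neutral)
      qed
      ultimately show ?thesis by simp
    qed
    show "T z ** \<tau> ** cadjoint (T (- cnj z)) = \<tau>"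
    proof -
      define A where "A = S (- cnj (of_real \<rho> * z))"
      have "r < cmod (of_real \<rho> * z)" using z r \<rho> by (simp add: norm_mult)
      from sym[OF this] have A: "invertible A"
        and TA: "T z = matrix_inv \<sigma> ** cadjoint (matrix_inv A) ** \<sigma>"
        by (simp_all add: A_def T_def)
      have "T (- cnj z) = A" by (simp add: A_def T_def)
      moreover have "cadjoint (matrix_inv A) ** cadjoint A = mat 1"
        using matrix_inv_right[OF A] cadjoint_mult[of A "matrix_inv A"] by (simp add: cadjoint_mat)
      moreover have "T z ** \<tau> = mat (- of_real \<rho>) ** (matrix_inv \<sigma> ** cadjoint (matrix_inv A))"
        by (simp add: TA \<tau>\<sigma> mat_commute flip: matrix_mul_assoc)
      ultimately show ?thesis
        by (simp add: \<tau>_def flip: matrix_mul_assoc)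
    qed
  qed (use T T0 h \<tau>_adj \<tau>\<tau>' in auto)
  show ?thesis
    using realization_data[OF \<rho>0(2) \<tau>\<sigma> a Ta Sa] by blast
qed

section \<open>Transport to functions on the real line\<close>

definition ell2_embed :: "'i::countable ell2 \<Rightarrow> real \<Rightarrow> complex" where
  "ell2_embed f x = (if x \<in> range (\<lambda>i::'i. real (to_nat i)) then coord f (from_nat (nat \<lfloor>x\<rfloor>)) else 0)"

definition ell2_hilbert :: "'i::countable itself \<Rightarrow> (real \<Rightarrow> complex) hilbert" where
  "ell2_hilbert _ = \<lparr>hcarrier = range (ell2_embed :: 'i ell2 \<Rightarrow> _), hscale = (\<lambda>c f x. c * f x),
     hinner = (\<lambda>f g. ip (inv ell2_embed f :: 'i ell2) (inv ell2_embed g))\<rparr>"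

lemma ell2_embed_to_nat: "ell2_embed f (real (to_nat i)) = coord f i"
  by (auto simp: ell2_embed_def)

lemma inj_ell2_embed: "inj ell2_embed"
  by (rule injI, rule ell2_eqI) (metis ell2_embed_to_nat)

lemma ell2_embed_simps:
  "ell2_embed (f + g) = ell2_embed f + ell2_embed g" "ell2_embed (f - g) = ell2_embed f - ell2_embed g"
  "ell2_embed (cscale c f) = (\<lambda>x. c * ell2_embed f x)" "ell2_embed 0 = 0"
  by (auto simp: ell2_embed_def fun_eq_iff)

lemma inv_ell2_embed [simp]: "inv ell2_embed (ell2_embed f) = f"
  by (rule inv_f_f[OF inj_ell2_embed])

context
  fixes K :: "(real \<Rightarrow> complex) hilbert" and ty :: "'i::countable itself"
  assumes K: "K = ell2_hilbert ty"
begin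

lemma K_carrier: "hcarrier K = range (ell2_embed :: 'i ell2 \<Rightarrow> _)"
  and K_scale: "hscale K c (ell2_embed (f :: 'i ell2)) = ell2_embed (cscale c f)"
  and K_inner: "hinner K (ell2_embed (f :: 'i ell2)) (ell2_embed g) = ip f g"
  by (simp_all add: K ell2_hilbert_def ell2_embed_simps)

lemma K_norm: "hnorm K (ell2_embed (f :: 'i ell2)) = nrm f"
  by (simp add: hnorm_def K_inner ip_self nrm_nonneg)

lemma hilbert_space_K: "hilbert_space K"
  unfolding hilbert_space_def
proof (intro conjI)
  show V: "vector_space (hscale K)"
    by (simp add: K ell2_hilbert_def vector_space_def fun_eq_iff algebra_simps)
  interpret vector_space "hscale K" by (rule V)
  show "module.subspace (hscale K) (hcarrier K)"
  proof (rule subspaceI)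
    show "0 \<in> hcarrier K"
      unfolding K_carrier by (rule range_eqI[of _ _ 0]) (simp add: ell2_embed_simps)
  qed (auto simp: K_carrier K_scale simp flip: ell2_embed_simps(1))
  show "\<forall>s. (\<forall>n. s n \<in> hcarrier K) \<and> (\<forall>e>0. \<exists>N. \<forall>m\<ge>N. \<forall>n\<ge>N. hnorm K (s m - s n) < e) \<longrightarrow>
      (\<exists>l\<in>hcarrier K. (\<lambda>n. hnorm K (s n - l)) \<longlonglongrightarrow> 0)"
  proof (intro allI impI, elim conjE)
    fix s :: "nat \<Rightarrow> real \<Rightarrow> complex" assume "\<forall>n. s n \<in> hcarrier K"
    then have "\<forall>n. \<exists>f :: 'i ell2. s n = ell2_embed f" by (auto simp: K_carrier)
    then obtain f :: "nat \<Rightarrow> 'i ell2" where s: "s = (\<lambda>n. ell2_embed (f n))" by metis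
    assume "\<forall>e>0. \<exists>N. \<forall>m\<ge>N. \<forall>n\<ge>N. hnorm K (s m - s n) < e"
    then have "\<exists>l. (\<lambda>n. nrm (f n - l)) \<longlonglongrightarrow> 0"
      by (intro ell2_complete) (simp add: s K_norm flip: ell2_embed_simps)
    then obtain l where "(\<lambda>n. nrm (f n - l)) \<longlonglongrightarrow> 0" ..
    then have "(\<lambda>n. hnorm K (s n - ell2_embed l)) \<longlonglongrightarrow> 0"
      by (simp add: s K_norm flip: ell2_embed_simps)
    then show "\<exists>l\<in>hcarrier K. (\<lambda>n. hnorm K (s n - l)) \<longlonglongrightarrow> 0"
      by (auto simp: K_carrier)
  qed
  show "\<forall>x\<in>hcarrier K. \<forall>y\<in>hcarrier K. \<forall>z\<in>hcarrier K.
      hinner K (x + y) z = hinner K x z + hinner K y z"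
    by (auto simp: K_carrier K_inner ip_add_left simp flip: ell2_embed_simps(1))
  show "\<forall>c. \<forall>x\<in>hcarrier K. \<forall>y\<in>hcarrier K. hinner K (hscale K c x) y = c * hinner K x y"
    by (auto simp: K_carrier K_inner K_scale ip_scale_left)
  show "\<forall>x\<in>hcarrier K. \<forall>y\<in>hcarrier K. hinner K y x = cnj (hinner K x y)"
    by (auto simp: K_carrier K_inner intro: ip_sym)
  show "\<forall>x\<in>hcarrier K. x \<noteq> 0 \<longrightarrow> Re (hinner K x x) > 0"
  proof (intro ballI impI)
    fix x assume "x \<in> hcarrier K" "x \<noteq> 0"
    then obtain f :: "'i ell2" where x: "x = ell2_embed f" by (auto simp: K_carrier)
    then have "f \<noteq> 0" using \<open>x \<noteq> 0\<close> by (auto simp: ell2_embed_simps)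
    then show "Re (hinner K x x) > 0" using nrm_pos[of f] by (simp add: x K_inner ip_self)
  qed
qed

lemma bounded_op_K:
  assumes F: "ell2_op F" and F': "\<And>f. F' (ell2_embed (f :: 'i ell2)) = ell2_embed (F f)"
  shows "bounded_op K K F'"
  using F unfolding bounded_op_def ell2_op_def
  by (auto simp: K_carrier K_scale K_norm F' simp flip: ell2_embed_simps(1))

lemma hadjoint_K:
  assumes "\<And>f. ip (F f) (g :: 'i ell2) = ip (f :: 'i ell2) g'" "\<And>f. F' (ell2_embed f) = ell2_embed (F f)"
  shows "hadjoint K K F' (ell2_embed g) = ell2_embed g'"
  by (rule hadjoint_eqI[OF hilbert_space_K]) (auto simp: K_carrier K_inner assms)

lemma
  assumes F: "ell2_op F" and G: "ell2_op G" and FG: "\<And>f. F (G f) = f" and GF: "\<And>f. G (F f) = f"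
    and F': "\<And>f. F' (ell2_embed (f :: 'i ell2)) = ell2_embed (F f)"
  shows hinverse_K: "hinverse K F' (ell2_embed f) = ell2_embed (G f)"
    and invertible_op_K: "invertible_op K F'"
proof -
  have inj: "inj_on F' (hcarrier K)"
  proof (rule inj_onI)
    fix x y assume "x \<in> hcarrier K" "y \<in> hcarrier K" "F' x = F' y"
    then obtain f g :: "'i ell2" where "x = ell2_embed f" "y = ell2_embed g" "ell2_embed (F f) = ell2_embed (F g)"
      by (auto simp: K_carrier F')
    then show "x = y" using GF by (metis inv_ell2_embed)
  qed
  show inv: "hinverse K F' (ell2_embed f) = ell2_embed (G f)" for f
    unfolding hinverse_def by (rule inv_into_f_eq[OF inj]) (auto simp: K_carrier F' FG)
  have "F' ` hcarrier K = hcarrier K"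
  proof (intro equalityI subsetI)
    fix x assume "x \<in> hcarrier K"
    then obtain f :: "'i ell2" where "x = ell2_embed f" by (auto simp: K_carrier)
    then have "x = F' (ell2_embed (G f))" by (simp add: F' FG)
    then show "x \<in> F' ` hcarrier K" by (auto simp: K_carrier)
  qed (auto simp: K_carrier F')
  then show "invertible_op K F'"
    unfolding invertible_op_def bij_betw_def
    using inj bounded_op_K[OF F F'] bounded_op_K[OF G inv] by blast
qed

end

theorem theorem6p2:
  fixes I :: "real set"
    and \<sigma>\<^sub>1 :: "real \<Rightarrow> complex ^ 'p ^ 'p"
    and S :: "complex \<Rightarrow> real \<Rightarrow> complex ^ 'p ^ 'p"
    and r :: real
  assumes "is_interval I"
    and "\<sigma>\<^sub>1 differentiable_on I"
    and "\<And>t. t \<in> I \<Longrightarrow> cadjoint (\<sigma>\<^sub>1 t) = \<sigma>\<^sub>1 t \<and> invertible (\<sigma>\<^sub>1 t)"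
    and "\<And>t. t \<in> I \<Longrightarrow> analytic_at_infinity r (\<lambda>z. S z t) (mat 1)"
    and "\<And>t z. t \<in> I \<Longrightarrow> r < cmod z \<Longrightarrow>
           invertible (S (- cnj z) t) \<and>
           S z t = matrix_inv (\<sigma>\<^sub>1 t) ** cadjoint (matrix_inv (S (- cnj z) t)) ** \<sigma>\<^sub>1 t"
  shows "\<exists>(K :: (real \<Rightarrow> complex) hilbert) A\<^sub>1 B X.
           krein_data I K A\<^sub>1 B X \<and>
           (\<exists>\<rho>\<ge>r. realizes_on \<rho> I \<sigma>\<^sub>1 S K A\<^sub>1 B X) \<and>
           lyapunov I \<sigma>\<^sub>1 K A\<^sub>1 B X"
proof -
  define \<rho> where "\<rho> = 2 * \<bar>r\<bar> + 1"
  have \<rho>: "r < \<rho>" "0 < \<rho>" by (auto simp: \<rho>_def)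
  have "\<forall>t\<in>I. \<exists>X Y B B'. realization_data \<rho> (\<sigma>\<^sub>1 t) (\<lambda>z. S z t) X Y B B'"
    using assms(3-5) \<rho>(1) by (intro ballI exists_realization_data) blast+
  then obtain X Y B B' where D: "\<And>t. t \<in> I \<Longrightarrow> realization_data \<rho> (\<sigma>\<^sub>1 t) (\<lambda>z. S z t) (X t) (Y t) (B t) (B' t)"
    by metis
  define K where "K = ell2_hilbert TYPE(int \<times> 'p)"
  define A\<^sub>1 :: "(real \<Rightarrow> complex) \<Rightarrow> real \<Rightarrow> complex"
    where "A\<^sub>1 x = ell2_embed (state \<rho> (inv ell2_embed x :: 'p seq))" for x
  define Xe :: "real \<Rightarrow> (real \<Rightarrow> complex) \<Rightarrow> real \<Rightarrow> complex"
    where "Xe t x = ell2_embed (X t (inv ell2_embed x))" for t x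
  define Be where "Be t v = ell2_embed (B t v)" for t v
  have A: "A\<^sub>1 (ell2_embed f) = ell2_embed (state \<rho> f)" for f :: "'p seq" by (simp add: A\<^sub>1_def)
  have Xe: "Xe t (ell2_embed f) = ell2_embed (X t f)" for t f by (simp add: Xe_def)
  note carrier = K_carrier[OF K_def]
  have adjA: "hadjoint K K A\<^sub>1 (ell2_embed f) = ell2_embed (cscale \<rho> (shift (-1) f))" for f :: "'p seq"
    by (rule hadjoint_K[OF K_def ip_state A])
  have adjB: "hadjoint cspace K (Be t) (ell2_embed f) = B' t f" if "t \<in> I" for t f
  proof (rule hadjoint_eqI[OF hilbert_space_cspace])
    show "B' t f \<in> hcarrier cspace" by (simp add: cspace_def)
    show "hinner K (Be t u) (ell2_embed f) = hinner cspace u (B' t f)" for u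
      using D[OF that] by (simp add: Be_def K_inner[OF K_def] realization_data_def)
  qed
  have invX: "hinverse K (Xe t) (ell2_embed f) = ell2_embed (Y t f)" "invertible_op K (Xe t)" if "t \<in> I" for t f
  proof -
    have X: "ell2_op (X t)" "ell2_op (Y t)" "\<And>f. X t (Y t f) = f" "\<And>f. Y t (X t f) = f"
      using D[OF that] by (simp_all add: realization_data_def)
    show "hinverse K (Xe t) (ell2_embed f) = ell2_embed (Y t f)"
      by (rule hinverse_K[OF K_def X]) (rule Xe)
    show "invertible_op K (Xe t)"
      by (rule invertible_op_K[OF K_def X]) (rule Xe)
  qed
  have sA: "hscale K z (ell2_embed f) - A\<^sub>1 (ell2_embed f) = ell2_embed (cscale z f - state \<rho> f)" for z and f :: "'p seq"
    by (simp add: K_scale[OF K_def] A ell2_embed_simps)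
  have opA: "ell2_op (\<lambda>f :: 'p seq. cscale z f - state \<rho> f)" for z
    by (intro ell2_op_diff ell2_op_cscale ell2_op_state)
  have resolv: "invertible_op K (\<lambda>x. hscale K z x - A\<^sub>1 x)"
      "resolvent K A\<^sub>1 z (ell2_embed f) = ell2_embed (res \<rho> z f)" if "\<rho> < cmod z" for z and f :: "'p seq"
    unfolding resolvent_def
    by (rule invertible_op_K[OF K_def opA ell2_op_res[OF \<rho>(2) that] res_right[OF \<rho>(2) that]
          res_left[OF \<rho>(2) that] sA])
       (rule hinverse_K[OF K_def opA ell2_op_res[OF \<rho>(2) that] res_right[OF \<rho>(2) that]
          res_left[OF \<rho>(2) that] sA])
  have "krein_data I K A\<^sub>1 Be Xe"
    unfolding krein_data_def
  proof (intro conjI ballI)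
    show "hilbert_space K" by (rule hilbert_space_K[OF K_def])
    show "bounded_op K K A\<^sub>1" by (rule bounded_op_K[OF K_def ell2_op_state A])
    fix t assume t: "t \<in> I"
    note Dt = D[OF t, unfolded realization_data_def]
    show "invertible_op K (Xe t)" by (rule invX[OF t])
    show "bounded_op cspace K (Be t)"
      using Dt unfolding bounded_op_def hnorm_cspace
      by (auto simp: Be_def carrier ell2_embed_simps K_scale[OF K_def] K_norm[OF K_def] cspace_def)
    have X: "ell2_op (X t)" "\<And>f g. ip (X t f) g = ip f (X t g)" using Dt by blast+
    have "bounded_op K K (Xe t)" by (rule bounded_op_K[OF K_def X(1)]) (rule Xe)
    moreover have "hadjoint K K (Xe t) (ell2_embed g) = ell2_embed (X t g)" for g
      by (rule hadjoint_K[OF K_def X(2)]) (rule Xe)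
    ultimately show "selfadjoint_op K (Xe t)"
      unfolding selfadjoint_op_def by (auto simp: carrier Xe)
  qed
  moreover have "realizes_on \<rho> I \<sigma>\<^sub>1 S K A\<^sub>1 Be Xe"
    unfolding realizes_on_def
  proof (intro ballI allI impI conjI)
    fix t z v assume t: "t \<in> I" and z: "\<rho> < cmod z"
    show "invertible_op K (\<lambda>x. hscale K z x - A\<^sub>1 x)" by (rule resolv[OF z])
    show "S z t *v v = v - hadjoint cspace K (Be t)
        (hinverse K (Xe t) (resolvent K A\<^sub>1 z (Be t (\<sigma>\<^sub>1 t *v v))))"
      using D[OF t] z unfolding realization_data_def
      by (simp add: Be_def[of t "\<sigma>\<^sub>1 t *v v"] resolv(2)[OF z] invX(1)[OF t] adjB[OF t])
  qed
  moreover have "lyapunov I \<sigma>\<^sub>1 K A\<^sub>1 Be Xe"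
    unfolding lyapunov_def
  proof (intro ballI)
    fix t x assume t: "t \<in> I" and "x \<in> hcarrier K"
    then obtain f :: "'p seq" where x: "x = ell2_embed f" by (auto simp: carrier)
    have "state \<rho> (X t f) + X t (cscale \<rho> (shift (-1) f)) + B t (\<sigma>\<^sub>1 t *v B' t f) = 0"
      using D[OF t] by (simp add: realization_data_def)
    then show "A\<^sub>1 (Xe t x) + Xe t (hadjoint K K A\<^sub>1 x) + Be t (\<sigma>\<^sub>1 t *v hadjoint cspace K (Be t) x) = 0"
      by (simp add: x Xe A adjA adjB[OF t] Be_def ell2_embed_simps(4) flip: ell2_embed_simps(1))
  qed
  ultimately show ?thesis using \<rho>(1) less_imp_le by blast
qed

end
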